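(* Let $A=(A_1,\dots,A_g)\in M_d(\mathbb C)^g$ and assume $A$ is linearly independent. Let $\mathcal A$ denote the algebra spanned by the tuple $A$. If $C_1,\dots,C_h\in M_d(\mathbb C)$ and the tuple $J=(J_1,\dots,J_{g+h})=(A_1,\dots,A_g,C_1,\dots,C_h)$ is linearly independent and spans $\mathcal A$, then there is a (free) rational map $f$ in $g$ variables with $g+h$ components such that $f(0)=0$, $f'(0)[x]=(x,0)$, and (1) $f$ is an injective proper map from $\operatorname{int}(\mathcal D_A)$ into $\operatorname{int}(\mathcal B_J)$; and (2) $f$ maps the boundary of $\mathcal D_A$ into the boundary of $\mathcal B_J$. Further, the tuple $\Xi\in M_{g+h}(\mathbb C)^{g+h}$ uniquely determined by $$J_kJ_j=\sum_{s=1}^{g+h}(\Xi_j)_{k,s}J_s\qquad(1\le j,k\le g+h)$$ is convexotonic, and $$f(x)=\begin{pmatrix}x_1&\cdots&x_g&0&\cdots&0\end{pmatrix}\Big(I+\sum_{j=1}^g\Xi_jx_j\Big)^{-1}.$$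
   Context: $M_n(\mathbb C)^g$ is the set of $g$-tuples of $n\times n$ complex matrices. For a tuple $A\in M_d(\mathbb C)^m$ and $X\in M_n(\mathbb C)^m$ let $\Lambda_A(X)=\sum_jA_j\otimes X_j$. The free spectrahedron is $\mathcal D_A=(\mathcal D_A(n))_n$ with $\mathcal D_A(n)=\{X\in M_n(\mathbb C)^m:I+\Lambda_A(X)+\Lambda_A(X)^*\succeq0\}$, and the spectraball is $\mathcal B_A=(\mathcal B_A(n))_n$ with $\mathcal B_A(n)=\{X\in M_n(\mathbb C)^m:\|\Lambda_A(X)\|\le1\}$ (so here $\mathcal D_A$ lives in $g$ variables and $\mathcal B_J$ in $g+h$ variables). Interiors and boundaries are taken levelwise, i.e. for each $n$. A tuple is linearly independent if its entries are linearly independent matrices. The algebra $\mathcal A$ spanned by $A$ is the (not necessarily unital) algebra generated by $A_1,\dots,A_g$, i.e. the smallest subalgebra of $M_d(\mathbb C)$ containing them; $J$ spans $\mathcal A$ means that $\mathcal A$ is the linear span of $\{J_1,\dots,J_{g+h}\}$. A tuple $\Xi\in M_m(\mathbb C)^m$ is convexotonic if $\Xi_k\Xi_j=\sum_{s=1}^m(\Xi_j)_{k,s}\Xi_s$ for all $1\le j,k\le m$. The formula for $f$ is evaluated at $X\in M_n(\mathbb C)^g$, for which $I+\sum_{j=1}^g\Xi_j\otimes X_j$ is invertible, by $f^i(X)=\sum_{j=1}^gX_j\,[(I+\sum_{k=1}^g\Xi_k\otimes X_k)^{-1}]_{j,i}$ for $1\le i\le g+h$, where $[\,\cdot\,]_{j,i}$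 is the $(j,i)$ block, of size $n\times n$, of the $(g+h)\times(g+h)$ block matrix. A free rational map (regular at $0$) is a map each of whose components can be written as $c^*(I-\Lambda_S(x))^{-1}b$ for some positive integer $s$, $S\in M_s(\mathbb C)^g$ and $b,c\in\mathbb C^s$. $f'(0)$ denotes the derivative of $f$ at $0$ (at each level). A free mapping $f:\mathcal U\to\mathcal V$ between open free sets is proper if for each $n$ the map $f_n:\mathcal U_n\to\mathcal V_n$ is proper (inverse images of compact sets are compact). *)

theory Defs
  imports
    "HOL-Analysis.Abstract_Metric_Spaces"
    "HOL-Analysis.L2_Norm"
    "Jordan_Normal_Form.Schur_Decomposition"
begin

text \<open>
  The size \<open>n\<close> of the matrices at which a free map is evaluated varies inside a single statement, so
  matrices are taken from \<^theory>\<open>Jordan_Normal_Form.Matrix\<close>.  A tuple in \<open>M_n(C)^m\<close> is a list of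
  length \<open>m\<close>; list and matrix positions are counted from 0.
\<close>

definition mtuples :: "nat \<Rightarrow> nat \<Rightarrow> complex mat list set" where
  "mtuples n m = {X. length X = m \<and> set X \<subseteq> carrier_mat n n}"

definition mat_sum :: "nat \<Rightarrow> nat \<Rightarrow> complex mat list \<Rightarrow> complex mat" where
  "mat_sum nr nc Ms = foldr (+) Ms (0\<^sub>m nr nc)"

definition lin_comb :: "nat \<Rightarrow> (nat \<Rightarrow> complex) \<Rightarrow> complex mat list \<Rightarrow> complex mat" where
  "lin_comb d c T = mat_sum d d (map (\<lambda>s. c s \<cdot>\<^sub>m T ! s) [0..<length T])"

definition lin_indep_tuple :: "nat \<Rightarrow> complex mat list \<Rightarrow> bool" where
  "lin_indep_tuple d T \<longleftrightarrow> (\<forall>c. lin_comb d c T = 0\<^sub>m d d \<longrightarrow> (\<forall>s<length T. c s = 0))"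

definition tuple_span :: "nat \<Rightarrow> complex mat list \<Rightarrow> complex mat set" where
  "tuple_span d T = range (\<lambda>c. lin_comb d c T)"

text \<open>Subalgebras need not contain the identity matrix.\<close>

definition mat_subalgebra :: "nat \<Rightarrow> complex mat set \<Rightarrow> bool" where
  "mat_subalgebra d S \<longleftrightarrow> S \<subseteq> carrier_mat d d \<and> 0\<^sub>m d d \<in> S \<and>
     (\<forall>M\<in>S. \<forall>N\<in>S. M + N \<in> S \<and> M * N \<in> S) \<and> (\<forall>a. \<forall>M\<in>S. a \<cdot>\<^sub>m M \<in> S)"

definition generated_algebra :: "nat \<Rightarrow> complex mat list \<Rightarrow> complex mat set" where
  "generated_algebra d T = \<Inter> {S. mat_subalgebra d S \<and> set T \<subseteq> S}"

text \<open>Block convention: \<open>kron M N\<close> is the block matrix with blocks \<open>M_{ik} N\<close>.\<close>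

definition kron :: "complex mat \<Rightarrow> complex mat \<Rightarrow> complex mat" where
  "kron M N = Matrix.mat (dim_row M * dim_row N) (dim_col M * dim_col N)
     (\<lambda>(i, k). M $$ (i div dim_row N, k div dim_col N) * N $$ (i mod dim_row N, k mod dim_col N))"

definition Lam :: "nat \<Rightarrow> nat \<Rightarrow> complex mat list \<Rightarrow> complex mat list \<Rightarrow> complex mat" where
  "Lam d n T X = mat_sum (d * n) (d * n) (map2 kron T X)"

definition pos_semidef :: "complex mat \<Rightarrow> bool" where
  "pos_semidef M \<longleftrightarrow> dim_row M = dim_col M \<and> mat_adjoint M = M \<and>
     (\<forall>v\<in>carrier_vec (dim_col M). 0 \<le> Re ((M *\<^sub>v v) \<bullet>c v))"

definition vnorm :: "complex vec \<Rightarrow> real" where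
  "vnorm v = L2_set (\<lambda>i. cmod (vec_index v i)) {..<dim_vec v}"

definition op_norm :: "complex mat \<Rightarrow> real" where
  "op_norm M = (SUP v\<in>{v \<in> carrier_vec (dim_col M). vnorm v \<le> 1}. vnorm (M *\<^sub>v v))"

text \<open>\<open>op_norm\<close> is a supremum of a nonempty set that is bounded above, hence not a junk value.\<close>

lemma op_norm_bdd_above:
  "bdd_above ((\<lambda>v. vnorm (M *\<^sub>v v)) ` {v \<in> carrier_vec (dim_col M). vnorm v \<le> 1})"
proof (rule bdd_aboveI2)
  fix v assume v: "v \<in> {v \<in> carrier_vec (dim_col M). vnorm v \<le> 1}"
  have entry: "cmod (vec_index v k) \<le> 1" if "k < dim_col M" for k
  proof -
    have "cmod (vec_index v k) \<le> vnorm v"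
      unfolding vnorm_def using v that by (intro member_le_L2_set) auto
    then show ?thesis using v by simp
  qed
  have "vnorm (M *\<^sub>v v) \<le> (\<Sum>i<dim_row M. cmod (vec_index (M *\<^sub>v v) i))"
    unfolding vnorm_def dim_mult_mat_vec by (rule L2_set_le_sum) simp
  also have "\<dots> \<le> (\<Sum>i<dim_row M. \<Sum>k<dim_col M. cmod (M $$ (i, k)))"
  proof (rule sum_mono)
    fix i assume "i \<in> {..<dim_row M}"
    then have "vec_index (M *\<^sub>v v) i = (\<Sum>k<dim_col M. M $$ (i, k) * vec_index v k)"
      using v by (auto simp: scalar_prod_def atLeast0LessThan intro!: sum.cong)
    also have "cmod \<dots> \<le> (\<Sum>k<dim_col M. cmod (M $$ (i, k)) * cmod (vec_index v k))"
      by (rule order_trans[OF norm_sum]) (simp add: norm_mult)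
    also have "\<dots> \<le> (\<Sum>k<dim_col M. cmod (M $$ (i, k)))"
      by (rule sum_mono) (use entry in \<open>auto intro!: mult_left_le\<close>)
    finally show "cmod (vec_index (M *\<^sub>v v) i) \<le> (\<Sum>k<dim_col M. cmod (M $$ (i, k)))" .
  qed
  finally show "vnorm (M *\<^sub>v v) \<le> (\<Sum>i<dim_row M. \<Sum>k<dim_col M. cmod (M $$ (i, k)))" .
qed

definition free_spectrahedron :: "nat \<Rightarrow> complex mat list \<Rightarrow> nat \<Rightarrow> complex mat list set" where
  "free_spectrahedron d T n = {X \<in> mtuples n (length T).
     pos_semidef (1\<^sub>m (d * n) + Lam d n T X + mat_adjoint (Lam d n T X))}"

definition spectraball :: "nat \<Rightarrow> complex mat list \<Rightarrow> nat \<Rightarrow> complex mat list set" where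
  "spectraball d T n = {X \<in> mtuples n (length T). op_norm (Lam d n T X) \<le> 1}"

text \<open>
  The Euclidean metric on \<open>M_n(C)^m\<close>; the type \<^typ>\<open>complex mat list\<close> carries no topology of its own.
\<close>

definition mtuple_dist :: "nat \<Rightarrow> nat \<Rightarrow> complex mat list \<Rightarrow> complex mat list \<Rightarrow> real" where
  "mtuple_dist n m X Y =
     L2_set (\<lambda>(j, r, c). cmod (X ! j $$ (r, c) - Y ! j $$ (r, c))) ({..<m} \<times> {..<n} \<times> {..<n})"

definition mtuple_zero :: "nat \<Rightarrow> nat \<Rightarrow> complex mat list" where
  "mtuple_zero n m = replicate m (0\<^sub>m n n)"

definition mtuple_norm :: "nat \<Rightarrow> nat \<Rightarrow> complex mat list \<Rightarrow> real" where
  "mtuple_norm n m X = mtuple_dist n m X (mtuple_zero n m)"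

lemma Metric_space_mtuples: "Metric_space (mtuples n m) (mtuple_dist n m)"
proof
  fix X Y
  show "0 \<le> mtuple_dist n m X Y" by (simp add: mtuple_dist_def)
  show "mtuple_dist n m X Y = mtuple_dist n m Y X"
    by (simp add: mtuple_dist_def norm_minus_commute)
next
  fix X Y assume X: "X \<in> mtuples n m" and Y: "Y \<in> mtuples n m"
  have "X = Y" if eq: "\<And>j r c. j < m \<Longrightarrow> r < n \<Longrightarrow> c < n \<Longrightarrow> X ! j $$ (r, c) = Y ! j $$ (r, c)"
  proof (rule nth_equalityI)
    show "length X = length Y" using X Y by (simp add: mtuples_def)
    fix j assume "j < length X"
    then have j: "j < m" using X by (simp add: mtuples_def)
    have "X ! j \<in> carrier_mat n n" "Y ! j \<in> carrier_mat n n"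
      using X Y j by (auto simp: mtuples_def)
    then show "X ! j = Y ! j" using eq j by (intro eq_matI) auto
  qed
  then show "mtuple_dist n m X Y = 0 \<longleftrightarrow> X = Y"
    by (auto simp: mtuple_dist_def L2_set_eq_0_iff)
next
  fix X Y Z
  have "mtuple_dist n m X Z \<le>
    L2_set (\<lambda>p. (\<lambda>(j, r, c). cmod (X ! j $$ (r, c) - Y ! j $$ (r, c))) p +
      (\<lambda>(j, r, c). cmod (Y ! j $$ (r, c) - Z ! j $$ (r, c))) p) ({..<m} \<times> {..<n} \<times> {..<n})"
    unfolding mtuple_dist_def
  proof (rule L2_set_mono)
    fix p assume "p \<in> {..<m} \<times> {..<n} \<times> {..<n}"
    show "(case p of (j, r, c) \<Rightarrow> cmod (X ! j $$ (r, c) - Z ! j $$ (r, c))) \<le>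
       (case p of (j, r, c) \<Rightarrow> cmod (X ! j $$ (r, c) - Y ! j $$ (r, c))) +
       (case p of (j, r, c) \<Rightarrow> cmod (Y ! j $$ (r, c) - Z ! j $$ (r, c)))"
      by (auto split: prod.split intro: norm_diff_triangle_le)
  qed (auto split: prod.split)
  also have "\<dots> \<le> mtuple_dist n m X Y + mtuple_dist n m Y Z"
    unfolding mtuple_dist_def by (rule L2_set_triangle_ineq)
  finally show "mtuple_dist n m X Z \<le> mtuple_dist n m X Y + mtuple_dist n m Y Z" .
qed

definition mtuple_topology :: "nat \<Rightarrow> nat \<Rightarrow> complex mat list topology" where
  "mtuple_topology n m = Metric_space.mtopology (mtuples n m) (mtuple_dist n m)"

definition linear_mtuple_map ::
  "nat \<Rightarrow> nat \<Rightarrow> nat \<Rightarrow> (complex mat list \<Rightarrow> complex mat list) \<Rightarrow> bool" where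
  "linear_mtuple_map n p q D \<longleftrightarrow>
     (\<forall>X\<in>mtuples n p. D X \<in> mtuples n q) \<and>
     (\<forall>X\<in>mtuples n p. \<forall>Y\<in>mtuples n p. D (map2 (+) X Y) = map2 (+) (D X) (D Y)) \<and>
     (\<forall>a. \<forall>X\<in>mtuples n p. D (map ((\<cdot>\<^sub>m) a) X) = map ((\<cdot>\<^sub>m) a) (D X))"

text \<open>
  Frechet derivative at \<open>X\<close> of a partial map from \<open>M_n(C)^p\<close> to \<open>M_n(C)^q\<close>; the map has to be
  defined near \<open>X\<close>.
\<close>

definition mtuple_has_derivative ::
  "nat \<Rightarrow> nat \<Rightarrow> nat \<Rightarrow> (complex mat list \<rightharpoonup> complex mat list) \<Rightarrow>
   (complex mat list \<Rightarrow> complex mat list) \<Rightarrow> complex mat list \<Rightarrow> bool" where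
  "mtuple_has_derivative n p q F D X \<longleftrightarrow> linear_mtuple_map n p q D \<and>
     (\<forall>\<epsilon>>0. \<exists>\<delta>>0. \<forall>H\<in>mtuples n p. mtuple_norm n p H < \<delta> \<longrightarrow>
        map2 (+) X H \<in> dom F \<and>
        mtuple_dist n q (the (F (map2 (+) X H))) (map2 (+) (the (F X)) (D H))
          \<le> \<epsilon> * mtuple_norm n p H)"

text \<open>
  The value at \<open>X\<close>, a tuple of \<open>n\<close> by \<open>n\<close> matrices, of \<open>c^* (I - Lam_S(x))^{-1} b\<close>: the scalar
  vectors \<open>c^*\<close> and \<open>b\<close> are inflated by a Kronecker product with the identity matrix.
\<close>

definition realization_value ::
  "nat \<Rightarrow> complex mat list \<Rightarrow> complex vec \<Rightarrow> complex vec \<Rightarrow> nat \<Rightarrow> complex mat list \<Rightarrow> complex mat" where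
  "realization_value s S b c n X =
     kron (mat_adjoint (mat_of_cols s [c])) (1\<^sub>m n) *
     the (mat_inverse (1\<^sub>m (s * n) - Lam s n S X)) *
     kron (mat_of_cols s [b]) (1\<^sub>m n)"

text \<open>
  A free map is given by its levels \<open>f n\<close>, which are partial maps.  A free rational map (regular at 0)
  in \<open>p\<close> variables with \<open>q\<close> components is defined exactly where the inverses in the realizations of its
  components exist.
\<close>

definition free_rational_map ::
  "nat \<Rightarrow> nat \<Rightarrow> (nat \<Rightarrow> complex mat list \<rightharpoonup> complex mat list) \<Rightarrow> bool" where
  "free_rational_map p q f \<longleftrightarrow>
     (\<exists>s S b c.
        (\<forall>i<q. 0 < s i \<and> S i \<in> mtuples (s i) p \<and> b i \<in> carrier_vec (s i) \<and> c i \<in> carrier_vec (s i)) \<and>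
        (\<forall>n\<ge>1.
           dom (f n) = {X \<in> mtuples n p. \<forall>i<q. invertible_mat (1\<^sub>m (s i * n) - Lam (s i) n (S i) X)} \<and>
           (\<forall>X\<in>dom (f n).
              f n X = Some (map (\<lambda>i. realization_value (s i) (S i) (b i) (c i) n X) [0..<q]))))"

definition convexotonic :: "nat \<Rightarrow> complex mat list \<Rightarrow> bool" where
  "convexotonic m \<Xi> \<longleftrightarrow> \<Xi> \<in> mtuples m m \<and>
     (\<forall>j<m. \<forall>k<m. \<Xi> ! k * \<Xi> ! j = lin_comb m (\<lambda>s. \<Xi> ! j $$ (k, s)) \<Xi>)"

definition structure_tuple :: "nat \<Rightarrow> complex mat list \<Rightarrow> complex mat list \<Rightarrow> bool" where
  "structure_tuple d J \<Xi> \<longleftrightarrow> \<Xi> \<in> mtuples (length J) (length J) \<and>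
     (\<forall>j<length J. \<forall>k<length J. J ! k * J ! j = lin_comb d (\<lambda>s. \<Xi> ! j $$ (k, s)) J)"

definition mat_block :: "nat \<Rightarrow> complex mat \<Rightarrow> nat \<Rightarrow> nat \<Rightarrow> complex mat" where
  "mat_block n M j i = Matrix.mat n n (\<lambda>(r, c). M $$ (j * n + r, i * n + c))"

text \<open>
  The map \<open>(x_1, ..., x_g, 0, ..., 0) (I + sum_{j \<le> g} Xi_j x_j)^{-1}\<close>, defined exactly where the
  inverse exists.
\<close>

definition convexotonic_map ::
  "nat \<Rightarrow> complex mat list \<Rightarrow> nat \<Rightarrow> complex mat list \<rightharpoonup> complex mat list" where
  "convexotonic_map g \<Xi> n X =
     (let m = length \<Xi>; P = 1\<^sub>m (m * n) + Lam m n (take g \<Xi>) X in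
      if X \<in> mtuples n g \<and> invertible_mat P
      then Some (map (\<lambda>i. mat_sum n n
             (map (\<lambda>j. X ! j * mat_block n (the (mat_inverse P)) j i) [0..<g])) [0..<m])
      else None)"

definition injective_proper_map_into ::
  "nat \<Rightarrow> nat \<Rightarrow> nat \<Rightarrow> (complex mat list \<rightharpoonup> complex mat list) \<Rightarrow>
   complex mat list set \<Rightarrow> complex mat list set \<Rightarrow> bool" where
  "injective_proper_map_into n p q F U V \<longleftrightarrow>
     U \<subseteq> dom F \<and> (\<lambda>X. the (F X)) \<in> U \<rightarrow> V \<and> inj_on (\<lambda>X. the (F X)) U \<and>
     (\<forall>K. compactin (mtuple_topology n q) K \<and> K \<subseteq> V \<longrightarrow>
        compactin (mtuple_topology n p) {X \<in> U. the (F X) \<in> K})"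

end

theory Submission
  imports Defs
begin

text \<open>
  For \<open>Y = f(X)\<close> the structure constants turn the defining equation
  \<open>Y (I + \<Sum> \<Xi>_j X_j) = (X, 0)\<close> into \<open>M (I + T) = T\<close>, where \<open>T = \<Lambda>_A(X)\<close> and
  \<open>M = \<Lambda>_J(Y)\<close>. Since \<open>|(I + T) v|^2 - |T v|^2\<close> is the quadratic form of \<open>I + T + T^*\<close>, the
  tuple \<open>X\<close> lies in the spectrahedron exactly when \<open>I + T\<close> is invertible and \<open>M = T (I + T)^{-1}\<close>
  is a contraction, and in its interior exactly when \<open>M\<close> is a strict contraction. Linear
  independence of \<open>J\<close> transfers invertibility from \<open>I + T\<close> to the pencil of \<open>\<Xi>\<close>, and linear
  independence of \<open>A\<close> recovers \<open>X\<close> from \<open>T = M + M T\<close>. This gives injectivity and the bound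
  \<open>\<parallel>T\<parallel> \<le> \<parallel>M\<parallel> / (1 - \<parallel>M\<parallel>)\<close> behind properness; the limit of a convergent subsequence is identified
  by passing to the limit in \<open>M (I + T) = T\<close>.
\<close>

subsection \<open>Sums and pencils in coordinates\<close>

text \<open>Everything runs through one identity: the structure constants turn right multiplication
  of a block row by the pencil of \<open>\<Xi>\<close> into right multiplication of a
  \<open>J\<close>-pencil by \<open>I + T\<close>. With the block row of \<open>(X, 0)\<close> as
  result it gives \<open>M (I + T) = T\<close>; with the zero row as result it excludes left null
  vectors of the pencil of \<open>\<Xi>\<close>, and this controls the domain of the map.

  The obstacle is strictness. Membership in the spectrahedron reads
  \<open>|T v| \<le> |v + T v|\<close>, and with \<open>w = (I + T) v\<close> this is
  \<open>|M w| \<le> |w|\<close>. The interior is described by a factor \<rho> < 1 on the right,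
  uniform in \<open>v\<close>, which survives small changes of \<open>T\<close>. Such a factor
  exists at interior points because some \<open>t X\<close> with \<open>t > 1\<close> is still in
  the set. It bounds the norm of \<open>M\<close>; conversely, the norm of \<open>M\<close> serves
  as the factor.

  In the properness proof a limit of preimages is not known beforehand to lie in the domain of the
  map. The equation \<open>M (I + T) = T\<close>, which makes sense everywhere, stands in for the
  map until this is established.\<close>

lemma sum_lessThan_mult_split:
  fixes G :: "nat \<Rightarrow> 'a::comm_monoid_add"
  shows "(\<Sum>z<a * b. G z) = (\<Sum>u<a. \<Sum>v<b. G (u * b + v))"
proof -
  have "(\<Sum>z<a * b. G z) = (\<Sum>u<a. sum G {u * b..<u * b + b})"
    by (rule sum.nat_group[symmetric])
  also have "\<dots> = (\<Sum>u<a. \<Sum>v<b. G (u * b + v))"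
  proof (rule sum.cong[OF refl])
    fix u
    show "sum G {u * b..<u * b + b} = (\<Sum>v<b. G (u * b + v))"
      using sum.shift_bounds_nat_ivl[of G 0 "u * b" b] by (simp add: atLeast0LessThan add.commute)
  qed
  finally show ?thesis .
qed

lemma block_index_less: "p * n + r < d * n" if "p < d" "r < n" for p n r d :: nat
proof -
  have "p * n + r < Suc p * n" using that by simp
  also have "\<dots> \<le> d * n" using that by (intro mult_le_mono1) simp
  finally show ?thesis .
qed

lemma mat_sum_carrier:
  "set Ms \<subseteq> carrier_mat nr nc \<Longrightarrow> mat_sum nr nc Ms \<in> carrier_mat nr nc"
  unfolding mat_sum_def by (induction Ms) auto

lemma mat_sum_index:
  assumes "set Ms \<subseteq> carrier_mat nr nc" "i < nr" "k < nc"
  shows "mat_sum nr nc Ms $$ (i, k) = (\<Sum>s<length Ms. (Ms ! s) $$ (i, k))"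
  using assms(1)
proof (induction Ms)
  case Nil
  then show ?case using assms by (simp add: mat_sum_def)
next
  case (Cons M Ms)
  have c: "mat_sum nr nc Ms \<in> carrier_mat nr nc" using Cons.prems by (intro mat_sum_carrier) auto
  have "mat_sum nr nc (M # Ms) = M + mat_sum nr nc Ms" by (simp add: mat_sum_def)
  then have "mat_sum nr nc (M # Ms) $$ (i, k) = M $$ (i, k) + mat_sum nr nc Ms $$ (i, k)"
    using c assms by simp
  also have "\<dots> = (\<Sum>s<length (M # Ms). ((M # Ms) ! s) $$ (i, k))"
    using Cons unfolding length_Cons by (subst sum.lessThan_Suc_shift) simp
  finally show ?case .
qed

lemma mtuplesD:
  assumes "X \<in> mtuples n m"
  shows "length X = m" "j < m \<Longrightarrow> X ! j \<in> carrier_mat n n"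
    "j < m \<Longrightarrow> dim_row (X ! j) = n" "j < m \<Longrightarrow> dim_col (X ! j) = n" "set X \<subseteq> carrier_mat n n"
proof -
  show l: "length X = m" and s: "set X \<subseteq> carrier_mat n n" using assms by (auto simp: mtuples_def)
  show c: "X ! j \<in> carrier_mat n n" if "j < m" for j
    using l s that nth_mem by blast
  show "j < m \<Longrightarrow> dim_row (X ! j) = n" "j < m \<Longrightarrow> dim_col (X ! j) = n" using c by auto
qed

lemma mtuplesI:
  "length X = m \<Longrightarrow> (\<And>j. j < m \<Longrightarrow> X ! j \<in> carrier_mat n n) \<Longrightarrow> X \<in> mtuples n m"
  by (auto simp: mtuples_def in_set_conv_nth)

lemma mtuples_eqI:
  assumes X: "X \<in> mtuples n m" and Y: "Y \<in> mtuples n m"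
    and eq: "\<And>j r c. j < m \<Longrightarrow> r < n \<Longrightarrow> c < n \<Longrightarrow> X ! j $$ (r, c) = Y ! j $$ (r, c)"
  shows "X = Y"
  by (rule nth_equalityI) (use assms mtuplesD[OF X] mtuplesD[OF Y] in \<open>auto intro!: eq_matI\<close>)

lemma lin_comb_carrier:
  assumes "T \<in> mtuples d m"
  shows "lin_comb d c T \<in> carrier_mat d d"
  unfolding lin_comb_def by (rule mat_sum_carrier) (use mtuplesD[OF assms] in auto)

lemma lin_comb_dim:
  assumes "T \<in> mtuples d m"
  shows "dim_row (lin_comb d c T) = d" "dim_col (lin_comb d c T) = d"
  using lin_comb_carrier[OF assms, of c] by auto

lemma lin_comb_index:
  assumes T: "T \<in> mtuples d m" and "p < d" "q < d"
  shows "lin_comb d c T $$ (p, q) = (\<Sum>s<m. c s * T ! s $$ (p, q))"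
proof -
  have "lin_comb d c T $$ (p, q) = (\<Sum>s<length T. (c s \<cdot>\<^sub>m T ! s) $$ (p, q))"
    unfolding lin_comb_def by (subst mat_sum_index) (use mtuplesD[OF T] assms in auto)
  also have "\<dots> = (\<Sum>s<m. c s * T ! s $$ (p, q))"
    using mtuplesD[OF T] assms by (intro sum.cong) auto
  finally show ?thesis .
qed

lemma kron_carrier:
  "M \<in> carrier_mat a b \<Longrightarrow> N \<in> carrier_mat a' b' \<Longrightarrow> kron M N \<in> carrier_mat (a * a') (b * b')"
  by (auto simp: kron_def)

lemma kron_index:
  assumes "M \<in> carrier_mat a b" "N \<in> carrier_mat a' b'" "i < a * a'" "k < b * b'"
  shows "kron M N $$ (i, k) = M $$ (i div a', k div b') * N $$ (i mod a', k mod b')"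
  using assms by (auto simp: kron_def)

lemma Lam_carrier:
  assumes "T \<in> mtuples d m" "X \<in> mtuples n m'"
  shows "Lam d n T X \<in> carrier_mat (d * n) (d * n)"
  unfolding Lam_def
  by (rule mat_sum_carrier) (use mtuplesD[OF assms(1)] mtuplesD[OF assms(2)] in
      \<open>auto simp: set_zip intro!: kron_carrier\<close>)

lemma Lam_index:
  assumes T: "T \<in> mtuples d m" and X: "X \<in> mtuples n m" and "i < d * n" "k < d * n"
  shows "Lam d n T X $$ (i, k) =
    (\<Sum>j<m. T ! j $$ (i div n, k div n) * X ! j $$ (i mod n, k mod n))"
proof -
  have "Lam d n T X $$ (i, k) = (\<Sum>j<length (map2 kron T X). (map2 kron T X ! j) $$ (i, k))"
    unfolding Lam_def
    by (rule mat_sum_index) (use mtuplesD[OF T] mtuplesD[OF X] assms in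
      \<open>auto simp: set_zip intro!: kron_carrier\<close>)
  also have "\<dots> = (\<Sum>j<m. T ! j $$ (i div n, k div n) * X ! j $$ (i mod n, k mod n))"
    using mtuplesD[OF T] mtuplesD[OF X] assms
    by (intro sum.cong) (auto intro!: kron_index)
  finally show ?thesis .
qed

lemma Lam_block_index:
  assumes T: "T \<in> mtuples d m" and X: "X \<in> mtuples n m" and "p < d" "q < d" "r < n" "c < n"
  shows "Lam d n T X $$ (p * n + r, q * n + c) = (\<Sum>j<m. T ! j $$ (p, q) * X ! j $$ (r, c))"
proof -
  have "p * n + r < d * n" "q * n + c < d * n" using assms by (auto intro: block_index_less)
  then show ?thesis using Lam_index[OF T X] assms by simp
qed

text \<open>Division with remainder by \<open>n\<close> writes every index below
  \<open>d * n\<close> as \<open>p * n + r\<close>; for \<open>n = 0\<close> there are no indices to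
  compare.\<close>

lemma block_mat_eqI:
  assumes "M \<in> carrier_mat (d * n) (d * n)" "N \<in> carrier_mat (d * n) (d * n)"
    and "\<And>p q r c. p < d \<Longrightarrow> q < d \<Longrightarrow> r < n \<Longrightarrow> c < n \<Longrightarrow>
      M $$ (p * n + r, q * n + c) = N $$ (p * n + r, q * n + c)"
  shows "M = N"
proof (rule eq_matI)
  fix i k assume "i < dim_row N" "k < dim_col N"
  then have ik: "i < d * n" "k < d * n" using assms by auto
  then have "0 < n" by (cases n) auto
  then have "i div n < d" "k div n < d" "i mod n < n" "k mod n < n"
    using ik by (auto simp: less_mult_imp_div_less)
  from assms(3)[OF this] show "M $$ (i, k) = N $$ (i, k)" by simp
qed (use assms in auto)

subsection \<open>Vector and operator norms\<close>

lemma vnorm_nonneg [simp]: "0 \<le> vnorm v"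
  by (simp add: vnorm_def)

lemma vnorm_square: "(vnorm v)\<^sup>2 = Re (v \<bullet>c v)"
proof -
  have "(vnorm v)\<^sup>2 = (\<Sum>i<dim_vec v. (cmod (vec_index v i))\<^sup>2)"
    by (simp add: vnorm_def L2_set_def sum_nonneg)
  also have "\<dots> = Re (v \<bullet>c v)"
    by (auto simp: scalar_prod_def atLeast0LessThan complex_norm_square[symmetric] simp del: of_real_power simp flip: of_real_power
        intro!: sum.cong)
  finally show ?thesis .
qed

lemma vnorm_triangle:
  assumes "u \<in> carrier_vec n" "v \<in> carrier_vec n"
  shows "vnorm (u + v) \<le> vnorm u + vnorm v"
proof -
  have "vnorm (u + v) \<le> L2_set (\<lambda>i. cmod (vec_index u i) + cmod (vec_index v i)) {..<n}"
    unfolding vnorm_def using assms by (auto intro!: L2_set_mono norm_triangle_ineq)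
  also have "\<dots> \<le> vnorm u + vnorm v"
    unfolding vnorm_def using assms L2_set_triangle_ineq by auto
  finally show ?thesis .
qed

lemma vnorm_smult: "vnorm (a \<cdot>\<^sub>v v) = cmod a * vnorm v"
proof -
  have "L2_set (\<lambda>i. cmod (vec_index (a \<cdot>\<^sub>v v) i)) {..<dim_vec v} =
      L2_set (\<lambda>i. cmod a * cmod (vec_index v i)) {..<dim_vec v}"
    by (intro L2_set_cong) (auto simp: norm_mult)
  then show ?thesis unfolding vnorm_def by (simp add: L2_set_right_distrib)
qed

lemma vnorm_minus:
  assumes "u \<in> carrier_vec n" "v \<in> carrier_vec n"
  shows "vnorm (u - v) \<le> vnorm u + vnorm v"
proof -
  have "u - v = u + (-1) \<cdot>\<^sub>v v" using assms by auto
  then show ?thesis using vnorm_triangle[of u n "(-1) \<cdot>\<^sub>v v"] assms by (simp add: vnorm_smult)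
qed

lemma vnorm_zero [simp]: "vnorm (0\<^sub>v n) = 0"
  unfolding vnorm_def by (simp add: L2_set_def)

lemma vnorm_eq_0:
  assumes "v \<in> carrier_vec n" "vnorm v = 0"
  shows "v = 0\<^sub>v n"
  using assms by (auto simp: vnorm_def L2_set_eq_0_iff)

lemma vnorm_mult_le_op_norm:
  assumes "v \<in> carrier_vec (dim_col M)"
  shows "vnorm (M *\<^sub>v v) \<le> op_norm M * vnorm v"
proof (cases "vnorm v = 0")
  case True
  then have "M *\<^sub>v v = 0\<^sub>v (dim_row M)" using vnorm_eq_0[OF assms] by auto
  then show ?thesis using True by simp
next
  case False
  define a where "a = complex_of_real (1 / vnorm v)"
  have "vnorm (a \<cdot>\<^sub>v v) = 1" using False by (simp add: vnorm_smult a_def norm_divide)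
  then have "vnorm (M *\<^sub>v (a \<cdot>\<^sub>v v)) \<le> op_norm M"
    unfolding op_norm_def using assms by (intro cSUP_upper op_norm_bdd_above) auto
  moreover have "M *\<^sub>v (a \<cdot>\<^sub>v v) = a \<cdot>\<^sub>v (M *\<^sub>v v)"
    using assms by (intro mult_mat_vec) auto
  ultimately have "vnorm (M *\<^sub>v v) / vnorm v \<le> op_norm M" by (simp add: vnorm_smult a_def norm_divide)
  moreover have "0 < vnorm v" using False by (simp add: less_le)
  ultimately show ?thesis by (simp add: divide_simps)
qed

lemma op_norm_leI:
  assumes "0 \<le> b" "\<And>v. v \<in> carrier_vec (dim_col M) \<Longrightarrow> vnorm (M *\<^sub>v v) \<le> b * vnorm v"
  shows "op_norm M \<le> b"
  unfolding op_norm_def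
proof (rule cSUP_least)
  show "{v \<in> carrier_vec (dim_col M). vnorm v \<le> 1} \<noteq> {}" by (auto intro!: exI[of _ "0\<^sub>v (dim_col M)"])
  fix v assume v: "v \<in> {v \<in> carrier_vec (dim_col M). vnorm v \<le> 1}"
  then have "vnorm (M *\<^sub>v v) \<le> b * vnorm v" using assms by auto
  also have "\<dots> \<le> b" using v assms(1) by (simp add: mult_left_le)
  finally show "vnorm (M *\<^sub>v v) \<le> b" .
qed

lemma op_norm_nonneg: "0 \<le> op_norm M"
proof -
  have "vnorm (M *\<^sub>v (0\<^sub>v (dim_col M))) \<le> op_norm M"
    unfolding op_norm_def by (intro cSUP_upper op_norm_bdd_above) auto
  then show ?thesis using vnorm_nonneg order_trans by blast
qed

lemma op_norm_add:
  assumes "M \<in> carrier_mat a b" "N \<in> carrier_mat a b"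
  shows "op_norm (M + N) \<le> op_norm M + op_norm N"
proof (rule op_norm_leI)
  show "0 \<le> op_norm M + op_norm N" by (simp add: op_norm_nonneg)
  fix v :: "complex vec" assume "v \<in> carrier_vec (dim_col (M + N))"
  then have v: "v \<in> carrier_vec b" using assms by simp
  have "(M + N) *\<^sub>v v = M *\<^sub>v v + N *\<^sub>v v" using assms v by (rule add_mult_distrib_mat_vec)
  then have "vnorm ((M + N) *\<^sub>v v) \<le> vnorm (M *\<^sub>v v) + vnorm (N *\<^sub>v v)"
    using assms v by (simp add: vnorm_triangle[of _ a])
  also have "\<dots> \<le> op_norm M * vnorm v + op_norm N * vnorm v"
    using assms v by (intro add_mono vnorm_mult_le_op_norm) auto
  finally show "vnorm ((M + N) *\<^sub>v v) \<le> (op_norm M + op_norm N) * vnorm v"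
    by (simp add: algebra_simps)
qed

lemma op_norm_mult:
  assumes "M \<in> carrier_mat a b" "N \<in> carrier_mat b c"
  shows "op_norm (M * N) \<le> op_norm M * op_norm N"
proof (rule op_norm_leI)
  show "0 \<le> op_norm M * op_norm N" by (simp add: op_norm_nonneg)
  fix v :: "complex vec" assume "v \<in> carrier_vec (dim_col (M * N))"
  then have v: "v \<in> carrier_vec c" using assms by simp
  have "(M * N) *\<^sub>v v = M *\<^sub>v (N *\<^sub>v v)" using assms v by (rule assoc_mult_mat_vec)
  then have "vnorm ((M * N) *\<^sub>v v) \<le> op_norm M * vnorm (N *\<^sub>v v)"
    using assms v by (simp add: vnorm_mult_le_op_norm)
  also have "\<dots> \<le> op_norm M * (op_norm N * vnorm v)"
    using assms v by (intro mult_left_mono vnorm_mult_le_op_norm) (auto simp: op_norm_nonneg)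
  finally show "vnorm ((M * N) *\<^sub>v v) \<le> op_norm M * op_norm N * vnorm v" by simp
qed

lemma op_norm_smult_le: "op_norm (a \<cdot>\<^sub>m M) \<le> cmod a * op_norm M"
proof (rule op_norm_leI)
  show "0 \<le> cmod a * op_norm M" by (simp add: op_norm_nonneg)
  fix v :: "complex vec" assume v: "v \<in> carrier_vec (dim_col (a \<cdot>\<^sub>m M))"
  have "(a \<cdot>\<^sub>m M) *\<^sub>v v = a \<cdot>\<^sub>v (M *\<^sub>v v)" using v by (intro eq_vecI) (auto simp: scalar_prod_def sum_distrib_left mult.assoc)
  then show "vnorm ((a \<cdot>\<^sub>m M) *\<^sub>v v) \<le> cmod a * op_norm M * vnorm v"
    using v vnorm_mult_le_op_norm[of v M] by (simp add: vnorm_smult mult.assoc mult_left_mono)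
qed

text \<open>Crude, but it only has to supply some Lipschitz constant for the pencil.\<close>

lemma op_norm_le_sum:
  "op_norm M \<le> (\<Sum>i<dim_row M. \<Sum>k<dim_col M. cmod (M $$ (i, k)))"
proof (rule op_norm_leI)
  show "0 \<le> (\<Sum>i<dim_row M. \<Sum>k<dim_col M. cmod (M $$ (i, k)))" by (intro sum_nonneg) simp
  fix v :: "complex vec" assume v: "v \<in> carrier_vec (dim_col M)"
  have entry: "cmod (vec_index v k) \<le> vnorm v" if "k < dim_col M" for k
    unfolding vnorm_def using v that by (intro member_le_L2_set) auto
  have "vnorm (M *\<^sub>v v) \<le> (\<Sum>i<dim_row M. cmod (vec_index (M *\<^sub>v v) i))"
    unfolding vnorm_def dim_mult_mat_vec by (rule L2_set_le_sum) simp
  also have "\<dots> \<le> (\<Sum>i<dim_row M. \<Sum>k<dim_col M. cmod (M $$ (i, k)) * vnorm v)"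
  proof (rule sum_mono)
    fix i assume "i \<in> {..<dim_row M}"
    then have "vec_index (M *\<^sub>v v) i = (\<Sum>k<dim_col M. M $$ (i, k) * vec_index v k)"
      using v by (auto simp: scalar_prod_def atLeast0LessThan intro!: sum.cong)
    also have "cmod \<dots> \<le> (\<Sum>k<dim_col M. cmod (M $$ (i, k)) * cmod (vec_index v k))"
      by (rule order_trans[OF norm_sum]) (simp add: norm_mult)
    also have "\<dots> \<le> (\<Sum>k<dim_col M. cmod (M $$ (i, k)) * vnorm v)"
      by (rule sum_mono) (use entry in \<open>auto intro!: mult_left_mono\<close>)
    finally show "cmod (vec_index (M *\<^sub>v v) i) \<le> (\<Sum>k<dim_col M. cmod (M $$ (i, k)) * vnorm v)" .
  qed
  finally show "vnorm (M *\<^sub>v v) \<le> (\<Sum>i<dim_row M. \<Sum>k<dim_col M. cmod (M $$ (i, k))) * vnorm v"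
    by (simp add: sum_distrib_right)
qed

text \<open>The entry occurs in the image of a unit vector. This is the converse comparison between
  entries and norm, used to bound a tuple by its pencil.\<close>

lemma entry_le_op_norm:
  assumes "i < dim_row M" "k < dim_col M"
  shows "cmod (M $$ (i, k)) \<le> op_norm M"
proof -
  have u: "vnorm (unit_vec (dim_col M) k) = 1"
  proof -
    have "(vnorm (unit_vec (dim_col M) k))\<^sup>2 = 1"
      unfolding vnorm_square using assms by (simp add: scalar_prod_def if_distrib cong: if_cong)
    then show ?thesis using vnorm_nonneg power2_eq_1_iff by (metis neg_0_le_iff_le not_one_le_zero)
  qed
  have "cmod (M $$ (i, k)) = cmod (vec_index (M *\<^sub>v unit_vec (dim_col M) k) i)"
    using assms by simp
  also have "\<dots> \<le> vnorm (M *\<^sub>v unit_vec (dim_col M) k)"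
    unfolding vnorm_def using assms by (intro member_le_L2_set) auto
  also have "\<dots> \<le> op_norm M * vnorm (unit_vec (dim_col M) k)" by (intro vnorm_mult_le_op_norm) simp
  finally show ?thesis using u by simp
qed

subsection \<open>Inverses and linear independence\<close>

lemma det_nonzero_inverse:
  assumes A: "(A :: complex mat) \<in> carrier_mat n n" and "det A \<noteq> 0"
  obtains B where "B \<in> carrier_mat n n" "A * B = 1\<^sub>m n" "B * A = 1\<^sub>m n"
  using det_non_zero_imp_unit[OF assms, of "()"] that by (auto simp: Units_def ring_mat_def)

lemma invertible_mat_iff_det:
  assumes A: "(A :: complex mat) \<in> carrier_mat n n"
  shows "invertible_mat A \<longleftrightarrow> det A \<noteq> 0"
proof
  assume "invertible_mat A"
  then obtain B where B: "A * B = 1\<^sub>m n" "B * A = 1\<^sub>m (dim_row B)"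
    using A unfolding invertible_mat_def inverts_mat_def by auto
  \<comment> \<open>\<open>inverts_mat\<close> leaves the size of \<open>B\<close> open; it is read
    off from the two products.\<close>
  have "dim_col B = dim_col (A * B)" by simp
  then have c: "dim_col B = n" using B(1) by simp
  have "dim_col (B * A) = dim_row B" using B(2) by simp
  then have "B \<in> carrier_mat n n" using c A by auto
  then have "det A * det B = 1" using det_mult[OF A] B(1) by (metis det_one)
  then show "det A \<noteq> 0" by auto
next
  assume "det A \<noteq> 0"
  then obtain B where "B \<in> carrier_mat n n" "A * B = 1\<^sub>m n" "B * A = 1\<^sub>m n"
    using A det_nonzero_inverse by blast
  then show "invertible_mat A" using A unfolding invertible_mat_def inverts_mat_def by auto
qed

text \<open>Allows a guessed inverse to replace the value of \<open>mat_inverse\<close>: for square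
  matrices a right inverse is also a left inverse, and inverses are unique.\<close>

lemma the_mat_inverse_eq:
  assumes A: "(A :: complex mat) \<in> carrier_mat n n" and B: "B \<in> carrier_mat n n" "A * B = 1\<^sub>m n"
  shows "the (mat_inverse A) = B"
proof -
  have BA: "B * A = 1\<^sub>m n" using mat_mult_left_right_inverse[OF A B] .
  then have "A \<in> Units (ring_mat TYPE(complex) n ())"
    using A B by (auto simp: Units_def ring_mat_def)
  then obtain C where C: "mat_inverse A = Some C" using mat_inverse(1)[OF A, of "()"] by blast
  then have "A * C = 1\<^sub>m n" "C \<in> carrier_mat n n" using mat_inverse(2)[OF A C] by auto
  then have "C = B" using BA assoc_mult_mat[OF B(1) A, of C n] B(1) by simp
  then show ?thesis using C by simp
qed

lemma the_mat_inverse: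
  assumes A: "(A :: complex mat) \<in> carrier_mat n n" and "det A \<noteq> 0"
  shows "the (mat_inverse A) \<in> carrier_mat n n" "A * the (mat_inverse A) = 1\<^sub>m n"
    "the (mat_inverse A) * A = 1\<^sub>m n"
proof -
  obtain B where B: "B \<in> carrier_mat n n" "A * B = 1\<^sub>m n" "B * A = 1\<^sub>m n"
    using det_nonzero_inverse[OF assms] .
  then show "the (mat_inverse A) \<in> carrier_mat n n" "A * the (mat_inverse A) = 1\<^sub>m n"
    "the (mat_inverse A) * A = 1\<^sub>m n"
    using the_mat_inverse_eq[OF A B(1,2)] by simp_all
qed

text \<open>The functionals come from a left inverse of the Gram matrix, which is injective
  because \<open>v^* G v\<close> is the squared Frobenius norm of the combination with coefficients \<open>v\<close>.\<close>

lemma lin_indep_dual_functionals: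
  assumes T: "T \<in> mtuples d m" and indep: "lin_indep_tuple d T"
  obtains \<phi> :: "nat \<Rightarrow> nat \<Rightarrow> nat \<Rightarrow> complex"
  where "\<And>s j. s < m \<Longrightarrow> j < m \<Longrightarrow>
    (\<Sum>p<d. \<Sum>q<d. \<phi> s p q * T ! j $$ (p, q)) = (if s = j then 1 else 0)"
proof -
  define G where
    "G = Matrix.mat m m (\<lambda>(i, j). \<Sum>p<d. \<Sum>q<d. cnj (T ! i $$ (p, q)) * T ! j $$ (p, q))"
  have G: "G \<in> carrier_mat m m" by (simp add: G_def)
  have "v = 0\<^sub>v m" if v: "v \<in> carrier_vec m" and Gv: "G *\<^sub>v v = 0\<^sub>v m" for v
  proof -
    let ?L = "\<lambda>p q. \<Sum>j<m. vec_index v j * T ! j $$ (p, q)"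
    have row: "(\<Sum>j<m. G $$ (i, j) * vec_index v j) = 0" if "i < m" for i
    proof -
      have "vec_index (G *\<^sub>v v) i = (\<Sum>j<m. G $$ (i, j) * vec_index v j)"
        using that v G by (auto simp: scalar_prod_def atLeast0LessThan intro!: sum.cong)
      then show ?thesis using Gv that by simp
    qed
    have "complex_of_real (\<Sum>p<d. \<Sum>q<d. (cmod (?L p q))\<^sup>2) = (\<Sum>p<d. \<Sum>q<d. cnj (?L p q) * ?L p q)"
      by (simp only: of_real_sum complex_norm_square mult.commute)
    also have "\<dots> = (\<Sum>p<d. \<Sum>q<d. \<Sum>i<m. \<Sum>j<m.
        cnj (vec_index v i) * (cnj (T ! i $$ (p, q)) * T ! j $$ (p, q) * vec_index v j))"
      by (simp only: cnj_sum complex_cnj_mult sum_product) (simp only: mult_ac)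
    \<comment> \<open>Fixing both index sets orients \<open>sum.swap\<close>: the sums over
      \<open>m\<close> can only move outwards, so the rewriting terminates.\<close>
    also have "\<dots> = (\<Sum>i<m. \<Sum>j<m. \<Sum>p<d. \<Sum>q<d.
        cnj (vec_index v i) * (cnj (T ! i $$ (p, q)) * T ! j $$ (p, q) * vec_index v j))"
      by (simp only: sum.swap[of _ "{..<m}" "{..<d}"])
    also have "\<dots> = (\<Sum>i<m. cnj (vec_index v i) * (\<Sum>j<m. G $$ (i, j) * vec_index v j))"
      by (intro sum.cong refl) (auto simp: G_def sum_distrib_left sum_distrib_right intro!: sum.cong)
    also have "\<dots> = 0" using row by simp
    finally have "(\<Sum>p<d. \<Sum>q<d. (cmod (?L p q))\<^sup>2) = 0" using of_real_eq_0_iff by blast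
    then have zero: "?L p q = 0" if "p < d" "q < d" for p q
      using that by (auto simp: sum_nonneg_eq_0_iff sum_nonneg)
    have "lin_comb d (\<lambda>j. vec_index v j) T = 0\<^sub>m d d"
      by (rule eq_matI) (use lin_comb_dim[OF T] in \<open>auto simp: lin_comb_index[OF T] zero\<close>)
    then have "\<forall>j<m. vec_index v j = 0" using indep mtuplesD(1)[OF T] unfolding lin_indep_tuple_def by blast
    then show ?thesis using v by auto
  qed
  then have "det G \<noteq> 0" using det_0_iff_vec_prod_zero_field[OF G] by blast
  then obtain B where B: "B \<in> carrier_mat m m" "B * G = 1\<^sub>m m" using det_nonzero_inverse[OF G] by blast
  show thesis
  \<comment> \<open>Pairing this functional with \<open>T ! j\<close> yields row \<open>s\<close> of
    \<open>B\<close> times column \<open>j\<close> of \<open>G\<close>.\<close>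
  proof (rule that[of "\<lambda>s p q. \<Sum>i<m. B $$ (s, i) * cnj (T ! i $$ (p, q))"])
    fix s j assume sj: "s < m" "j < m"
    have "(\<Sum>p<d. \<Sum>q<d. (\<Sum>i<m. B $$ (s, i) * cnj (T ! i $$ (p, q))) * T ! j $$ (p, q)) =
      (\<Sum>p<d. \<Sum>q<d. \<Sum>i<m. B $$ (s, i) * (cnj (T ! i $$ (p, q)) * T ! j $$ (p, q)))"
      by (simp add: sum_distrib_right mult.assoc)
    also have "\<dots> = (\<Sum>i<m. \<Sum>p<d. \<Sum>q<d. B $$ (s, i) * (cnj (T ! i $$ (p, q)) * T ! j $$ (p, q)))"
      by (simp only: sum.swap[of _ "{..<m}" "{..<d}"])
    also have "\<dots> = (\<Sum>i<m. B $$ (s, i) * G $$ (i, j))"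
      using sj by (intro sum.cong refl) (auto simp: G_def sum_distrib_left)
    also have "\<dots> = (B * G) $$ (s, j)"
      using sj carrier_matD[OF B(1)] carrier_matD[OF G]
      by (simp only: index_mult_mat(1)) (auto simp: scalar_prod_def atLeast0LessThan intro!: sum.cong)
    finally show "(\<Sum>p<d. \<Sum>q<d. (\<Sum>i<m. B $$ (s, i) * cnj (T ! i $$ (p, q))) * T ! j $$ (p, q)) =
      (if s = j then 1 else 0)"
      using B sj by simp
  qed
qed

text \<open>The dual functionals act on the \<open>d\<close> by \<open>d\<close> array formed by
  entry \<open>(r, c)\<close> of each block of the pencil. They depend on \<open>T\<close> alone, so
  \<phi> is chosen before the level \<open>n\<close>.\<close>

lemma lin_indep_recover:
  assumes T: "T \<in> mtuples d m" and indep: "lin_indep_tuple d T"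
  obtains \<phi> :: "nat \<Rightarrow> nat \<Rightarrow> nat \<Rightarrow> complex"
  where "\<And>n Y s r c. Y \<in> mtuples n m \<Longrightarrow> s < m \<Longrightarrow> r < n \<Longrightarrow> c < n \<Longrightarrow>
    Y ! s $$ (r, c) = (\<Sum>p<d. \<Sum>q<d. \<phi> s p q * Lam d n T Y $$ (p * n + r, q * n + c))"
proof -
  obtain \<phi> where \<phi>: "\<And>s j. s < m \<Longrightarrow> j < m \<Longrightarrow>
    (\<Sum>p<d. \<Sum>q<d. \<phi> s p q * T ! j $$ (p, q)) = (if s = j then 1 else 0)"
    using lin_indep_dual_functionals[OF assms] by blast
  show thesis
  proof (rule that[of \<phi>])
    fix n Y s r c assume Y: "Y \<in> mtuples n m" and src: "s < m" "r < n" "c < n"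
    have "(\<Sum>p<d. \<Sum>q<d. \<phi> s p q * Lam d n T Y $$ (p * n + r, q * n + c)) =
      (\<Sum>p<d. \<Sum>q<d. \<Sum>j<m. \<phi> s p q * T ! j $$ (p, q) * Y ! j $$ (r, c))"
      using src by (intro sum.cong refl) (simp add: Lam_block_index[OF T Y] sum_distrib_left mult.assoc)
    also have "\<dots> = (\<Sum>j<m. \<Sum>p<d. \<Sum>q<d. \<phi> s p q * T ! j $$ (p, q) * Y ! j $$ (r, c))"
      by (simp only: sum.swap[of _ "{..<m}" "{..<d}"])
    also have "\<dots> = (\<Sum>j<m. (if s = j then 1 else 0) * Y ! j $$ (r, c))"
      using src by (intro sum.cong refl) (simp add: \<phi>[symmetric] sum_distrib_right)
    also have "\<dots> = Y ! s $$ (r, c)" using src by (simp add: if_distrib if_distribR cong: if_cong)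
    finally show "Y ! s $$ (r, c) =
      (\<Sum>p<d. \<Sum>q<d. \<phi> s p q * Lam d n T Y $$ (p * n + r, q * n + c))" by simp
  qed
qed

lemma Lam_inject:
  assumes T: "T \<in> mtuples d m" and indep: "lin_indep_tuple d T"
    and Y: "Y \<in> mtuples n m" "Y' \<in> mtuples n m" and eq: "Lam d n T Y = Lam d n T Y'"
  shows "Y = Y'"
proof -
  obtain \<phi> where \<phi>: "\<And>n Y s r c. Y \<in> mtuples n m \<Longrightarrow> s < m \<Longrightarrow> r < n \<Longrightarrow> c < n \<Longrightarrow>
    Y ! s $$ (r, c) = (\<Sum>p<d. \<Sum>q<d. \<phi> s p q * Lam d n T Y $$ (p * n + r, q * n + c))"
    using lin_indep_recover[OF T indep] by blast
  show ?thesis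
    by (rule mtuples_eqI[OF Y]) (simp add: \<phi>[OF Y(1)] \<phi>[OF Y(2)] eq)
qed

subsection \<open>The structure tuple\<close>

lemma lin_comb_inject:
  assumes T: "T \<in> mtuples d m" and indep: "lin_indep_tuple d T"
    and eq: "lin_comb d a T = lin_comb d b T" and s: "s < m"
  shows "a s = b s"
proof -
  have "lin_comb d (\<lambda>s. a s - b s) T = 0\<^sub>m d d"
  proof (rule eq_matI)
    fix p q assume "p < dim_row (0\<^sub>m d d)" "q < dim_col (0\<^sub>m d d)"
    then have pq: "p < d" "q < d" by auto
    have "lin_comb d a T $$ (p, q) = lin_comb d b T $$ (p, q)" by (simp add: eq)
    then show "lin_comb d (\<lambda>s. a s - b s) T $$ (p, q) = 0\<^sub>m d d $$ (p, q)"
      using pq by (simp add: lin_comb_index[OF T] left_diff_distrib sum_subtractf)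
  qed (use lin_comb_dim[OF T] in auto)
  then have "a s - b s = 0"
    using indep s mtuplesD(1)[OF T] unfolding lin_indep_tuple_def by blast
  then show ?thesis by simp
qed

text \<open>The full matrix algebra is one of the sets being intersected; this is what keeps the
  intersection inside \<open>carrier_mat d d\<close>.\<close>

lemma mat_subalgebra_generated:
  assumes "T \<in> mtuples d m"
  shows "mat_subalgebra d (generated_algebra d T)"
proof -
  have "mat_subalgebra d (carrier_mat d d)" by (auto simp: mat_subalgebra_def)
  moreover have "set T \<subseteq> carrier_mat d d" using mtuplesD[OF assms] by simp
  ultimately show ?thesis
    unfolding mat_subalgebra_def generated_algebra_def by (auto 0 3)
qed

lemma nth_in_tuple_span:
  assumes T: "T \<in> mtuples d m" and "k < m"
  shows "T ! k \<in> tuple_span d T"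
proof -
  have "lin_comb d (\<lambda>s. if s = k then 1 else 0) T = T ! k"
    by (rule eq_matI)
      (use assms mtuplesD[OF T] lin_comb_dim[OF T] in
        \<open>auto simp: lin_comb_index[OF T] if_distrib if_distribR cong: if_cong\<close>)
  then show ?thesis unfolding tuple_span_def by (metis rangeI)
qed

text \<open>Existence is closure of the span under products, uniqueness is uniqueness of coordinates
  with respect to \<open>J\<close>.\<close>

lemma structure_tuple_ex1:
  assumes J: "J \<in> mtuples d m" and indep: "lin_indep_tuple d J"
    and alg: "mat_subalgebra d (tuple_span d J)"
  shows "\<exists>!\<Xi>. structure_tuple d J \<Xi>"
proof (rule ex_ex1I)
  have len: "length J = m" using mtuplesD[OF J] by simp
  have "\<exists>c. J ! k * J ! j = lin_comb d c J" if "j < m" "k < m" for j k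
  proof -
    have "J ! k * J ! j \<in> tuple_span d J"
      using alg nth_in_tuple_span[OF J] that unfolding mat_subalgebra_def by blast
    then show ?thesis by (auto simp: tuple_span_def)
  qed
  then obtain \<gamma> where \<gamma>: "\<And>j k. j < m \<Longrightarrow> k < m \<Longrightarrow> J ! k * J ! j = lin_comb d (\<gamma> j k) J" by metis
  let ?\<Xi> = "map (\<lambda>j. Matrix.mat m m (\<lambda>(k, s). \<gamma> j k s)) [0..<m]"
  have "lin_comb d (\<lambda>s. ?\<Xi> ! j $$ (k, s)) J = lin_comb d (\<gamma> j k) J" if "j < m" "k < m" for j k
    by (rule eq_matI) (use that lin_comb_dim[OF J] in \<open>auto simp: lin_comb_index[OF J]\<close>)
  then have "structure_tuple d J ?\<Xi>"
    unfolding structure_tuple_def len by (auto simp: \<gamma> intro!: mtuplesI)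
  then show "\<exists>\<Xi>. structure_tuple d J \<Xi>" by blast
  fix \<Xi> \<Xi>' assume "structure_tuple d J \<Xi>" "structure_tuple d J \<Xi>'"
  then have \<Xi>: "\<Xi> \<in> mtuples m m" "\<Xi>' \<in> mtuples m m"
    and eq: "\<And>j k. j < m \<Longrightarrow> k < m \<Longrightarrow>
      lin_comb d (\<lambda>s. \<Xi> ! j $$ (k, s)) J = lin_comb d (\<lambda>s. \<Xi>' ! j $$ (k, s)) J"
    unfolding structure_tuple_def len by auto
  show "\<Xi> = \<Xi>'" by (rule mtuples_eqI[OF \<Xi>]) (rule lin_comb_inject[OF J indep eq])
qed

lemma structure_tuple_index:
  assumes J: "J \<in> mtuples d m" and \<Xi>: "structure_tuple d J \<Xi>"
    and "j < m" "k < m" "p < d" "q < d"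
  shows "(\<Sum>u<d. J ! k $$ (p, u) * J ! j $$ (u, q)) = (\<Sum>s<m. \<Xi> ! j $$ (k, s) * J ! s $$ (p, q))"
proof -
  have "(J ! k * J ! j) $$ (p, q) = (\<Sum>s<m. \<Xi> ! j $$ (k, s) * J ! s $$ (p, q))"
    using \<Xi> assms mtuplesD[OF J] unfolding structure_tuple_def by (simp add: lin_comb_index[OF J])
  moreover have "(J ! k * J ! j) $$ (p, q) = (\<Sum>u<d. J ! k $$ (p, u) * J ! j $$ (u, q))"
    using assms mtuplesD[OF J] by (auto simp: scalar_prod_def atLeast0LessThan intro!: sum.cong)
  ultimately show ?thesis by simp
qed

text \<open>Comparing coefficients in \<open>(J_a J_k) J_j = J_a (J_k J_j)\<close>.\<close>

lemma structure_tuple_convexotonic: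
  assumes J: "J \<in> mtuples d m" and indep: "lin_indep_tuple d J" and st: "structure_tuple d J \<Xi>"
  shows "convexotonic m \<Xi>"
  unfolding convexotonic_def
proof (intro conjI allI impI)
  have len: "length J = m" using mtuplesD[OF J] by simp
  show \<Xi>: "\<Xi> \<in> mtuples m m" using st unfolding structure_tuple_def len by simp
  note ix = structure_tuple_index[OF J st]
  fix j k assume jk: "j < m" "k < m"
  show "\<Xi> ! k * \<Xi> ! j = lin_comb m (\<lambda>s. \<Xi> ! j $$ (k, s)) \<Xi>"
  proof (rule eq_matI)
    fix a t assume "a < dim_row (lin_comb m (\<lambda>s. \<Xi> ! j $$ (k, s)) \<Xi>)"
      "t < dim_col (lin_comb m (\<lambda>s. \<Xi> ! j $$ (k, s)) \<Xi>)"
    then have at: "a < m" "t < m" using lin_comb_dim[OF \<Xi>] by auto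
    \<comment> \<open>The left side is \<open>(J_a J_k) J_j\<close>, the right side
      \<open>J_a (J_k J_j)\<close>. The coefficient of \<open>J_t\<close> on the left is entry
      \<open>(a, t)\<close> of \<open>\<Xi> ! k * \<Xi> ! j\<close>, on the right it is that of the
      linear combination.\<close>
    have "lin_comb d (\<lambda>t. \<Sum>s<m. \<Xi> ! k $$ (a, s) * \<Xi> ! j $$ (s, t)) J =
        lin_comb d (\<lambda>t. \<Sum>s<m. \<Xi> ! j $$ (k, s) * \<Xi> ! s $$ (a, t)) J"
    proof (rule eq_matI)
      fix p q assume "p < dim_row (lin_comb d (\<lambda>t. \<Sum>s<m. \<Xi> ! j $$ (k, s) * \<Xi> ! s $$ (a, t)) J)"
        "q < dim_col (lin_comb d (\<lambda>t. \<Sum>s<m. \<Xi> ! j $$ (k, s) * \<Xi> ! s $$ (a, t)) J)"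
      then have pq: "p < d" "q < d" using lin_comb_dim[OF J] by auto
      have "(\<Sum>t<m. (\<Sum>s<m. \<Xi> ! k $$ (a, s) * \<Xi> ! j $$ (s, t)) * J ! t $$ (p, q)) =
          (\<Sum>s<m. \<Xi> ! k $$ (a, s) * (\<Sum>t<m. \<Xi> ! j $$ (s, t) * J ! t $$ (p, q)))"
        unfolding sum_distrib_left sum_distrib_right by (subst sum.swap) (simp add: mult.assoc)
      also have "\<dots> = (\<Sum>s<m. \<Xi> ! k $$ (a, s) * (\<Sum>u<d. J ! s $$ (p, u) * J ! j $$ (u, q)))"
        using jk pq by (simp add: ix)
      also have "\<dots> = (\<Sum>u<d. (\<Sum>s<m. \<Xi> ! k $$ (a, s) * J ! s $$ (p, u)) * J ! j $$ (u, q))"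
        unfolding sum_distrib_left sum_distrib_right by (subst sum.swap) (simp add: mult.assoc)
      also have "\<dots> = (\<Sum>u<d. (\<Sum>w<d. J ! a $$ (p, w) * J ! k $$ (w, u)) * J ! j $$ (u, q))"
        using jk pq at by (simp add: ix)
      also have "\<dots> = (\<Sum>w<d. J ! a $$ (p, w) * (\<Sum>u<d. J ! k $$ (w, u) * J ! j $$ (u, q)))"
        unfolding sum_distrib_left sum_distrib_right by (subst sum.swap) (simp add: mult.assoc)
      also have "\<dots> = (\<Sum>w<d. J ! a $$ (p, w) * (\<Sum>s<m. \<Xi> ! j $$ (k, s) * J ! s $$ (w, q)))"
        using jk pq at by (simp add: ix)
      also have "\<dots> = (\<Sum>s<m. \<Xi> ! j $$ (k, s) * (\<Sum>w<d. J ! a $$ (p, w) * J ! s $$ (w, q)))"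
        unfolding sum_distrib_left by (subst sum.swap) (simp add: mult_ac)
      also have "\<dots> = (\<Sum>s<m. \<Xi> ! j $$ (k, s) * (\<Sum>t<m. \<Xi> ! s $$ (a, t) * J ! t $$ (p, q)))"
        using jk pq at by (simp add: ix)
      also have "\<dots> = (\<Sum>t<m. (\<Sum>s<m. \<Xi> ! j $$ (k, s) * \<Xi> ! s $$ (a, t)) * J ! t $$ (p, q))"
        unfolding sum_distrib_left sum_distrib_right by (subst sum.swap) (simp add: mult.assoc)
      finally show "lin_comb d (\<lambda>t. \<Sum>s<m. \<Xi> ! k $$ (a, s) * \<Xi> ! j $$ (s, t)) J $$ (p, q) =
        lin_comb d (\<lambda>t. \<Sum>s<m. \<Xi> ! j $$ (k, s) * \<Xi> ! s $$ (a, t)) J $$ (p, q)"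
        using pq by (simp add: lin_comb_index[OF J])
    qed (use lin_comb_dim[OF J] in auto)
    from lin_comb_inject[OF J indep this at(2)]
    have "(\<Sum>s<m. \<Xi> ! k $$ (a, s) * \<Xi> ! j $$ (s, t)) = (\<Sum>s<m. \<Xi> ! j $$ (k, s) * \<Xi> ! s $$ (a, t))" .
    moreover have "(\<Xi> ! k * \<Xi> ! j) $$ (a, t) = (\<Sum>s<m. \<Xi> ! k $$ (a, s) * \<Xi> ! j $$ (s, t))"
      using at jk mtuplesD[OF \<Xi>] by (auto simp: scalar_prod_def atLeast0LessThan intro!: sum.cong)
    ultimately show "(\<Xi> ! k * \<Xi> ! j) $$ (a, t) = lin_comb m (\<lambda>s. \<Xi> ! j $$ (k, s)) \<Xi> $$ (a, t)"
      using at by (simp add: lin_comb_index[OF \<Xi>])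
  qed (use lin_comb_dim[OF \<Xi>] mtuplesD[OF \<Xi>] jk in auto)
qed

subsection \<open>The convexotonic map\<close>

text \<open>A tuple as one flat block row, so that the formula for the map becomes an ordinary
  matrix product.\<close>

definition block_row :: "nat \<Rightarrow> complex mat list \<Rightarrow> complex mat" where
  "block_row n Y = Matrix.mat n (length Y * n) (\<lambda>(r, k). Y ! (k div n) $$ (r, k mod n))"

lemma block_row_carrier: "Y \<in> mtuples n m \<Longrightarrow> block_row n Y \<in> carrier_mat n (m * n)"
  using mtuplesD(1) by (simp add: block_row_def)

lemma block_row_index:
  "Y \<in> mtuples n m \<Longrightarrow> s < m \<Longrightarrow> r < n \<Longrightarrow> c < n \<Longrightarrow> block_row n Y $$ (r, s * n + c) = Y ! s $$ (r, c)"
  using mtuplesD(1)[of Y n m] block_index_less[of s m c n] by (simp add: block_row_def)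

lemma block_row_eqI:
  assumes "M \<in> carrier_mat n (m * n)" "N \<in> carrier_mat n (m * n)"
    and "\<And>s r c. s < m \<Longrightarrow> r < n \<Longrightarrow> c < n \<Longrightarrow> M $$ (r, s * n + c) = N $$ (r, s * n + c)"
  shows "M = N"
proof (rule eq_matI)
  fix r k assume "r < dim_row N" "k < dim_col N"
  then have rk: "r < n" "k < m * n" using assms by auto
  then have "k div n < m" "k mod n < n" by (auto simp: less_mult_imp_div_less)
  from assms(3)[OF this(1) rk(1) this(2)] show "M $$ (r, k) = N $$ (r, k)" by simp
qed (use assms in auto)

lemma mult_block_index:
  assumes "M \<in> carrier_mat a (m * n)" "N \<in> carrier_mat (m * n) b" "i < a" "k < b"
  shows "(M * N) $$ (i, k) = (\<Sum>u<m. \<Sum>v<n. M $$ (i, u * n + v) * N $$ (u * n + v, k))"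
proof -
  have "(M * N) $$ (i, k) = (\<Sum>z<m * n. M $$ (i, z) * N $$ (z, k))"
    using assms by (auto simp: scalar_prod_def atLeast0LessThan intro!: sum.cong)
  then show ?thesis by (simp add: sum_lessThan_mult_split)
qed

lemma mtuples_take: "T \<in> mtuples d m \<Longrightarrow> g \<le> m \<Longrightarrow> take g T \<in> mtuples d g"
  by (auto simp: mtuples_def dest: in_set_takeD)

lemma mtuple_zero_mtuples: "mtuple_zero n m \<in> mtuples n m"
  by (auto simp: mtuple_zero_def mtuples_def)

lemma mtuple_zero_nth [simp]: "j < m \<Longrightarrow> mtuple_zero n m ! j = 0\<^sub>m n n"
  by (simp add: mtuple_zero_def)

lemma mtuples_append: "X \<in> mtuples n a \<Longrightarrow> Y \<in> mtuples n b \<Longrightarrow> X @ Y \<in> mtuples n (a + b)"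
  by (auto simp: mtuples_def)

text \<open>The structure constants convert the pencil of \<open>\<Xi>\<close>, acting on block rows from the right,
  into the pencil of \<open>J\<close>.\<close>

lemma Lam_structure_mult:
  assumes J: "J \<in> mtuples d m" and st: "structure_tuple d J \<Xi>" and g: "g \<le> m"
    and X: "X \<in> mtuples n g" and Y: "Y \<in> mtuples n m" and Z: "Z \<in> mtuples n m"
    and eq: "block_row n Y * (1\<^sub>m (m * n) + Lam m n (take g \<Xi>) X) = block_row n Z"
  shows "Lam d n J Y * (1\<^sub>m (d * n) + Lam d n (take g J) X) = Lam d n J Z"
proof -
  have \<Xi>: "\<Xi> \<in> mtuples m m" using st mtuplesD(1)[OF J] by (simp add: structure_tuple_def)
  note Jg = mtuples_take[OF J g] and \<Xi>g = mtuples_take[OF \<Xi> g]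
  note car = Lam_carrier[OF J Y] Lam_carrier[OF J Z] Lam_carrier[OF Jg X] Lam_carrier[OF \<Xi>g X]
    block_row_carrier[OF Y] block_row_carrier[OF Z]
  \<comment> \<open>The hypothesis read in block \<open>s\<close>: \<open>Z_s\<close> equals
    \<open>Y_s\<close> plus the sum of \<open>(\<Xi>_j)_{k,s} Y_k X_j\<close> over \<open>k\<close>
    and \<open>j\<close>.\<close>
  have Z_ix: "Z ! s $$ (r, c) = Y ! s $$ (r, c) +
      (\<Sum>k<m. \<Sum>j<g. \<Xi> ! j $$ (k, s) * (\<Sum>v<n. Y ! k $$ (r, v) * X ! j $$ (v, c)))"
    if src: "s < m" "r < n" "c < n" for s r c
  proof -
    let ?k = "s * n + c"
    have k: "?k < m * n" using src by (intro block_index_less)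
    have "Z ! s $$ (r, c) = (block_row n Y * (1\<^sub>m (m * n) + Lam m n (take g \<Xi>) X)) $$ (r, ?k)"
      using src by (simp add: eq block_row_index[OF Z])
    also have "block_row n Y * (1\<^sub>m (m * n) + Lam m n (take g \<Xi>) X) =
        block_row n Y + block_row n Y * Lam m n (take g \<Xi>) X"
      using car by (subst mult_add_distrib_mat) auto
    also have "\<dots> $$ (r, ?k) = Y ! s $$ (r, c) + (block_row n Y * Lam m n (take g \<Xi>) X) $$ (r, ?k)"
      using car src k by (simp add: block_row_index[OF Y])
    also have "(block_row n Y * Lam m n (take g \<Xi>) X) $$ (r, ?k) =
        (\<Sum>k<m. \<Sum>v<n. Y ! k $$ (r, v) * (\<Sum>j<g. \<Xi> ! j $$ (k, s) * X ! j $$ (v, c)))"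
      using car src k
      by (subst mult_block_index[of _ n m n _ "m * n"])
        (auto simp: block_row_index[OF Y] Lam_block_index[OF \<Xi>g X] intro!: sum.cong)
    also have "\<dots> = (\<Sum>k<m. \<Sum>j<g. \<Xi> ! j $$ (k, s) * (\<Sum>v<n. Y ! k $$ (r, v) * X ! j $$ (v, c)))"
      unfolding sum_distrib_left by (subst sum.swap) (simp add: mult_ac)
    finally show ?thesis .
  qed
  show ?thesis
  proof (rule block_mat_eqI[of _ d n])
    fix p q r c assume pqrc: "p < d" "q < d" "r < n" "c < n"
    let ?i = "p * n + r" and ?k = "q * n + c"
    have ik: "?i < d * n" "?k < d * n" using pqrc by (auto intro: block_index_less)
    have "(Lam d n J Y * Lam d n (take g J) X) $$ (?i, ?k) =
      (\<Sum>u<d. \<Sum>v<n. (\<Sum>k<m. J ! k $$ (p, u) * Y ! k $$ (r, v)) * (\<Sum>j<g. J ! j $$ (u, q) * X ! j $$ (v, c)))"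
      using car pqrc ik
      by (subst mult_block_index[of _ "d * n" d n _ "d * n"])
        (auto simp: Lam_block_index[OF J Y] Lam_block_index[OF Jg X] intro!: sum.cong)
    also have "\<dots> = (\<Sum>u<d. \<Sum>v<n. \<Sum>k<m. \<Sum>j<g.
        (J ! k $$ (p, u) * J ! j $$ (u, q)) * (Y ! k $$ (r, v) * X ! j $$ (v, c)))"
      by (simp only: sum_product) (simp only: mult_ac)
    \<comment> \<open>With only the outer index set fixed, \<open>sum.swap\<close> pushes the sum
      over \<open>n\<close> inwards past all others; the next step does the same for
      \<open>d\<close>. Then \<open>J_k J_j\<close> appears as the coefficient of
      \<open>Y_k X_j\<close> and the structure constants apply.\<close>
    also have "\<dots> = (\<Sum>u<d. \<Sum>k<m. \<Sum>j<g. \<Sum>v<n.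
        (J ! k $$ (p, u) * J ! j $$ (u, q)) * (Y ! k $$ (r, v) * X ! j $$ (v, c)))"
      by (simp only: sum.swap[of _ _ "{..<n}"])
    also have "\<dots> = (\<Sum>k<m. \<Sum>j<g. \<Sum>u<d. \<Sum>v<n.
        (J ! k $$ (p, u) * J ! j $$ (u, q)) * (Y ! k $$ (r, v) * X ! j $$ (v, c)))"
      by (simp only: sum.swap[of _ _ "{..<d}"])
    also have "\<dots> = (\<Sum>k<m. \<Sum>j<g. (\<Sum>u<d. J ! k $$ (p, u) * J ! j $$ (u, q)) *
        (\<Sum>v<n. Y ! k $$ (r, v) * X ! j $$ (v, c)))"
      by (simp add: sum_product)
    also have "\<dots> = (\<Sum>k<m. \<Sum>j<g. (\<Sum>s<m. \<Xi> ! j $$ (k, s) * J ! s $$ (p, q)) *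
        (\<Sum>v<n. Y ! k $$ (r, v) * X ! j $$ (v, c)))"
      using pqrc g by (intro sum.cong refl) (simp add: structure_tuple_index[OF J st])
    also have "\<dots> = (\<Sum>k<m. \<Sum>s<m. \<Sum>j<g. J ! s $$ (p, q) * (\<Xi> ! j $$ (k, s) *
        (\<Sum>v<n. Y ! k $$ (r, v) * X ! j $$ (v, c))))"
      by (subst (2) sum.swap) (simp add: sum_distrib_right mult_ac)
    also have "\<dots> = (\<Sum>s<m. J ! s $$ (p, q) * (\<Sum>k<m. \<Sum>j<g. \<Xi> ! j $$ (k, s) *
        (\<Sum>v<n. Y ! k $$ (r, v) * X ! j $$ (v, c))))"
      by (subst sum.swap) (simp add: sum_distrib_left)
    finally have prod: "(Lam d n J Y * Lam d n (take g J) X) $$ (?i, ?k) = \<dots>" .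
    have "Lam d n J Y * (1\<^sub>m (d * n) + Lam d n (take g J) X) =
        Lam d n J Y + Lam d n J Y * Lam d n (take g J) X"
      using car by (subst mult_add_distrib_mat) auto
    then have "(Lam d n J Y * (1\<^sub>m (d * n) + Lam d n (take g J) X)) $$ (?i, ?k) =
        Lam d n J Y $$ (?i, ?k) + (Lam d n J Y * Lam d n (take g J) X) $$ (?i, ?k)"
      using car ik by simp
    also have "\<dots> = (\<Sum>s<m. J ! s $$ (p, q) * Z ! s $$ (r, c))"
      using pqrc by (simp add: prod Lam_block_index[OF J Y] Z_ix distrib_left sum.distrib)
    also have "\<dots> = Lam d n J Z $$ (?i, ?k)" using pqrc by (simp add: Lam_block_index[OF J Z])
    finally show "(Lam d n J Y * (1\<^sub>m (d * n) + Lam d n (take g J) X)) $$ (?i, ?k) =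
      Lam d n J Z $$ (?i, ?k)" .
  qed (use car in auto)
qed

lemma Lam_zero:
  assumes "T \<in> mtuples d m"
  shows "Lam d n T (mtuple_zero n m) = 0\<^sub>m (d * n) (d * n)"
  by (rule block_mat_eqI[of _ d n])
    (use assms Lam_carrier[OF assms mtuple_zero_mtuples] in
      \<open>auto simp: Lam_block_index[OF assms mtuple_zero_mtuples] block_index_less\<close>)

section \<open>Invertibility of the pencil of the structure tuple and the block-row form of the
  map\<close>

lemma transpose_mult_vec_index:
  fixes M :: "complex mat"
  assumes "M \<in> carrier_mat a b" "w \<in> carrier_vec a" "k < b"
  shows "vec_index (M\<^sup>T *\<^sub>v w) k = (\<Sum>z<a. vec_index w z * M $$ (z, k))"
  using assms by (auto simp: scalar_prod_def atLeast0LessThan intro!: sum.cong)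

text \<open>A singular pencil of \<open>\<Xi>\<close> has a nonzero left null vector. Made into a
  tuple \<open>Y\<close>, it satisfies \<open>Lam d n J Y * (I + T) = 0\<close> by the preceding
  identity, so the pencil of \<open>J\<close> at \<open>Y\<close> vanishes, and linear independence
  of \<open>J\<close> forces \<open>Y = 0\<close>.\<close>

lemma det_structure_pencil_nonzero:
  assumes J: "J \<in> mtuples d m" and indep: "lin_indep_tuple d J" and st: "structure_tuple d J \<Xi>"
    and g: "g \<le> m" and X: "X \<in> mtuples n g" and n: "1 \<le> n"
    and det: "det (1\<^sub>m (d * n) + Lam d n (take g J) X) \<noteq> 0"
  shows "det (1\<^sub>m (m * n) + Lam m n (take g \<Xi>) X) \<noteq> 0"
proof
  let ?P = "1\<^sub>m (m * n) + Lam m n (take g \<Xi>) X" and ?Q = "1\<^sub>m (d * n) + Lam d n (take g J) X"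
  assume "det ?P = 0"
  have \<Xi>: "\<Xi> \<in> mtuples m m" using st mtuplesD(1)[OF J] by (simp add: structure_tuple_def)
  have P: "?P \<in> carrier_mat (m * n) (m * n)" using Lam_carrier[OF mtuples_take[OF \<Xi> g] X] by simp
  have Q: "?Q \<in> carrier_mat (d * n) (d * n)" using Lam_carrier[OF mtuples_take[OF J g] X] by simp
  have "det ?P\<^sup>T = 0" using \<open>det ?P = 0\<close> det_transpose[OF P] by simp
  then obtain w where w: "w \<in> carrier_vec (m * n)" "w \<noteq> 0\<^sub>v (m * n)" "?P\<^sup>T *\<^sub>v w = 0\<^sub>v (m * n)"
    using det_0_iff_vec_prod_zero_field[of "?P\<^sup>T" "m * n"] P by auto
  \<comment> \<open>The entries do not depend on the row \<open>r\<close>: every row of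
    \<open>block_row n Y\<close> is a copy of the left null vector \<open>w\<close>.\<close>
  define Y where "Y = map (\<lambda>s. Matrix.mat n n (\<lambda>(r, c). vec_index w (s * n + c))) [0..<m]"
  have Y: "Y \<in> mtuples n m" by (rule mtuplesI) (auto simp: Y_def)
  have Y_ix: "Y ! s $$ (r, c) = vec_index w (s * n + c)" if "s < m" "r < n" "c < n" for s r c
    using that by (simp add: Y_def)
  have Z: "mtuple_zero n m \<in> mtuples n m" by (rule mtuple_zero_mtuples)
  have "block_row n Y * ?P = block_row n (mtuple_zero n m)"
  proof (rule block_row_eqI[of _ n m])
    fix s r c assume src: "s < m" "r < n" "c < n"
    have k: "s * n + c < m * n" using src by (intro block_index_less)
    have "(block_row n Y * ?P) $$ (r, s * n + c) =
      (\<Sum>u<m. \<Sum>v<n. vec_index w (u * n + v) * ?P $$ (u * n + v, s * n + c))"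
      using src k P block_row_carrier[OF Y]
      by (subst mult_block_index[of _ n m n _ "m * n"]) (auto simp: block_row_index[OF Y] Y_ix)
    also have "\<dots> = (\<Sum>z<m * n. vec_index w z * ?P $$ (z, s * n + c))"
      by (simp only: sum_lessThan_mult_split)
    also have "\<dots> = vec_index (?P\<^sup>T *\<^sub>v w) (s * n + c)"
      using transpose_mult_vec_index[OF P w(1) k] by simp
    also have "\<dots> = 0" using w k by simp
    also have "\<dots> = block_row n (mtuple_zero n m) $$ (r, s * n + c)"
      using src by (simp add: block_row_index[OF Z])
    finally show "(block_row n Y * ?P) $$ (r, s * n + c) =
      block_row n (mtuple_zero n m) $$ (r, s * n + c)" .
  qed (use P block_row_carrier[OF Y] block_row_carrier[OF Z] in auto)
  from Lam_structure_mult[OF J st g X Y Z this]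
  have LQ: "Lam d n J Y * ?Q = 0\<^sub>m (d * n) (d * n)" by (simp add: Lam_zero[OF J])
  obtain B where B: "B \<in> carrier_mat (d * n) (d * n)" "?Q * B = 1\<^sub>m (d * n)"
    using det_nonzero_inverse[OF Q det] by blast
  have "Lam d n J Y = Lam d n J Y * ?Q * B"
    using assoc_mult_mat[OF Lam_carrier[OF J Y] Q B(1)] B(2) Lam_carrier[OF J Y] by simp
  also have "\<dots> = Lam d n J (mtuple_zero n m)" using LQ B by (simp add: Lam_zero[OF J])
  finally have "Y = mtuple_zero n m" using Lam_inject[OF J indep Y Z] by blast
  have "w = 0\<^sub>v (m * n)"
  proof (rule eq_vecI)
    fix k assume "k < dim_vec (0\<^sub>v (m * n))"
    then have k: "k < m * n" by simp
    then have s: "k div n < m" "k mod n < n" using n by (auto simp: less_mult_imp_div_less)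
    \<comment> \<open>Row 0 gives \<open>w\<close> back; it exists because \<open>n\<close> is at
      least 1.\<close>
    have "vec_index w k = Y ! (k div n) $$ (0, k mod n)" using s n by (simp add: Y_def)
    also have "\<dots> = 0" using s n \<open>Y = mtuple_zero n m\<close> by (simp add: mtuple_zero_def)
    finally show "vec_index w k = vec_index (0\<^sub>v (m * n)) k" using k by simp
  qed (use w in auto)
  then show False using w by simp
qed

text \<open>Padding \<open>X\<close> by \<open>h\<close> zero blocks extends the sum over the first
  \<open>g\<close> blocks in the formula to a full row-times-matrix product. The last equation
  clears the inverse and is the form in which the structure constants can be used.\<close>

lemma convexotonic_map_block_row:
  assumes \<Xi>: "\<Xi> \<in> mtuples (g + h) (g + h)" and X: "X \<in> mtuples n g"
    and det: "det (1\<^sub>m ((g + h) * n) + Lam (g + h) n (take g \<Xi>) X) \<noteq> 0"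
  obtains Y where "convexotonic_map g \<Xi> n X = Some Y" "Y \<in> mtuples n (g + h)"
    "block_row n Y = block_row n (X @ mtuple_zero n h) *
       the (mat_inverse (1\<^sub>m ((g + h) * n) + Lam (g + h) n (take g \<Xi>) X))"
    "block_row n Y * (1\<^sub>m ((g + h) * n) + Lam (g + h) n (take g \<Xi>) X) =
       block_row n (X @ mtuple_zero n h)"
proof -
  let ?m = "g + h"
  let ?P = "1\<^sub>m (?m * n) + Lam ?m n (take g \<Xi>) X"
  have P: "?P \<in> carrier_mat (?m * n) (?m * n)"
    using Lam_carrier[OF mtuples_take[OF \<Xi>, of g] X] by simp
  let ?R = "the (mat_inverse ?P)"
  note R = the_mat_inverse[OF P det]
  have XZ: "X @ mtuple_zero n h \<in> mtuples n ?m" by (rule mtuples_append[OF X mtuple_zero_mtuples])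
  define Y where "Y = map (\<lambda>i. mat_sum n n (map (\<lambda>j. X ! j * mat_block n ?R j i) [0..<g])) [0..<?m]"
  have car: "set (map (\<lambda>j. X ! j * mat_block n ?R j i) [0..<g]) \<subseteq> carrier_mat n n" for i
    using mtuplesD[OF X] by (auto simp: mat_block_def)
  have Y: "Y \<in> mtuples n ?m" by (rule mtuplesI) (simp_all add: Y_def mat_sum_carrier[OF car])
  have row: "block_row n Y = block_row n (X @ mtuple_zero n h) * ?R"
  proof (rule block_row_eqI[of _ n ?m])
    fix s r c assume src: "s < ?m" "r < n" "c < n"
    have k: "s * n + c < ?m * n" using src by (intro block_index_less)
    have "block_row n Y $$ (r, s * n + c) = (\<Sum>j<g. (X ! j * mat_block n ?R j s) $$ (r, c))"
      unfolding block_row_index[OF Y src] using src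
      by (simp add: Y_def del: upt_Suc) (subst mat_sum_index[OF car], auto)
    also have "\<dots> = (\<Sum>j<g. \<Sum>v<n. X ! j $$ (r, v) * ?R $$ (j * n + v, s * n + c))"
      using src mtuplesD[OF X]
      by (auto simp: scalar_prod_def atLeast0LessThan mat_block_def intro!: sum.cong)
    also have "\<dots> = (\<Sum>j<?m. \<Sum>v<n. (X @ mtuple_zero n h) ! j $$ (r, v) * ?R $$ (j * n + v, s * n + c))"
      using mtuplesD(1)[OF X] src
      by (intro sum.mono_neutral_cong_left) (auto simp: nth_append mtuple_zero_def)
    also have "\<dots> = (block_row n (X @ mtuple_zero n h) * ?R) $$ (r, s * n + c)"
      using src k R block_row_carrier[OF XZ]
      by (subst mult_block_index[of _ n ?m n _ "?m * n"]) (auto simp: block_row_index[OF XZ])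
    finally show "block_row n Y $$ (r, s * n + c) =
      (block_row n (X @ mtuple_zero n h) * ?R) $$ (r, s * n + c)" .
  qed (use R block_row_carrier[OF Y] block_row_carrier[OF XZ] in auto)
  show thesis
  proof (rule that[OF _ Y row])
    show "convexotonic_map g \<Xi> n X = Some Y"
      using X det mtuplesD(1)[OF \<Xi>] unfolding convexotonic_map_def Y_def
      by (simp add: Let_def invertible_mat_iff_det[OF P])
    show "block_row n Y * ?P = block_row n (X @ mtuple_zero n h)"
      unfolding row using R P block_row_carrier[OF XZ]
        assoc_mult_mat[OF block_row_carrier[OF XZ] R(1) P] by simp
  qed
qed

subsection \<open>Realization\<close>

lemma mat_adjoint_index:
  "i < dim_col M \<Longrightarrow> k < dim_row M \<Longrightarrow> mat_adjoint M $$ (i, k) = cnj (M $$ (k, i))"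
  by (simp add: mat_adjoint_def mat_of_rows_index)

lemma mat_adjoint_dim [simp]:
  "dim_row (mat_adjoint M) = dim_col M" "dim_col (mat_adjoint M) = dim_row M"
  by (simp_all add: mat_adjoint_def)

text \<open>With unit vectors as \<open>c\<close> and \<open>b\<close> a realization reads off a
  single block of the inverse pencil; each component of the map will be one such block.\<close>

lemma kron_unit_vec_select:
  assumes M: "M \<in> carrier_mat (s * n) (s * n)" and ab: "a < s" "b < s"
  shows "kron (mat_adjoint (mat_of_cols s [unit_vec s a])) (1\<^sub>m n) * M *
    kron (mat_of_cols s [unit_vec s b]) (1\<^sub>m n) = mat_block n M a b"
proof -
  let ?L = "kron (mat_adjoint (mat_of_cols s [unit_vec s a])) (1\<^sub>m n)"
  let ?R = "kron (mat_of_cols s [unit_vec s b]) (1\<^sub>m n)"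
  have L: "?L \<in> carrier_mat n (s * n)" and R: "?R \<in> carrier_mat (s * n) n"
    by (rule carrier_matI; simp add: kron_def)+
  have L_ix: "?L $$ (r, u * n + v) = (if u = a \<and> v = r then 1 else 0)" if "r < n" "u < s" "v < n" for r u v
    using that ab block_index_less[of u s v n]
    by (auto simp: kron_def mat_adjoint_index mat_of_cols_index)
  have R_ix: "?R $$ (u * n + v, c) = (if u = b \<and> v = c then 1 else 0)" if "c < n" "u < s" "v < n" for c u v
    using that ab block_index_less[of u s v n]
    by (auto simp: kron_def mat_of_cols_index)
  have two: "(\<Sum>u<s. \<Sum>v<n. (if u = x \<and> v = y then 1 else 0) * F u v) = F x y"
    "(\<Sum>u<s. \<Sum>v<n. F u v * (if u = x \<and> v = y then 1 else 0)) = F x y"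
    if "x < s" "y < n" for x y and F :: "nat \<Rightarrow> nat \<Rightarrow> complex"
  proof -
    have inner: "(\<Sum>v<n. if u = x \<and> v = y then F x y else 0) = (if u = x then F x y else 0)" for u
      using that by (cases "u = x") simp_all
    show "(\<Sum>u<s. \<Sum>v<n. (if u = x \<and> v = y then 1 else 0) * F u v) = F x y"
      "(\<Sum>u<s. \<Sum>v<n. F u v * (if u = x \<and> v = y then 1 else 0)) = F x y"
      using that by (simp_all add: inner if_distrib if_distribR cong: if_cong)
  qed
  have LM: "(?L * M) $$ (r, k) = M $$ (a * n + r, k)" if "r < n" "k < s * n" for r k
    using that ab L M by (subst mult_block_index[of _ n s n _ "s * n"]) (simp_all add: L_ix two)
  show ?thesis
  proof (rule eq_matI)
    fix r c assume "r < dim_row (mat_block n M a b)" "c < dim_col (mat_block n M a b)"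
    then have rc: "r < n" "c < n" by (simp_all add: mat_block_def)
    then have "(?L * M * ?R) $$ (r, c) = (\<Sum>u<s. \<Sum>v<n. (?L * M) $$ (r, u * n + v) * ?R $$ (u * n + v, c))"
      using L M R by (intro mult_block_index[of _ n s n _ n]) auto
    also have "\<dots> = (?L * M) $$ (r, b * n + c)" using rc ab by (simp add: R_ix two)
    also have "\<dots> = mat_block n M a b $$ (r, c)"
      using rc ab by (simp add: LM block_index_less mat_block_def)
    finally show "(?L * M * ?R) $$ (r, c) = mat_block n M a b $$ (r, c)" .
  qed (use L R in \<open>auto simp: mat_block_def\<close>)
qed

text \<open>With \<open>x = (x_1, ..., x_g, 0, ..., 0)\<close> and \<open>P = I + \<Sum> \<Xi>_j x_j\<close>, the pencil
  \<open>[[I, -x], [0, P]]\<close> has inverse \<open>[[I, x P^{-1}], [0, P^{-1}]]\<close>, whose first block row contains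
  the components of the map; it is invertible exactly when \<open>P\<close> is.\<close>

definition realization_tuple :: "nat \<Rightarrow> nat \<Rightarrow> complex mat list \<Rightarrow> complex mat list" where
  "realization_tuple g m \<Xi> = map (\<lambda>j. Matrix.mat (Suc m) (Suc m) (\<lambda>(a, b).
     if a = 0 then (if b = Suc j then 1 else 0)
     else if b = 0 then 0 else - (\<Xi> ! j $$ (a - 1, b - 1)))) [0..<g]"

lemma realization_tuple_mtuples: "realization_tuple g m \<Xi> \<in> mtuples (Suc m) g"
  by (rule mtuplesI) (auto simp: realization_tuple_def)

lemma realization_pencil:
  assumes \<Xi>: "\<Xi> \<in> mtuples (g + h) (g + h)" and X: "X \<in> mtuples n g"
  shows "1\<^sub>m (Suc (g + h) * n) - Lam (Suc (g + h)) n (realization_tuple g (g + h) \<Xi>) X =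
    four_block_mat (1\<^sub>m n) (- block_row n (X @ mtuple_zero n h)) (0\<^sub>m ((g + h) * n) n)
      (1\<^sub>m ((g + h) * n) + Lam (g + h) n (take g \<Xi>) X)"
    (is "_ - Lam _ _ ?S _ = four_block_mat _ (- ?B) _ ?P")
proof (rule block_mat_eqI[of _ "Suc (g + h)" n])
  let ?m = "g + h"
  have S: "?S \<in> mtuples (Suc ?m) g" by (rule realization_tuple_mtuples)
  have \<Xi>g: "take g \<Xi> \<in> mtuples ?m g" using mtuples_take[OF \<Xi>] by simp
  have XZ: "X @ mtuple_zero n h \<in> mtuples n ?m" by (rule mtuples_append[OF X mtuple_zero_mtuples])
  have B: "?B \<in> carrier_mat n (?m * n)" by (rule block_row_carrier[OF XZ])
  have LP: "Lam ?m n (take g \<Xi>) X \<in> carrier_mat (?m * n) (?m * n)" by (rule Lam_carrier[OF \<Xi>g X])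
  then have P: "?P \<in> carrier_mat (?m * n) (?m * n)" by simp
  have LS: "Lam (Suc ?m) n ?S X \<in> carrier_mat (Suc ?m * n) (Suc ?m * n)" by (rule Lam_carrier[OF S X])
  show "1\<^sub>m (Suc ?m * n) - Lam (Suc ?m) n ?S X \<in> carrier_mat (Suc ?m * n) (Suc ?m * n)"
    using LS by (intro minus_carrier_mat)
  show "four_block_mat (1\<^sub>m n) (- ?B) (0\<^sub>m (?m * n) n) ?P \<in> carrier_mat (Suc ?m * n) (Suc ?m * n)"
    using four_block_carrier_mat[OF one_carrier_mat[of n] P] by simp
  fix p q r c assume pqrc: "p < Suc ?m" "q < Suc ?m" "r < n" "c < n"
  have ik: "p * n + r < Suc ?m * n" "q * n + c < Suc ?m * n" by (intro block_index_less pqrc)+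
  have lhs: "(1\<^sub>m (Suc ?m * n) - Lam (Suc ?m) n ?S X) $$ (p * n + r, q * n + c) =
      (if p * n + r = q * n + c then 1 else 0) - (\<Sum>j<g. ?S ! j $$ (p, q) * X ! j $$ (r, c))"
    using ik LS Lam_block_index[OF S X pqrc] by simp
  have diag: "p * n + r = q * n + c \<longleftrightarrow> p = q \<and> r = c"
  proof
    assume eq: "p * n + r = q * n + c"
    then have "(p * n + r) div n = (q * n + c) div n" "(p * n + r) mod n = (q * n + c) mod n" by simp_all
    then show "p = q \<and> r = c" using pqrc by simp
  qed simp
  \<comment> \<open>Index 0 is the added block row and column; the blocks of the pencil of
    \<open>\<Xi>\<close> are shifted by one.\<close>
  consider "p = 0" "q = 0" | q' where "p = 0" "q = Suc q'" | p' where "p = Suc p'" "q = 0"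
    | p' q' where "p = Suc p'" "q = Suc q'" by (cases p; cases q) auto
  then show "(1\<^sub>m (Suc ?m * n) - Lam (Suc ?m) n ?S X) $$ (p * n + r, q * n + c) =
    four_block_mat (1\<^sub>m n) (- ?B) (0\<^sub>m (?m * n) n) ?P $$ (p * n + r, q * n + c)"
  proof cases
    case 1
    then show ?thesis unfolding lhs diag using pqrc P by (simp add: realization_tuple_def)
  next
    case (2 q')
    have k: "q' * n + c < ?m * n" using 2 pqrc by (intro block_index_less) auto
    \<comment> \<open>Row 0 of the \<open>j\<close>-th coefficient has its only nonzero entry in
      column \<open>Suc j\<close>, so a single variable survives, and none if \<open>q'\<close> is
      at least \<open>g\<close>: exactly the zero padding.\<close>
    have "(\<Sum>j<g. ?S ! j $$ (p, q) * X ! j $$ (r, c)) = (\<Sum>j<g. if j = q' then X ! q' $$ (r, c) else 0)"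
      using 2 pqrc by (intro sum.cong) (auto simp: realization_tuple_def)
    also have "\<dots> = (X @ mtuple_zero n h) ! q' $$ (r, c)"
      using 2 pqrc mtuplesD(1)[OF X] by (auto simp: nth_append)
    finally show ?thesis unfolding lhs diag using pqrc LP B k 2 block_row_index[OF XZ, of q' r c]
      by (simp add: add.assoc)
  next
    case (3 p')
    have k: "p' * n + r < ?m * n" using 3 pqrc by (intro block_index_less) auto
    show ?thesis unfolding lhs diag using 3 k LP pqrc by (simp add: realization_tuple_def add.assoc)
  next
    case (4 p' q')
    have k: "p' * n + r < ?m * n" "q' * n + c < ?m * n"
      using 4 pqrc by (auto intro!: block_index_less)
    have "(\<Sum>j<g. ?S ! j $$ (p, q) * X ! j $$ (r, c)) = - (\<Sum>j<g. \<Xi> ! j $$ (p', q') * X ! j $$ (r, c))"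
      using 4 pqrc by (simp add: realization_tuple_def sum_negf)
    then have "(1\<^sub>m (Suc ?m * n) - Lam (Suc ?m) n ?S X) $$ (p * n + r, q * n + c) =
        (if p' * n + r = q' * n + c then 1 else 0) + Lam ?m n (take g \<Xi>) X $$ (p' * n + r, q' * n + c)"
      unfolding lhs using 4 pqrc by (simp add: Lam_block_index[OF \<Xi>g X])
    also have "\<dots> = ?P $$ (p' * n + r, q' * n + c)" using k LP by simp
    also have "\<dots> = four_block_mat (1\<^sub>m n) (- ?B) (0\<^sub>m (?m * n) n) ?P $$ (p * n + r, q * n + c)"
      using 4 k LP by (simp add: add.assoc)
    finally show ?thesis .
  qed
qed

lemma four_block_upper_inverse:
  fixes P :: "complex mat"
  assumes P: "P \<in> carrier_mat k k" "R \<in> carrier_mat k k" "P * R = 1\<^sub>m k" and B: "B \<in> carrier_mat n k"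
  shows "four_block_mat (1\<^sub>m n) (- B) (0\<^sub>m k n) P * four_block_mat (1\<^sub>m n) (B * R) (0\<^sub>m k n) R = 1\<^sub>m (n + k)"
proof -
  have "four_block_mat (1\<^sub>m n) (- B) (0\<^sub>m k n) P * four_block_mat (1\<^sub>m n) (B * R) (0\<^sub>m k n) R =
    four_block_mat (1\<^sub>m n * 1\<^sub>m n + (- B) * 0\<^sub>m k n) (1\<^sub>m n * (B * R) + (- B) * R)
      (0\<^sub>m k n * 1\<^sub>m n + P * 0\<^sub>m k n) (0\<^sub>m k n * (B * R) + P * R)"
    by (rule mult_four_block_mat) (use P B in auto)
  also have "(- B) * R = - (B * R)" using P B by simp
  also have "1\<^sub>m n * (B * R) + - (B * R) = 0\<^sub>m n k" using P B by (intro eq_matI) auto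
  finally show ?thesis using P B by (auto intro!: eq_matI)
qed

lemma convexotonic_map_dom:
  assumes \<Xi>: "\<Xi> \<in> mtuples m m" and g: "g \<le> m"
  shows "dom (convexotonic_map g \<Xi> n) =
    {X \<in> mtuples n g. det (1\<^sub>m (m * n) + Lam m n (take g \<Xi>) X) \<noteq> 0}"
proof -
  have "X \<in> dom (convexotonic_map g \<Xi> n) \<longleftrightarrow>
    X \<in> mtuples n g \<and> det (1\<^sub>m (m * n) + Lam m n (take g \<Xi>) X) \<noteq> 0" for X
  proof (cases "X \<in> mtuples n g")
    case True
    have "1\<^sub>m (m * n) + Lam m n (take g \<Xi>) X \<in> carrier_mat (m * n) (m * n)"
      using Lam_carrier[OF mtuples_take[OF \<Xi> g] True] by simp
    then show ?thesis
      using True mtuplesD(1)[OF \<Xi>] invertible_mat_iff_det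
      by (auto simp: dom_def convexotonic_map_def Let_def)
  next
    case False
    then show ?thesis by (auto simp: dom_def convexotonic_map_def)
  qed
  then show ?thesis by blast
qed

lemma free_rational_convexotonic_map:
  assumes \<Xi>: "\<Xi> \<in> mtuples (g + h) (g + h)"
  shows "free_rational_map g (g + h) (convexotonic_map g \<Xi>)"
proof -
  let ?m = "g + h"
  let ?S = "realization_tuple g ?m \<Xi>"
  let ?P = "\<lambda>n X. 1\<^sub>m (?m * n) + Lam ?m n (take g \<Xi>) X"
  let ?Q = "\<lambda>n X. 1\<^sub>m (Suc ?m * n) - Lam (Suc ?m) n ?S X"
  have P: "?P n X \<in> carrier_mat (?m * n) (?m * n)" if "X \<in> mtuples n g" for n X
    using Lam_carrier[OF mtuples_take[OF \<Xi>, of g] that] by simp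
  have Q: "?Q n X \<in> carrier_mat (Suc ?m * n) (Suc ?m * n)" if "X \<in> mtuples n g" for n X
    using Lam_carrier[OF realization_tuple_mtuples that] by (intro minus_carrier_mat)
  have XZ: "X @ mtuple_zero n h \<in> mtuples n ?m" if "X \<in> mtuples n g" for n X
    by (rule mtuples_append[OF that mtuple_zero_mtuples])
  \<comment> \<open>The realization has to be undefined exactly where the map is. The pencil is
    block triangular with diagonal blocks \<open>I\<close> and \<open>?P n X\<close>, so the
    determinants agree.\<close>
  have det_Q: "det (?Q n X) = det (?P n X)" if X: "X \<in> mtuples n g" for n X
    unfolding realization_pencil[OF \<Xi> X]
    using P[OF X] block_row_carrier[OF XZ[OF X]]
    by (subst det_four_block_mat_lower_left_zero[of _ n _ "?m * n"]) auto
  have dom: "dom (convexotonic_map g \<Xi> n) = {X \<in> mtuples n g. \<forall>i<?m. invertible_mat (?Q n X)}" for n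
  proof -
    have "det (?P n X) \<noteq> 0 \<longleftrightarrow> (\<forall>i<?m. invertible_mat (?Q n X))" if X: "X \<in> mtuples n g" for X
    \<comment> \<open>Without components the condition on the right is vacuous, while the pencil on
      the left is an empty matrix with determinant 1.\<close>
    proof (cases "?m = 0")
      case True
      then show ?thesis using P[OF X] by (simp add: det_dim_zero)
    next
      case False
      then show ?thesis using invertible_mat_iff_det[OF Q[OF X]] det_Q[OF X] by auto
    qed
    then show ?thesis unfolding convexotonic_map_dom[OF \<Xi> le_add1] by blast
  qed
  have val: "convexotonic_map g \<Xi> n X =
      Some (map (\<lambda>i. realization_value (Suc ?m) ?S (unit_vec (Suc ?m) (Suc i)) (unit_vec (Suc ?m) 0) n X) [0..<?m])"
    if "X \<in> dom (convexotonic_map g \<Xi> n)" for n X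
  proof -
    have X: "X \<in> mtuples n g" and det: "det (?P n X) \<noteq> 0"
      using that unfolding convexotonic_map_dom[OF \<Xi> le_add1] by auto
    let ?R = "the (mat_inverse (?P n X))"
    let ?B = "block_row n (X @ mtuple_zero n h)"
    note R = the_mat_inverse[OF P[OF X] det]
    note B = block_row_carrier[OF XZ[OF X]]
    let ?I = "four_block_mat (1\<^sub>m n) (?B * ?R) (0\<^sub>m (?m * n) n) ?R"
    have I: "?I \<in> carrier_mat (Suc ?m * n) (Suc ?m * n)"
      using four_block_carrier_mat[OF one_carrier_mat[of n] R(1)] by simp
    have inv: "the (mat_inverse (?Q n X)) = ?I"
    proof (rule the_mat_inverse_eq[OF Q[OF X] I])
      show "?Q n X * ?I = 1\<^sub>m (Suc ?m * n)"
        unfolding realization_pencil[OF \<Xi> X]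
        using four_block_upper_inverse[OF P[OF X] R(1,2) B] by simp
    qed
    obtain Y where Y: "convexotonic_map g \<Xi> n X = Some Y" "Y \<in> mtuples n ?m"
      and row: "block_row n Y = ?B * ?R"
      using convexotonic_map_block_row[OF \<Xi> X det] by metis
    have "Y = map (\<lambda>i. realization_value (Suc ?m) ?S (unit_vec (Suc ?m) (Suc i)) (unit_vec (Suc ?m) 0) n X) [0..<?m]"
    proof (rule nth_equalityI)
      fix i assume "i < length Y"
      then have i: "i < ?m" using mtuplesD(1)[OF Y(2)] by simp
      have "realization_value (Suc ?m) ?S (unit_vec (Suc ?m) (Suc i)) (unit_vec (Suc ?m) 0) n X =
          mat_block n ?I 0 (Suc i)"
        unfolding realization_value_def inv using i by (subst kron_unit_vec_select[OF I]) auto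
      also have "\<dots> = Y ! i"
      proof (rule eq_matI)
        fix r c assume "r < dim_row (Y ! i)" "c < dim_col (Y ! i)"
        then have rc: "r < n" "c < n" using mtuplesD(3,4)[OF Y(2) i] by auto
        have k: "i * n + c < ?m * n" using i rc by (intro block_index_less)
        have "mat_block n ?I 0 (Suc i) $$ (r, c) = ?I $$ (r, n + (i * n + c))"
          using rc by (simp add: mat_block_def add.assoc)
        also have "\<dots> = block_row n Y $$ (r, i * n + c)"
          unfolding row using rc k R(1) B by simp
        also have "\<dots> = Y ! i $$ (r, c)" by (rule block_row_index[OF Y(2) i rc])
        finally show "mat_block n ?I 0 (Suc i) $$ (r, c) = Y ! i $$ (r, c)" .
      qed (use mtuplesD(3,4)[OF Y(2) i] in \<open>auto simp: mat_block_def\<close>)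
      finally show "Y ! i = map (\<lambda>i. realization_value (Suc ?m) ?S (unit_vec (Suc ?m) (Suc i))
          (unit_vec (Suc ?m) 0) n X) [0..<?m] ! i"
        using i by simp
    qed (use mtuplesD(1)[OF Y(2)] in simp)
    then show ?thesis using Y(1) by simp
  qed
  show ?thesis
    unfolding free_rational_map_def
    \<comment> \<open>All components share one pencil and the vector \<open>c\<close>; only
      \<open>b\<close> depends on the component.\<close>
    by (intro exI[of _ "\<lambda>i. Suc ?m"] exI[of _ "\<lambda>i. ?S"] exI[of _ "\<lambda>i. unit_vec (Suc ?m) (Suc i)"]
        exI[of _ "\<lambda>i. unit_vec (Suc ?m) 0"] conjI allI impI ballI)
      (use dom val realization_tuple_mtuples in \<open>simp_all\<close>)
qed

subsection \<open>Contractions and the positivity condition\<close>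

lemma vnorm_square_sum: "(vnorm v)\<^sup>2 = (\<Sum>i<dim_vec v. (cmod (vec_index v i))\<^sup>2)"
  by (simp add: vnorm_def L2_set_def sum_nonneg)

lemma mult_mat_vec_index_sum:
  assumes "M \<in> carrier_mat a b" "v \<in> carrier_vec b" "i < a"
  shows "vec_index (M *\<^sub>v v) i = (\<Sum>k<b. M $$ (i, k) * vec_index v k)"
  using assms by (auto simp: scalar_prod_def atLeast0LessThan intro!: sum.cong)

lemma cscalar_prod_sum:
  assumes "u \<in> carrier_vec N" "v \<in> carrier_vec N"
  shows "u \<bullet>c v = (\<Sum>i<N. vec_index u i * cnj (vec_index v i))"
  using assms by (auto simp: scalar_prod_def atLeast0LessThan intro!: sum.cong)

lemma vnorm_square_add:
  assumes u: "u \<in> carrier_vec N" and v: "v \<in> carrier_vec N"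
  shows "(vnorm (v + u))\<^sup>2 = (vnorm v)\<^sup>2 + 2 * Re (u \<bullet>c v) + (vnorm u)\<^sup>2"
proof -
  have sq: "(cmod (a + b))\<^sup>2 = (cmod a)\<^sup>2 + 2 * Re (b * cnj a) + (cmod b)\<^sup>2" for a b
    unfolding cmod_power2 by (simp add: power2_eq_square algebra_simps)
  have "(vnorm (v + u))\<^sup>2 = (\<Sum>i<N. (cmod (vec_index v i + vec_index u i))\<^sup>2)"
    unfolding vnorm_square_sum using u v by (intro sum.cong) auto
  then show ?thesis
    unfolding vnorm_square_sum[of u] vnorm_square_sum[of v] cscalar_prod_sum[OF u v] sq
    using u v by (simp add: sum.distrib sum_distrib_left)
qed

lemma adjoint_quadratic_form:
  assumes T: "T \<in> carrier_mat N N" and v: "v \<in> carrier_vec N"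
  shows "(mat_adjoint T *\<^sub>v v) \<bullet>c v = cnj ((T *\<^sub>v v) \<bullet>c v)"
proof -
  have T': "mat_adjoint T \<in> carrier_mat N N" using T by (intro carrier_matI) auto
  have Tv: "vec_index (T *\<^sub>v v) i = (\<Sum>k<N. T $$ (i, k) * vec_index v k)" if "i < N" for i
    by (rule mult_mat_vec_index_sum[OF T v that])
  have T'v: "vec_index (mat_adjoint T *\<^sub>v v) i = (\<Sum>k<N. cnj (T $$ (k, i)) * vec_index v k)"
    if "i < N" for i
    unfolding mult_mat_vec_index_sum[OF T' v that]
    using that T by (intro sum.cong) (auto simp: mat_adjoint_index)
  have "(mat_adjoint T *\<^sub>v v) \<bullet>c v =
      (\<Sum>i<N. \<Sum>k<N. cnj (T $$ (k, i)) * vec_index v k * cnj (vec_index v i))"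
    using T' v by (subst cscalar_prod_sum[of _ N]) (auto simp: T'v sum_distrib_right simp del: index_mult_mat_vec)
  also have "\<dots> = (\<Sum>k<N. \<Sum>i<N. cnj (T $$ (k, i)) * vec_index v k * cnj (vec_index v i))"
    by (rule sum.swap)
  also have "\<dots> = cnj ((T *\<^sub>v v) \<bullet>c v)"
    using T v by (subst cscalar_prod_sum[of _ N])
      (auto simp: Tv sum_distrib_right sum_distrib_left mult_ac simp del: index_mult_mat_vec)
  finally show ?thesis .
qed

lemma pos_semidef_iff_vnorm:
  assumes T: "T \<in> carrier_mat N N"
  shows "pos_semidef (1\<^sub>m N + T + mat_adjoint T) \<longleftrightarrow>
    (\<forall>v\<in>carrier_vec N. vnorm (T *\<^sub>v v) \<le> vnorm (v + T *\<^sub>v v))"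
proof -
  let ?H = "1\<^sub>m N + T + mat_adjoint T"
  have T': "mat_adjoint T \<in> carrier_mat N N" using T by (intro carrier_matI) auto
  have H: "?H \<in> carrier_mat N N" using T T' by simp
  have herm: "mat_adjoint ?H = ?H"
    by (rule eq_matI) (use T T' in \<open>auto simp: mat_adjoint_index\<close>)
  have "0 \<le> Re ((?H *\<^sub>v v) \<bullet>c v) \<longleftrightarrow> vnorm (T *\<^sub>v v) \<le> vnorm (v + T *\<^sub>v v)"
    if v: "v \<in> carrier_vec N" for v
  proof -
    have Tv: "T *\<^sub>v v \<in> carrier_vec N" "mat_adjoint T *\<^sub>v v \<in> carrier_vec N" using T T' v by auto
    have "?H *\<^sub>v v = v + T *\<^sub>v v + mat_adjoint T *\<^sub>v v"
      using T T' v by (simp add: add_mult_distrib_mat_vec[of _ N N])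
    then have "Re ((?H *\<^sub>v v) \<bullet>c v) = Re (v \<bullet>c v) + Re ((T *\<^sub>v v) \<bullet>c v) + Re ((mat_adjoint T *\<^sub>v v) \<bullet>c v)"
      using v Tv by (simp add: add_scalar_prod_distrib[of _ N])
    also have "\<dots> = (vnorm v)\<^sup>2 + 2 * Re ((T *\<^sub>v v) \<bullet>c v)"
      using adjoint_quadratic_form[OF T v] by (simp add: vnorm_square)
    also have "\<dots> = (vnorm (v + T *\<^sub>v v))\<^sup>2 - (vnorm (T *\<^sub>v v))\<^sup>2"
      using vnorm_square_add[OF Tv(1) v] by simp
    finally show ?thesis by (simp add: power_mono_iff)
  qed
  then show ?thesis unfolding pos_semidef_def using H herm carrier_matD[OF T] by auto
qed

text \<open>On the kernel of \<open>I + T\<close> the bound forces \<open>T v = 0\<close>, hence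
  \<open>v = 0\<close>. The factor \<open>b\<close> is left free because interior points supply some
  \<rho> < 1 and boundary points supply 1.\<close>

lemma det_one_plus_nonzero:
  assumes T: "T \<in> carrier_mat N N"
    and le: "\<And>v. v \<in> carrier_vec N \<Longrightarrow> vnorm (T *\<^sub>v v) \<le> b * vnorm (v + T *\<^sub>v v)"
  shows "det (1\<^sub>m N + T) \<noteq> 0"
proof
  assume "det (1\<^sub>m N + T) = 0"
  then obtain v where v: "v \<in> carrier_vec N" "v \<noteq> 0\<^sub>v N" "(1\<^sub>m N + T) *\<^sub>v v = 0\<^sub>v N"
    using det_0_iff_vec_prod_zero_field[of "1\<^sub>m N + T" N] T by auto
  have sum0: "v + T *\<^sub>v v = 0\<^sub>v N" using v T by (simp add: add_mult_distrib_mat_vec[of _ N N])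
  then have "vnorm (T *\<^sub>v v) = 0" using le[OF v(1)] vnorm_nonneg[of "T *\<^sub>v v"] by simp
  then have "T *\<^sub>v v = 0\<^sub>v N" using vnorm_eq_0[of "T *\<^sub>v v" N] T v by simp
  then show False using sum0 v by simp
qed

text \<open>Substitute \<open>w = v + T v\<close>, a bijective change of vector since
  \<open>I + T\<close> is invertible, under which \<open>M w = T v\<close>. The case
  \<open>b = 1\<close> is membership in the spectrahedron against membership in the ball; smaller
  \<open>b\<close> compares the interiors.\<close>

lemma op_norm_Cayley_le_iff:
  assumes T: "T \<in> carrier_mat N N" and M: "M \<in> carrier_mat N N" and MT: "M * (1\<^sub>m N + T) = T"
    and det: "det (1\<^sub>m N + T) \<noteq> 0" and b: "0 \<le> b"
  shows "op_norm M \<le> b \<longleftrightarrow> (\<forall>v\<in>carrier_vec N. vnorm (T *\<^sub>v v) \<le> b * vnorm (v + T *\<^sub>v v))"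
proof -
  have IT: "1\<^sub>m N + T \<in> carrier_mat N N" using T by simp
  have Tv: "M *\<^sub>v (v + T *\<^sub>v v) = T *\<^sub>v v" if v: "v \<in> carrier_vec N" for v
  proof -
    have "T *\<^sub>v v = M *\<^sub>v ((1\<^sub>m N + T) *\<^sub>v v)"
      using assoc_mult_mat_vec[OF M IT v] MT by simp
    also have "(1\<^sub>m N + T) *\<^sub>v v = v + T *\<^sub>v v" using v T by (simp add: add_mult_distrib_mat_vec[of _ N N])
    finally show ?thesis by simp
  qed
  show ?thesis
  proof
    assume le: "op_norm M \<le> b"
    show "\<forall>v\<in>carrier_vec N. vnorm (T *\<^sub>v v) \<le> b * vnorm (v + T *\<^sub>v v)"
    proof
      fix v :: "complex vec" assume v: "v \<in> carrier_vec N"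
      have "vnorm (T *\<^sub>v v) \<le> op_norm M * vnorm (v + T *\<^sub>v v)"
        using vnorm_mult_le_op_norm[of "v + T *\<^sub>v v" M] Tv[OF v] M T v by simp
      also have "\<dots> \<le> b * vnorm (v + T *\<^sub>v v)" using le by (intro mult_right_mono) auto
      finally show "vnorm (T *\<^sub>v v) \<le> b * vnorm (v + T *\<^sub>v v)" .
    qed
  next
    assume le: "\<forall>v\<in>carrier_vec N. vnorm (T *\<^sub>v v) \<le> b * vnorm (v + T *\<^sub>v v)"
    obtain B where B: "B \<in> carrier_mat N N" "(1\<^sub>m N + T) * B = 1\<^sub>m N"
      using det_nonzero_inverse[OF IT det] by blast
    show "op_norm M \<le> b"
    proof (rule op_norm_leI[OF b])
      fix w :: "complex vec" assume "w \<in> carrier_vec (dim_col M)"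
      then have w: "w \<in> carrier_vec N" using M by simp
      let ?v = "B *\<^sub>v w"
      have v: "?v \<in> carrier_vec N" using B w by simp
      have "w = (1\<^sub>m N + T) *\<^sub>v ?v" using assoc_mult_mat_vec[OF IT B(1) w] B(2) w by simp
      also have "\<dots> = ?v + T *\<^sub>v ?v" using v T by (simp add: add_mult_distrib_mat_vec[of _ N N])
      finally have "w = ?v + T *\<^sub>v ?v" .
      then show "vnorm (M *\<^sub>v w) \<le> b * vnorm w" using le v Tv[OF v] by metis
    qed
  qed
qed

subsection \<open>The metric on matrix tuples\<close>

lemma mtuple_entry_le_dist:
  "j < m \<Longrightarrow> r < n \<Longrightarrow> c < n \<Longrightarrow> cmod (X ! j $$ (r, c) - Y ! j $$ (r, c)) \<le> mtuple_dist n m X Y"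
  unfolding mtuple_dist_def
  using member_le_L2_set[of "{..<m} \<times> {..<n} \<times> {..<n}" "(j, r, c)"
      "\<lambda>(j, r, c). cmod (X ! j $$ (r, c) - Y ! j $$ (r, c))"] by simp

lemma mtuple_dist_le_sum:
  "mtuple_dist n m X Y \<le>
    (\<Sum>(j, r, c)\<in>{..<m} \<times> {..<n} \<times> {..<n}. cmod (X ! j $$ (r, c) - Y ! j $$ (r, c)))"
  unfolding mtuple_dist_def by (intro L2_set_le_sum) auto

lemma mtuple_dist_nonneg [simp]: "0 \<le> mtuple_dist n m X Y"
  by (simp add: mtuple_dist_def)

lemma mtuple_interior:
  "X \<in> mtuple_topology n m interior_of S \<longleftrightarrow>
    X \<in> mtuples n m \<and> (\<exists>\<epsilon>>0. \<forall>Y\<in>mtuples n m. mtuple_dist n m X Y < \<epsilon> \<longrightarrow> Y \<in> S)"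
  unfolding mtuple_topology_def Metric_space.in_interior_of_mball[OF Metric_space_mtuples]
  by (auto simp: Metric_space.in_mball[OF Metric_space_mtuples] subset_iff)

text \<open>The second hypothesis is openness of the complement, so the closure in the definition of
  the frontier is the set itself.\<close>

lemma mtuple_frontier:
  assumes S: "S \<subseteq> mtuples n m" and closed: "\<And>X. X \<in> mtuples n m \<Longrightarrow> X \<notin> S \<Longrightarrow>
    \<exists>\<epsilon>>0. \<forall>Y\<in>mtuples n m. mtuple_dist n m X Y < \<epsilon> \<longrightarrow> Y \<notin> S"
  shows "mtuple_topology n m frontier_of S = S - mtuple_topology n m interior_of S"
proof -
  have "closedin (mtuple_topology n m) S"
    unfolding mtuple_topology_def Metric_space.closedin_metric[OF Metric_space_mtuples]
  proof (intro conjI S allI impI)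
    fix X assume "X \<in> mtuples n m - S"
    then obtain \<epsilon> where "\<epsilon> > 0" "\<forall>Y\<in>mtuples n m. mtuple_dist n m X Y < \<epsilon> \<longrightarrow> Y \<notin> S"
      using closed by blast
    then show "\<exists>r>0. disjnt S (Metric_space.mball (mtuples n m) (mtuple_dist n m) X r)"
      by (intro exI[of _ \<epsilon>]) (auto simp: disjnt_iff Metric_space.in_mball[OF Metric_space_mtuples])
  qed
  then show ?thesis by (simp add: frontier_of_def closure_of_closedin)
qed

text \<open>Bolzano-Weierstrass for finitely many complex coordinates.\<close>

lemma mtuple_bounded_subsequence:
  fixes \<sigma> :: "nat \<Rightarrow> complex mat list"
  assumes bounded: "\<And>k j r c. j < m \<Longrightarrow> r < n \<Longrightarrow> c < n \<Longrightarrow> cmod (\<sigma> k ! j $$ (r, c)) \<le> b"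
  obtains l \<rho> where "l \<in> mtuples n m" "strict_mono \<rho>" "(\<lambda>k. mtuple_dist n m (\<sigma> (\<rho> k)) l) \<longlonglongrightarrow> 0"
proof -
  let ?B = "{..<m} \<times> {..<n} \<times> {..<n}"
  define f where "f = (\<lambda>k (j, r, c). \<sigma> k ! j $$ (r, c))"
  have "\<forall>\<delta>\<subseteq>?B. \<exists>l. \<exists>\<rho>. strict_mono \<rho> \<and>
    (\<forall>\<epsilon>>0. eventually (\<lambda>k. \<forall>i\<in>\<delta>. dist (f (\<rho> k) i) (l i) < \<epsilon>) sequentially)"
  \<comment> \<open>The points are already functions on the finite index set \<open>?B\<close>, so
    projecting to a coordinate is application and \<open>unproj\<close> is the identity.\<close>
  proof (rule compact_lemma_general[where unproj = "\<lambda>x. x"])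
    show "finite ?B" by simp
    fix i assume "i \<in> ?B"
    then show "bounded ((\<lambda>x. x i) ` range f)"
      unfolding bounded_iff using bounded by (auto simp: f_def intro!: exI[of _ b])
  qed simp_all
  then obtain l \<rho> where \<rho>: "strict_mono \<rho>"
    and lim: "\<And>\<epsilon>. \<epsilon> > 0 \<Longrightarrow> eventually (\<lambda>k. \<forall>i\<in>?B. dist (f (\<rho> k) i) (l i) < \<epsilon>) sequentially"
    by blast
  define L where "L = map (\<lambda>j. Matrix.mat n n (\<lambda>(r, c). l (j, r, c))) [0..<m]"
  have L: "L \<in> mtuples n m" by (rule mtuplesI) (auto simp: L_def)
  have conv: "(\<lambda>k. cmod (f (\<rho> k) i - l i)) \<longlonglongrightarrow> 0" if i: "i \<in> ?B" for i
  proof -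
    have "(\<lambda>k. f (\<rho> k) i) \<longlonglongrightarrow> l i"
      unfolding tendsto_iff by (intro allI impI eventually_mono[OF lim]) (use i in auto)
    then show ?thesis by (intro tendsto_norm_zero) (rule LIM_zero)
  qed
  have sum0: "(\<lambda>k. \<Sum>i\<in>?B. cmod (f (\<rho> k) i - l i)) \<longlonglongrightarrow> 0"
    using tendsto_sum[of ?B "\<lambda>i k. cmod (f (\<rho> k) i - l i)" "\<lambda>_. 0" sequentially] conv by simp
  have "(\<lambda>k. mtuple_dist n m (\<sigma> (\<rho> k)) L) \<longlonglongrightarrow> 0"
  proof (rule tendsto_sandwich[OF _ _ tendsto_const sum0])
    have "mtuple_dist n m (\<sigma> (\<rho> k)) L \<le> (\<Sum>i\<in>?B. cmod (f (\<rho> k) i - l i))" for k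
    proof -
      have "(\<Sum>(j, r, c)\<in>?B. cmod (\<sigma> (\<rho> k) ! j $$ (r, c) - L ! j $$ (r, c))) =
          (\<Sum>i\<in>?B. cmod (f (\<rho> k) i - l i))"
        by (rule sum.cong) (auto simp: f_def L_def)
      then show ?thesis using mtuple_dist_le_sum[of n m "\<sigma> (\<rho> k)" L] by simp
    qed
    then show "\<forall>\<^sub>F k in sequentially. mtuple_dist n m (\<sigma> (\<rho> k)) L \<le> (\<Sum>i\<in>?B. cmod (f (\<rho> k) i - l i))"
      by simp
  qed simp
  with L \<rho> show thesis using that by blast
qed

section \<open>Comparison of the tuple metric with the operator norm of the pencil;
  dilations\<close>

lemma Lam_lipschitz:
  assumes T: "T \<in> mtuples d m"
  obtains K where "0 < K" "\<And>X Y. X \<in> mtuples n m \<Longrightarrow> Y \<in> mtuples n m \<Longrightarrow>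
    op_norm (Lam d n T X - Lam d n T Y) \<le> K * mtuple_dist n m X Y"
proof -
  define K where "K = (\<Sum>i<d * n. \<Sum>k<d * n. \<Sum>j<m. cmod (T ! j $$ (i div n, k div n)))"
  have K: "0 \<le> K" unfolding K_def by (intro sum_nonneg) simp
  have "op_norm (Lam d n T X - Lam d n T Y) \<le> (K + 1) * mtuple_dist n m X Y"
    if X: "X \<in> mtuples n m" and Y: "Y \<in> mtuples n m" for X Y
  proof -
    note car = Lam_carrier[OF T X] Lam_carrier[OF T Y]
    have "op_norm (Lam d n T X - Lam d n T Y) \<le>
        (\<Sum>i<d * n. \<Sum>k<d * n. cmod ((Lam d n T X - Lam d n T Y) $$ (i, k)))"
      using op_norm_le_sum[of "Lam d n T X - Lam d n T Y"] car by simp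
    also have "\<dots> \<le> (\<Sum>i<d * n. \<Sum>k<d * n. \<Sum>j<m. cmod (T ! j $$ (i div n, k div n)) * mtuple_dist n m X Y)"
    proof (intro sum_mono)
      fix i k assume "i \<in> {..<d * n}" "k \<in> {..<d * n}"
      then have ik: "i < d * n" "k < d * n" by auto
      then have n: "0 < n" by (cases n) auto
      have eq: "(Lam d n T X - Lam d n T Y) $$ (i, k) = (\<Sum>j<m. T ! j $$ (i div n, k div n) *
          (X ! j $$ (i mod n, k mod n) - Y ! j $$ (i mod n, k mod n)))"
        using ik car by (simp add: Lam_index[OF T X] Lam_index[OF T Y] right_diff_distrib sum_subtractf)
      show "cmod ((Lam d n T X - Lam d n T Y) $$ (i, k)) \<le>
          (\<Sum>j<m. cmod (T ! j $$ (i div n, k div n)) * mtuple_dist n m X Y)"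
        unfolding eq by (rule order_trans[OF norm_sum])
          (use n in \<open>auto intro!: sum_mono mult_left_mono mtuple_entry_le_dist simp: norm_mult\<close>)
    qed
    also have "\<dots> = K * mtuple_dist n m X Y" by (simp add: K_def sum_distrib_right)
    also have "\<dots> \<le> (K + 1) * mtuple_dist n m X Y" by (intro mult_right_mono) auto
    finally show ?thesis .
  qed
  \<comment> \<open>\<open>K\<close> vanishes if all coefficients do. Adding 1 makes the constant
    positive, since later radii are obtained by dividing by it.\<close>
  with K show thesis by (intro that[of "K + 1"]) auto
qed

text \<open>Quantitative linear independence: each entry of a tuple is a fixed linear functional of
  its pencil. It turns norm bounds on pencils into bounds on tuples, for properness and for the
  derivative.\<close>

lemma Lam_bounded_below:
  assumes T: "T \<in> mtuples d m" and indep: "lin_indep_tuple d T"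
  obtains K where "0 < K" "\<And>X Y. X \<in> mtuples n m \<Longrightarrow> Y \<in> mtuples n m \<Longrightarrow>
    mtuple_dist n m X Y \<le> K * op_norm (Lam d n T X - Lam d n T Y)"
proof -
  obtain \<phi> where \<phi>: "\<And>n Y s r c. Y \<in> mtuples n m \<Longrightarrow> s < m \<Longrightarrow> r < n \<Longrightarrow> c < n \<Longrightarrow>
    Y ! s $$ (r, c) = (\<Sum>p<d. \<Sum>q<d. \<phi> s p q * Lam d n T Y $$ (p * n + r, q * n + c))"
    using lin_indep_recover[OF assms] by blast
  let ?B = "{..<m} \<times> {..<n} \<times> {..<n}"
  define K where "K = (\<Sum>(s, r, c)\<in>?B. \<Sum>p<d. \<Sum>q<d. cmod (\<phi> s p q))"
  have K: "0 \<le> K" unfolding K_def by (intro sum_nonneg) (auto intro!: sum_nonneg)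
  have "mtuple_dist n m X Y \<le> (K + 1) * op_norm (Lam d n T X - Lam d n T Y)"
    if X: "X \<in> mtuples n m" and Y: "Y \<in> mtuples n m" for X Y
  proof -
    let ?D = "Lam d n T X - Lam d n T Y"
    note car = Lam_carrier[OF T X] Lam_carrier[OF T Y]
    have entry: "cmod (X ! s $$ (r, c) - Y ! s $$ (r, c)) \<le> (\<Sum>p<d. \<Sum>q<d. cmod (\<phi> s p q)) * op_norm ?D"
      if src: "s < m" "r < n" "c < n" for s r c
    proof -
      have eq: "X ! s $$ (r, c) - Y ! s $$ (r, c) = (\<Sum>p<d. \<Sum>q<d. \<phi> s p q * ?D $$ (p * n + r, q * n + c))"
        using src car block_index_less[of _ d _ n]
        by (simp add: \<phi>[OF X src] \<phi>[OF Y src] right_diff_distrib sum_subtractf)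
      have "cmod (X ! s $$ (r, c) - Y ! s $$ (r, c)) \<le>
          (\<Sum>p<d. cmod (\<Sum>q<d. \<phi> s p q * ?D $$ (p * n + r, q * n + c)))"
        unfolding eq by (rule norm_sum)
      also have "\<dots> \<le> (\<Sum>p<d. \<Sum>q<d. cmod (\<phi> s p q) * op_norm ?D)"
      proof (rule sum_mono)
        fix p assume p: "p \<in> {..<d}"
        show "cmod (\<Sum>q<d. \<phi> s p q * ?D $$ (p * n + r, q * n + c)) \<le> (\<Sum>q<d. cmod (\<phi> s p q) * op_norm ?D)"
        proof (rule order_trans[OF norm_sum], rule sum_mono)
          fix q assume "q \<in> {..<d}"
          then have "cmod (?D $$ (p * n + r, q * n + c)) \<le> op_norm ?D"
            using p src car by (intro entry_le_op_norm) (auto intro: block_index_less)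
          then show "cmod (\<phi> s p q * ?D $$ (p * n + r, q * n + c)) \<le> cmod (\<phi> s p q) * op_norm ?D"
            unfolding norm_mult by (intro mult_left_mono) auto
        qed
      qed
      finally show ?thesis by (simp add: sum_distrib_right)
    qed
    have "mtuple_dist n m X Y \<le> (\<Sum>(s, r, c)\<in>?B. cmod (X ! s $$ (r, c) - Y ! s $$ (r, c)))"
      by (rule mtuple_dist_le_sum)
    also have "\<dots> \<le> (\<Sum>(s, r, c)\<in>?B. (\<Sum>p<d. \<Sum>q<d. cmod (\<phi> s p q)) * op_norm ?D)"
      by (rule sum_mono) (auto intro: entry)
    also have "\<dots> = K * op_norm ?D"
      unfolding K_def sum_distrib_right[of _ ?B] by (simp add: case_prod_unfold)
    also have "\<dots> \<le> (K + 1) * op_norm ?D" by (intro mult_right_mono) (auto simp: op_norm_nonneg)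
    finally show ?thesis .
  qed
  with K show thesis by (intro that[of "K + 1"]) auto
qed

lemma mtuple_smult_mtuples: "X \<in> mtuples n m \<Longrightarrow> map ((\<cdot>\<^sub>m) a) X \<in> mtuples n m"
  by (auto simp: mtuples_def)

lemma Lam_smult:
  assumes T: "T \<in> mtuples d m" and X: "X \<in> mtuples n m"
  shows "Lam d n T (map ((\<cdot>\<^sub>m) a) X) = a \<cdot>\<^sub>m Lam d n T X"
proof -
  note aX = mtuple_smult_mtuples[OF X, of a]
  note car = Lam_carrier[OF T X] Lam_carrier[OF T aX]
  show ?thesis
  proof (rule block_mat_eqI[of _ d n])
    fix p q r c assume pqrc: "p < d" "q < d" "r < n" "c < n"
    have "p * n + r < d * n" "q * n + c < d * n" by (intro block_index_less pqrc)+
    moreover have "(map ((\<cdot>\<^sub>m) a) X) ! j $$ (r, c) = a * X ! j $$ (r, c)" if "j < m" for j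
      using that pqrc mtuplesD[OF X] by simp
    ultimately show "Lam d n T (map ((\<cdot>\<^sub>m) a) X) $$ (p * n + r, q * n + c) =
        (a \<cdot>\<^sub>m Lam d n T X) $$ (p * n + r, q * n + c)"
      using car pqrc by (simp add: Lam_block_index[OF T X] Lam_block_index[OF T aX] sum_distrib_left mult.left_commute)
  qed (use car in auto)
qed

text \<open>An interior point of a set can thus be scaled by some \<open>t > 1\<close> without
  leaving the set; both strict inequalities describing interiors are extracted this way.\<close>

lemma mtuple_dilation_near:
  assumes X: "X \<in> mtuples n m" and "0 < \<epsilon>"
  obtains t :: real where "1 < t" "mtuple_dist n m X (map ((\<cdot>\<^sub>m) (complex_of_real t)) X) < \<epsilon>"
proof -
  let ?B = "{..<m} \<times> {..<n} \<times> {..<n}"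
  define K where "K = (\<Sum>(j, r, c)\<in>?B. cmod (X ! j $$ (r, c)))"
  have K: "0 \<le> K" unfolding K_def by (intro sum_nonneg) auto
  \<comment> \<open>The distance is at most \<open>(t - 1) * K\<close>, here
    \<open>\<epsilon> * K / (2 * (K + 1))\<close>, which is below \<epsilon> also when
    \<open>K = 0\<close>.\<close>
  define t where "t = 1 + \<epsilon> / (2 * (K + 1))"
  have t: "1 < t" using K assms by (simp add: t_def)
  have "mtuple_dist n m X (map ((\<cdot>\<^sub>m) (complex_of_real t)) X) \<le>
      (\<Sum>(j, r, c)\<in>?B. cmod (X ! j $$ (r, c) - map ((\<cdot>\<^sub>m) (complex_of_real t)) X ! j $$ (r, c)))"
    by (rule mtuple_dist_le_sum)
  also have "\<dots> = (\<Sum>(j, r, c)\<in>?B. (t - 1) * cmod (X ! j $$ (r, c)))"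
  proof (rule sum.cong[OF refl], clarify)
    fix j r c assume jrc: "j < m" "r < n" "c < n"
    have "X ! j $$ (r, c) - map ((\<cdot>\<^sub>m) (complex_of_real t)) X ! j $$ (r, c) =
        complex_of_real (1 - t) * X ! j $$ (r, c)"
      using jrc mtuplesD[OF X] by (simp add: algebra_simps)
    then show "cmod (X ! j $$ (r, c) - map ((\<cdot>\<^sub>m) (complex_of_real t)) X ! j $$ (r, c)) =
        (t - 1) * cmod (X ! j $$ (r, c))"
      using t by (simp add: norm_mult del: of_real_diff)
  qed
  also have "\<dots> = (t - 1) * K" unfolding K_def sum_distrib_left by (simp add: case_prod_unfold)
  also have "\<dots> = \<epsilon> * (K / (2 * (K + 1)))" by (simp add: t_def)
  also have "\<dots> < \<epsilon> * 1" using assms K by (intro mult_strict_left_mono) (auto simp: divide_simps)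
  finally show thesis using t that by simp
qed

subsection \<open>Interiors and boundaries\<close>

lemma Lam_append_zero:
  assumes A: "A \<in> mtuples d g" and C: "C \<in> mtuples d h" and X: "X \<in> mtuples n g"
  shows "Lam d n (A @ C) (X @ mtuple_zero n h) = Lam d n A X"
proof -
  note AC = mtuples_append[OF A C] and XZ = mtuples_append[OF X mtuple_zero_mtuples[of n h]]
  show ?thesis
  proof (rule block_mat_eqI[OF Lam_carrier[OF AC XZ] Lam_carrier[OF A X]])
    fix p q r c assume pqrc: "p < d" "q < d" "r < n" "c < n"
    have "(\<Sum>j<g. A ! j $$ (p, q) * X ! j $$ (r, c)) =
        (\<Sum>j<g + h. (A @ C) ! j $$ (p, q) * (X @ mtuple_zero n h) ! j $$ (r, c))"
      using mtuplesD(1)[OF A] mtuplesD(1)[OF X] pqrc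
      by (intro sum.mono_neutral_cong_left) (auto simp: nth_append)
    then show "Lam d n (A @ C) (X @ mtuple_zero n h) $$ (p * n + r, q * n + c) =
        Lam d n A X $$ (p * n + r, q * n + c)"
      using Lam_block_index[OF AC XZ pqrc] Lam_block_index[OF A X pqrc] by simp
  qed
qed

lemma vnorm_perturb:
  assumes T: "T \<in> carrier_mat N N" "T' \<in> carrier_mat N N" and v: "v \<in> carrier_vec N"
    and e: "op_norm (T - T') \<le> e"
  shows "vnorm (T *\<^sub>v v) \<le> vnorm (T' *\<^sub>v v) + e * vnorm v"
    "vnorm (T' *\<^sub>v v) \<le> vnorm (T *\<^sub>v v) + e * vnorm v"
    "vnorm (v + T *\<^sub>v v) \<le> vnorm (v + T' *\<^sub>v v) + e * vnorm v"
    "vnorm (v + T' *\<^sub>v v) \<le> vnorm (v + T *\<^sub>v v) + e * vnorm v"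
proof -
  let ?D = "(T - T') *\<^sub>v v"
  have D: "?D \<in> carrier_vec N" and Tv: "T *\<^sub>v v \<in> carrier_vec N" "T' *\<^sub>v v \<in> carrier_vec N"
    using T v by (auto intro!: carrier_vecI)
  have "vnorm ?D \<le> op_norm (T - T') * vnorm v" using T v by (intro vnorm_mult_le_op_norm) auto
  also have "\<dots> \<le> e * vnorm v" using e by (intro mult_right_mono) auto
  finally have le: "vnorm ?D \<le> e * vnorm v" .
  have "?D = T *\<^sub>v v - T' *\<^sub>v v" using T v by (simp add: minus_mult_distrib_mat_vec[of _ N N])
  then have eqs: "T *\<^sub>v v = T' *\<^sub>v v + ?D" "T' *\<^sub>v v = T *\<^sub>v v - ?D"
    "v + T *\<^sub>v v = (v + T' *\<^sub>v v) + ?D" "v + T' *\<^sub>v v = (v + T *\<^sub>v v) - ?D"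
    using T v Tv by (auto intro!: eq_vecI)
  have near: "vnorm (a + ?D) \<le> vnorm a + e * vnorm v" "vnorm (a - ?D) \<le> vnorm a + e * vnorm v"
    if "a \<in> carrier_vec N" for a
    using vnorm_triangle[OF that D] vnorm_minus[OF that D] le by linarith+
  show "vnorm (T *\<^sub>v v) \<le> vnorm (T' *\<^sub>v v) + e * vnorm v"
    by (subst eqs(1)) (rule near(1)[OF Tv(2)])
  show "vnorm (T' *\<^sub>v v) \<le> vnorm (T *\<^sub>v v) + e * vnorm v"
    by (subst eqs(2)) (rule near(2)[OF Tv(1)])
  show "vnorm (v + T *\<^sub>v v) \<le> vnorm (v + T' *\<^sub>v v) + e * vnorm v"
    by (subst eqs(3)) (rule near(1)[OF add_carrier_vec[OF v Tv(2)]])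
  show "vnorm (v + T' *\<^sub>v v) \<le> vnorm (v + T *\<^sub>v v) + e * vnorm v"
    by (subst eqs(4)) (rule near(2)[OF add_carrier_vec[OF v Tv(1)]])
qed

section \<open>Closedness and interior of the free spectrahedron, interior of the
  spectraball\<close>

lemma free_spectrahedron_iff:
  assumes T: "T \<in> mtuples d m"
  shows "X \<in> free_spectrahedron d T n \<longleftrightarrow> X \<in> mtuples n m \<and>
    (\<forall>v\<in>carrier_vec (d * n). vnorm (Lam d n T X *\<^sub>v v) \<le> vnorm (v + Lam d n T X *\<^sub>v v))"
  using pos_semidef_iff_vnorm[OF Lam_carrier[OF T]] mtuplesD(1)[OF T]
  by (auto simp: free_spectrahedron_def)

text \<open>A single vector violating the norm inequality still violates it after a small change of
  the pencil.\<close>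

lemma free_spectrahedron_complement_open:
  assumes T: "T \<in> mtuples d m" and X: "X \<in> mtuples n m" "X \<notin> free_spectrahedron d T n"
  shows "\<exists>\<epsilon>>0. \<forall>Y\<in>mtuples n m. mtuple_dist n m X Y < \<epsilon> \<longrightarrow> Y \<notin> free_spectrahedron d T n"
proof -
  let ?L = "Lam d n T"
  obtain K where K: "0 < K" "\<And>X Y. X \<in> mtuples n m \<Longrightarrow> Y \<in> mtuples n m \<Longrightarrow>
    op_norm (?L X - ?L Y) \<le> K * mtuple_dist n m X Y" by (rule Lam_lipschitz[OF T, of n]) blast
  obtain v where v: "v \<in> carrier_vec (d * n)" and gap: "vnorm (v + ?L X *\<^sub>v v) < vnorm (?L X *\<^sub>v v)"
    using X unfolding free_spectrahedron_iff[OF T] by force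
  define \<gamma> where "\<gamma> = vnorm (?L X *\<^sub>v v) - vnorm (v + ?L X *\<^sub>v v)"
  have \<gamma>: "0 < \<gamma>" using gap by (simp add: \<gamma>_def)
  \<comment> \<open>Each side of the inequality moves by at most
    \<open>K * \<epsilon> * vnorm v\<close>, both together by at most
    \<open>\<gamma> * vnorm v / (vnorm v + 1)\<close>, less than the gap \<gamma>.\<close>
  define \<epsilon> where "\<epsilon> = \<gamma> / (vnorm v + 1) / (2 * K)"
  have vp: "0 < vnorm v + 1" using vnorm_nonneg[of v] by linarith
  have \<epsilon>: "0 < \<epsilon>" using \<gamma> K vp by (simp add: \<epsilon>_def)
  have "Y \<notin> free_spectrahedron d T n" if Y: "Y \<in> mtuples n m" "mtuple_dist n m X Y < \<epsilon>" for Y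
  proof
    assume "Y \<in> free_spectrahedron d T n"
    then have le: "vnorm (?L Y *\<^sub>v v) \<le> vnorm (v + ?L Y *\<^sub>v v)"
      using v unfolding free_spectrahedron_iff[OF T] by blast
    have "op_norm (?L X - ?L Y) \<le> K * \<epsilon>"
      using K(2)[OF X(1) Y(1)] Y(2) K(1) by (meson less_imp_le mult_left_mono order_trans)
    note per = vnorm_perturb[OF Lam_carrier[OF T X(1)] Lam_carrier[OF T Y(1)] v this]
    have "\<gamma> \<le> 2 * (K * \<epsilon> * vnorm v)" using per(1,4) le by (simp add: \<gamma>_def)
    also have "\<dots> = \<gamma> * (vnorm v / (vnorm v + 1))"
    proof -
      have half: "K * \<epsilon> = \<gamma> / (vnorm v + 1) / 2" using K(1) by (simp add: \<epsilon>_def)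
      have two: "2 * (a / 2 * b) = a * b" for a b :: real by simp
      show ?thesis unfolding half two by simp
    qed
    also have "\<dots> < \<gamma> * 1" using \<gamma> vp by (intro mult_strict_left_mono) (auto simp: divide_simps)
    finally show False by simp
  qed
  with \<epsilon> show ?thesis by blast
qed

text \<open>With \<open>w = v + T v\<close> the bound gives
  \<open>|v| \<le> |w| + |T v| \<le> 2 |w|\<close>. An error proportional to \<open>|v|\<close> is
  therefore one proportional to \<open>|w|\<close>, and the slack \<open>(1 - \<rho>) |w|\<close>
  absorbs it.\<close>

lemma free_spectrahedron_interiorI:
  assumes T: "T \<in> mtuples d m" and X: "X \<in> mtuples n m" and \<rho>: "0 \<le> \<rho>" "\<rho> < 1"
    and le: "\<And>v. v \<in> carrier_vec (d * n) \<Longrightarrow>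
      vnorm (Lam d n T X *\<^sub>v v) \<le> \<rho> * vnorm (v + Lam d n T X *\<^sub>v v)"
  shows "X \<in> mtuple_topology n m interior_of free_spectrahedron d T n"
proof -
  let ?L = "Lam d n T"
  obtain K where K: "0 < K" "\<And>X Y. X \<in> mtuples n m \<Longrightarrow> Y \<in> mtuples n m \<Longrightarrow>
    op_norm (?L X - ?L Y) \<le> K * mtuple_dist n m X Y" by (rule Lam_lipschitz[OF T, of n]) blast
  \<comment> \<open>The pencil moves by at most \<open>(1 - \<rho>) / 4\<close>, hence each side by
    at most \<open>(1 - \<rho>) / 2\<close> times \<open>|w|\<close>; the two losses together use up
    exactly the slack.\<close>
  define \<epsilon> where "\<epsilon> = (1 - \<rho>) / (4 * K)"
  have \<epsilon>: "0 < \<epsilon>" "K * \<epsilon> = (1 - \<rho>) / 4" using K \<rho> by (auto simp: \<epsilon>_def)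
  have "Y \<in> free_spectrahedron d T n" if Y: "Y \<in> mtuples n m" "mtuple_dist n m X Y < \<epsilon>" for Y
    unfolding free_spectrahedron_iff[OF T]
  proof (intro conjI ballI Y)
    fix v :: "complex vec" assume v: "v \<in> carrier_vec (d * n)"
    let ?w = "v + ?L X *\<^sub>v v"
    have Lv: "?L X *\<^sub>v v \<in> carrier_vec (d * n)" using Lam_carrier[OF T X] v by simp
    have "op_norm (?L X - ?L Y) \<le> K * \<epsilon>"
      using K(2)[OF X Y(1)] Y(2) K(1) by (meson less_imp_le mult_left_mono order_trans)
    then have "op_norm (?L X - ?L Y) \<le> (1 - \<rho>) / 4" using \<epsilon>(2) by simp
    note per = vnorm_perturb[OF Lam_carrier[OF T X] Lam_carrier[OF T Y(1)] v this]
    have "v = ?w - ?L X *\<^sub>v v" using v Lv Lam_carrier[OF T X] by (intro eq_vecI) auto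
    then have "vnorm v \<le> vnorm ?w + vnorm (?L X *\<^sub>v v)"
      using vnorm_minus[of ?w "d * n" "?L X *\<^sub>v v"] v Lv by simp
    also have "\<dots> \<le> vnorm ?w + 1 * vnorm ?w"
      using le[OF v] \<rho> mult_right_mono[of \<rho> 1 "vnorm ?w"] by simp
    finally have "(1 - \<rho>) / 4 * vnorm v \<le> (1 - \<rho>) / 4 * (2 * vnorm ?w)"
      using \<rho> by (intro mult_left_mono) auto
    then have small: "(1 - \<rho>) / 4 * vnorm v \<le> (1 - \<rho>) / 2 * vnorm ?w" by simp
    have "vnorm (?L Y *\<^sub>v v) \<le> \<rho> * vnorm ?w + (1 - \<rho>) / 2 * vnorm ?w"
      using per(2) le[OF v] small by linarith
    also have "\<dots> = vnorm ?w - (1 - \<rho>) / 2 * vnorm ?w" by (simp add: field_simps)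
    also have "\<dots> \<le> vnorm (v + ?L Y *\<^sub>v v)" using per(3) small by linarith
    finally show "vnorm (?L Y *\<^sub>v v) \<le> vnorm (v + ?L Y *\<^sub>v v)" .
  qed
  with \<epsilon> X show ?thesis unfolding mtuple_interior by blast
qed

text \<open>A slightly dilated tuple still lies in the spectrahedron, which gives
  \<open>I + \<Lambda> + \<Lambda>^* \<ge> (1 - 1/t) I\<close>.\<close>

lemma free_spectrahedron_interiorD:
  assumes T: "T \<in> mtuples d m" and X: "X \<in> mtuple_topology n m interior_of free_spectrahedron d T n"
  obtains \<rho> where "0 \<le> \<rho>" "\<rho> < 1" "\<And>v. v \<in> carrier_vec (d * n) \<Longrightarrow>
      vnorm (Lam d n T X *\<^sub>v v) \<le> \<rho> * vnorm (v + Lam d n T X *\<^sub>v v)"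
proof -
  let ?T = "Lam d n T X"
  have Xm: "X \<in> mtuples n m" using X by (simp add: mtuple_interior)
  have car: "?T \<in> carrier_mat (d * n) (d * n)" by (rule Lam_carrier[OF T Xm])
  obtain \<epsilon> where "0 < \<epsilon>" and ball: "\<And>Y. Y \<in> mtuples n m \<Longrightarrow> mtuple_dist n m X Y < \<epsilon> \<Longrightarrow>
      Y \<in> free_spectrahedron d T n"
    using X unfolding mtuple_interior by blast
  obtain t :: real where t: "1 < t" and "mtuple_dist n m X (map ((\<cdot>\<^sub>m) (complex_of_real t)) X) < \<epsilon>"
    using mtuple_dilation_near[OF Xm \<open>0 < \<epsilon>\<close>] .
  then have "map ((\<cdot>\<^sub>m) (complex_of_real t)) X \<in> free_spectrahedron d T n"
    using ball mtuple_smult_mtuples[OF Xm] by blast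
  then have tX: "vnorm ((complex_of_real t \<cdot>\<^sub>m ?T) *\<^sub>v v) \<le> vnorm (v + (complex_of_real t \<cdot>\<^sub>m ?T) *\<^sub>v v)"
    if "v \<in> carrier_vec (d * n)" for v
    using that unfolding free_spectrahedron_iff[OF T] Lam_smult[OF T Xm] by blast
  define \<tau> where "\<tau> = op_norm ?T"
  have \<tau>: "0 \<le> \<tau>" by (simp add: \<tau>_def op_norm_nonneg)
  \<comment> \<open>Since \<open>|v + T v| \<le> (1 + \<tau>) |v|\<close>, this converts a lower
    bound by \<open>(1 - 1 / t)\<close> times \<open>|v|\<close> squared into one by \<delta> times
    \<open>|v + T v|\<close> squared; the factor is then \<open>sqrt (1 - \<delta>)\<close>.\<close>
  define \<delta> where "\<delta> = (1 - 1 / t) / (1 + \<tau>)\<^sup>2"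
  have \<tau>2: "1 \<le> (1 + \<tau>)\<^sup>2" using \<tau> by (simp add: one_le_power)
  have \<delta>: "0 < \<delta>" "\<delta> \<le> 1"
  proof -
    show "0 < \<delta>" using t \<tau>2 by (auto simp: \<delta>_def intro!: divide_pos_pos)
    have "1 - 1 / t \<le> (1 + \<tau>)\<^sup>2" using t \<tau>2 by (smt (verit) divide_nonneg_nonneg)
    then show "\<delta> \<le> 1" using \<tau>2 by (simp add: \<delta>_def divide_simps)
  qed
  show thesis
  proof (rule that[of "sqrt (1 - \<delta>)"])
    show "0 \<le> sqrt (1 - \<delta>)" "sqrt (1 - \<delta>) < 1" using \<delta> by auto
    fix v :: "complex vec" assume v: "v \<in> carrier_vec (d * n)"
    let ?u = "?T *\<^sub>v v"
    have u: "?u \<in> carrier_vec (d * n)" using car v by simp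
    let ?\<sigma> = "Re (?u \<bullet>c v)"
    have tu: "(complex_of_real t \<cdot>\<^sub>m ?T) *\<^sub>v v = complex_of_real t \<cdot>\<^sub>v ?u"
      using car v by (intro eq_vecI) (auto simp: scalar_prod_def sum_distrib_left mult.assoc)
    have "(complex_of_real t \<cdot>\<^sub>v ?u) \<bullet>c v = complex_of_real t * (?u \<bullet>c v)" using u v by simp
    then have "Re ((complex_of_real t \<cdot>\<^sub>v ?u) \<bullet>c v) = t * ?\<sigma>" by simp
    moreover have "(vnorm (complex_of_real t \<cdot>\<^sub>v ?u))\<^sup>2 \<le> (vnorm (v + complex_of_real t \<cdot>\<^sub>v ?u))\<^sup>2"
      using tX[OF v] unfolding tu by (intro power_mono) auto
    ultimately have "0 \<le> (vnorm v)\<^sup>2 + 2 * (t * ?\<sigma>)"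
      using vnorm_square_add[of "complex_of_real t \<cdot>\<^sub>v ?u" "d * n" v] u v by simp
    \<comment> \<open>Positivity of the form at \<open>t X\<close> controls
      \<open>2 * t * ?\<sigma>\<close>. Dividing by \<open>t\<close> leaves only the part
      \<open>1 / t\<close> of \<open>|v|\<close> squared to compensate \<open>2 * ?\<sigma>\<close>,
      and the remaining part \<open>1 - 1 / t\<close> is the gain.\<close>
    then have "0 \<le> ((vnorm v)\<^sup>2 + 2 * (t * ?\<sigma>)) / t" using t by simp
    also have "\<dots> = (vnorm v)\<^sup>2 / t + 2 * ?\<sigma>" using t by (simp add: field_simps)
    finally have "(1 - 1 / t) * (vnorm v)\<^sup>2 \<le> (vnorm v)\<^sup>2 + 2 * ?\<sigma>" by (simp add: algebra_simps)
    also have "\<dots> = (vnorm (v + ?u))\<^sup>2 - (vnorm ?u)\<^sup>2" using vnorm_square_add[OF u v] by simp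
    finally have gap: "(1 - 1 / t) * (vnorm v)\<^sup>2 \<le> (vnorm (v + ?u))\<^sup>2 - (vnorm ?u)\<^sup>2" .
    have "vnorm (v + ?u) \<le> vnorm v + vnorm ?u" by (rule vnorm_triangle[OF v u])
    also have "\<dots> \<le> vnorm v + \<tau> * vnorm v"
      using vnorm_mult_le_op_norm[of v ?T] car v by (simp add: \<tau>_def)
    finally have "vnorm (v + ?u) \<le> (1 + \<tau>) * vnorm v" by (simp add: algebra_simps)
    then have "(vnorm (v + ?u))\<^sup>2 \<le> (1 + \<tau>)\<^sup>2 * (vnorm v)\<^sup>2"
      using power_mono[of "vnorm (v + ?u)" "(1 + \<tau>) * vnorm v" 2] by (simp add: power_mult_distrib)
    then have "\<delta> * (vnorm (v + ?u))\<^sup>2 \<le> \<delta> * ((1 + \<tau>)\<^sup>2 * (vnorm v)\<^sup>2)"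
      using \<delta> by (intro mult_left_mono) auto
    also have "\<dots> = (1 - 1 / t) * (vnorm v)\<^sup>2" using \<tau>2 by (auto simp: \<delta>_def)
    finally have "(vnorm ?u)\<^sup>2 \<le> (1 - \<delta>) * (vnorm (v + ?u))\<^sup>2" using gap by (simp add: algebra_simps)
    then have "sqrt ((vnorm ?u)\<^sup>2) \<le> sqrt ((1 - \<delta>) * (vnorm (v + ?u))\<^sup>2)" by (rule real_sqrt_le_mono)
    then show "vnorm ?u \<le> sqrt (1 - \<delta>) * vnorm (v + ?u)" by (simp add: real_sqrt_mult)
  qed
qed

text \<open>If \<open>t Y\<close> is still in the ball for some \<open>t > 1\<close>, the norm of
  the pencil at \<open>Y\<close> is at most \<open>1 / t\<close>; the converse is the triangle
  inequality with the Lipschitz bound.\<close>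

lemma spectraball_interior_iff:
  assumes T: "T \<in> mtuples d m"
  shows "Y \<in> mtuple_topology n m interior_of spectraball d T n \<longleftrightarrow>
    Y \<in> mtuples n m \<and> op_norm (Lam d n T Y) < 1"
proof (intro iffI conjI)
  let ?L = "Lam d n T"
  assume Y: "Y \<in> mtuple_topology n m interior_of spectraball d T n"
  then show Ym: "Y \<in> mtuples n m" by (simp add: mtuple_interior)
  obtain \<epsilon> where "0 < \<epsilon>" and ball: "\<And>Z. Z \<in> mtuples n m \<Longrightarrow> mtuple_dist n m Y Z < \<epsilon> \<Longrightarrow>
      Z \<in> spectraball d T n"
    using Y unfolding mtuple_interior by blast
  obtain t :: real where t: "1 < t" and "mtuple_dist n m Y (map ((\<cdot>\<^sub>m) (complex_of_real t)) Y) < \<epsilon>"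
    using mtuple_dilation_near[OF Ym \<open>0 < \<epsilon>\<close>] .
  then have "map ((\<cdot>\<^sub>m) (complex_of_real t)) Y \<in> spectraball d T n"
    using ball mtuple_smult_mtuples[OF Ym] by blast
  then have le: "op_norm (complex_of_real t \<cdot>\<^sub>m ?L Y) \<le> 1"
    by (simp add: spectraball_def Lam_smult[OF T Ym])
  have "?L Y = complex_of_real (1 / t) \<cdot>\<^sub>m (complex_of_real t \<cdot>\<^sub>m ?L Y)"
    using t by (intro eq_matI) auto
  then have "op_norm (?L Y) \<le> cmod (complex_of_real (1 / t)) * op_norm (complex_of_real t \<cdot>\<^sub>m ?L Y)"
    using op_norm_smult_le by metis
  also have "cmod (complex_of_real (1 / t)) = 1 / t" using t by (simp add: norm_divide)
  also have "1 / t * op_norm (complex_of_real t \<cdot>\<^sub>m ?L Y) \<le> 1 / t * 1"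
    using le t by (intro mult_left_mono) auto
  also have "\<dots> < 1" using t by simp
  finally show "op_norm (?L Y) < 1" .
next
  let ?L = "Lam d n T"
  assume "Y \<in> mtuples n m \<and> op_norm (?L Y) < 1"
  then have Y: "Y \<in> mtuples n m" and lt: "op_norm (?L Y) < 1" by auto
  obtain K where K: "0 < K" "\<And>X Y. X \<in> mtuples n m \<Longrightarrow> Y \<in> mtuples n m \<Longrightarrow>
    op_norm (?L X - ?L Y) \<le> K * mtuple_dist n m X Y" by (rule Lam_lipschitz[OF T, of n]) blast
  define \<epsilon> where "\<epsilon> = (1 - op_norm (?L Y)) / K"
  have \<epsilon>: "0 < \<epsilon>" "K * \<epsilon> = 1 - op_norm (?L Y)" using K lt by (auto simp: \<epsilon>_def)
  have "Z \<in> spectraball d T n" if Z: "Z \<in> mtuples n m" "mtuple_dist n m Y Z < \<epsilon>" for Z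
  proof -
    note car = Lam_carrier[OF T Y] Lam_carrier[OF T Z(1)]
    have sym: "mtuple_dist n m Z Y = mtuple_dist n m Y Z"
      by (simp add: Metric_space.commute[OF Metric_space_mtuples])
    have "?L Z = ?L Y + (?L Z - ?L Y)" using car by (intro eq_matI) auto
    then have "op_norm (?L Z) \<le> op_norm (?L Y) + op_norm (?L Z - ?L Y)"
      using op_norm_add[OF car(1) minus_carrier_mat[OF car(1)], of "?L Z"] by simp
    also have "\<dots> \<le> op_norm (?L Y) + K * \<epsilon>"
      using K(2)[OF Z(1) Y] sym mult_left_mono[OF less_imp_le[OF Z(2)] less_imp_le[OF K(1)]] by simp
    finally show ?thesis using \<epsilon>(2) Z(1) mtuplesD(1)[OF T] by (simp add: spectraball_def)
  qed
  with \<epsilon> Y show "Y \<in> mtuple_topology n m interior_of spectraball d T n" unfolding mtuple_interior by blast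
qed

subsection \<open>Properness\<close>

text \<open>The arguments on injectivity, properness, boundary, value and derivative at 0 use the
  map only through this equation.\<close>

lemma convexotonic_map_Cayley:
  assumes A: "A \<in> mtuples d g" and C: "C \<in> mtuples d h" and indep: "lin_indep_tuple d (A @ C)"
    and st: "structure_tuple d (A @ C) \<Xi>" and n: "1 \<le> n" and X: "X \<in> mtuples n g"
    and det: "det (1\<^sub>m (d * n) + Lam d n A X) \<noteq> 0"
  obtains Y where "convexotonic_map g \<Xi> n X = Some Y" "Y \<in> mtuples n (g + h)"
    "Lam d n (A @ C) Y * (1\<^sub>m (d * n) + Lam d n A X) = Lam d n A X"
proof -
  note J = mtuples_append[OF A C]
  have \<Xi>: "\<Xi> \<in> mtuples (g + h) (g + h)" using st mtuplesD(1)[OF J] by (simp add: structure_tuple_def)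
  have take: "take g (A @ C) = A" using mtuplesD(1)[OF A] by simp
  have "det (1\<^sub>m ((g + h) * n) + Lam (g + h) n (take g \<Xi>) X) \<noteq> 0"
    using det_structure_pencil_nonzero[OF J indep st le_add1 X n] det unfolding take by blast
  then obtain Y where Y: "convexotonic_map g \<Xi> n X = Some Y" "Y \<in> mtuples n (g + h)"
    and row: "block_row n Y * (1\<^sub>m ((g + h) * n) + Lam (g + h) n (take g \<Xi>) X) =
      block_row n (X @ mtuple_zero n h)"
    using convexotonic_map_block_row[OF \<Xi> X] by metis
  have "Lam d n (A @ C) Y * (1\<^sub>m (d * n) + Lam d n A X) = Lam d n (A @ C) (X @ mtuple_zero n h)"
    using Lam_structure_mult[OF J st le_add1 X Y(2) mtuples_append[OF X mtuple_zero_mtuples] row]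
    unfolding take .
  with Y show thesis using that Lam_append_zero[OF A C X] by simp
qed

lemma Cayley_unique:
  fixes M M' T :: "complex mat"
  assumes T: "T \<in> carrier_mat N N" and M: "M \<in> carrier_mat N N" "M' \<in> carrier_mat N N"
    and det: "det (1\<^sub>m N + T) \<noteq> 0" and eq: "M * (1\<^sub>m N + T) = M' * (1\<^sub>m N + T)"
  shows "M = M'"
proof -
  have IT: "1\<^sub>m N + T \<in> carrier_mat N N" using T by simp
  obtain B where B: "B \<in> carrier_mat N N" "(1\<^sub>m N + T) * B = 1\<^sub>m N"
    using det_nonzero_inverse[OF IT det] by blast
  have "M = M * (1\<^sub>m N + T) * B" using assoc_mult_mat[OF M(1) IT B(1)] B(2) M by simp
  also have "\<dots> = M'" unfolding eq using assoc_mult_mat[OF M(2) IT B(1)] B(2) M by simp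
  finally show ?thesis .
qed

text \<open>\<open>I - M\<close> is the inverse of \<open>I + T\<close>, so that \<open>T\<close> can be recovered from \<open>M\<close>.\<close>

lemma Cayley_inject:
  fixes M T T' :: "complex mat"
  assumes T: "T \<in> carrier_mat N N" "T' \<in> carrier_mat N N" and M: "M \<in> carrier_mat N N"
    and eq: "M * (1\<^sub>m N + T) = T" "M * (1\<^sub>m N + T') = T'"
  shows "T = T'"
proof -
  let ?I = "1\<^sub>m N :: complex mat"
  have IM: "?I - M \<in> carrier_mat N N" by (rule minus_carrier_mat[OF M])
  have left: "(?I - M) * (?I + S) = ?I" if S: "S \<in> carrier_mat N N" "M * (?I + S) = S" for S
  proof -
    have "(?I - M) * (?I + S) = ?I * (?I + S) - M * (?I + S)"
      using S M by (intro minus_mult_distrib_mat) auto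
    also have "\<dots> = ?I" using S by (intro eq_matI) auto
    finally show ?thesis .
  qed
  have "(?I + T) * (?I - M) = ?I"
    using mat_mult_left_right_inverse[OF IM _ left[OF T(1) eq(1)]] T by simp
  then have "?I + T = (?I + T) * ((?I - M) * (?I + T'))" using left[OF T(2) eq(2)] T by simp
  also have "\<dots> = ?I + T'"
    using assoc_mult_mat[of "?I + T" N N "?I - M" N "?I + T'" N] \<open>(?I + T) * (?I - M) = ?I\<close> T IM by simp
  finally have IT: "?I + T = ?I + T'" .
  have "T = (?I + T) - ?I" using T by (intro eq_matI) auto
  also have "\<dots> = T'" unfolding IT using T by (intro eq_matI) auto
  finally show ?thesis .
qed

lemma Lam_entry_tendsto:
  assumes T: "T \<in> mtuples d m" and X: "\<And>k. X k \<in> mtuples n m" and l: "l \<in> mtuples n m"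
    and lim: "(\<lambda>k. mtuple_dist n m (X k) l) \<longlonglongrightarrow> 0" and ij: "i < d * n" "j < d * n"
  shows "(\<lambda>k. Lam d n T (X k) $$ (i, j)) \<longlonglongrightarrow> Lam d n T l $$ (i, j)"
proof -
  have n: "0 < n" using ij by (cases n) auto
  have "(\<lambda>k. X k ! s $$ (r, c)) \<longlonglongrightarrow> l ! s $$ (r, c)" if "s < m" "r < n" "c < n" for s r c
  proof (rule Lim_transform_bound[of "\<lambda>k. X k ! s $$ (r, c) - l ! s $$ (r, c)", THEN LIM_zero_cancel, OF _ lim])
    show "\<forall>\<^sub>F k in sequentially. norm (X k ! s $$ (r, c) - l ! s $$ (r, c)) \<le> norm (mtuple_dist n m (X k) l)"
      using mtuple_entry_le_dist[OF that] by simp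
  qed
  then show ?thesis
    unfolding Lam_index[OF T X ij] Lam_index[OF T l ij]
    using n by (intro tendsto_sum tendsto_mult tendsto_const) auto
qed

lemma convexotonic_map_proper:
  assumes A: "A \<in> mtuples d g" and C: "C \<in> mtuples d h" and indep_A: "lin_indep_tuple d A"
    and indep: "lin_indep_tuple d (A @ C)" and st: "structure_tuple d (A @ C) \<Xi>" and n: "1 \<le> n"
  shows "injective_proper_map_into n g (g + h) (convexotonic_map g \<Xi> n)
        (mtuple_topology n g interior_of free_spectrahedron d A n)
        (mtuple_topology n (g + h) interior_of spectraball d (A @ C) n)"
proof -
  let ?J = "A @ C" and ?N = "d * n"
  let ?f = "\<lambda>X. the (convexotonic_map g \<Xi> n X)"
  let ?U = "mtuple_topology n g interior_of free_spectrahedron d A n"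
  let ?V = "mtuple_topology n (g + h) interior_of spectraball d ?J n"
  note J = mtuples_append[OF A C]
  have map: "X \<in> dom (convexotonic_map g \<Xi> n) \<and> ?f X \<in> mtuples n (g + h) \<and>
      Lam d n ?J (?f X) * (1\<^sub>m ?N + Lam d n A X) = Lam d n A X \<and>
      det (1\<^sub>m ?N + Lam d n A X) \<noteq> 0 \<and> op_norm (Lam d n ?J (?f X)) < 1 \<and> X \<in> mtuples n g"
    if XU: "X \<in> ?U" for X
  proof -
    have X: "X \<in> mtuples n g" using XU by (simp add: mtuple_interior)
    obtain \<rho> where \<rho>: "0 \<le> \<rho>" "\<rho> < 1" and le: "\<And>v. v \<in> carrier_vec ?N \<Longrightarrow>
      vnorm (Lam d n A X *\<^sub>v v) \<le> \<rho> * vnorm (v + Lam d n A X *\<^sub>v v)"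
      using free_spectrahedron_interiorD[OF A XU] by blast
    have det: "det (1\<^sub>m ?N + Lam d n A X) \<noteq> 0"
      by (rule det_one_plus_nonzero[OF Lam_carrier[OF A X] le])
    obtain Y where Y: "convexotonic_map g \<Xi> n X = Some Y" "Y \<in> mtuples n (g + h)"
      "Lam d n ?J Y * (1\<^sub>m ?N + Lam d n A X) = Lam d n A X"
      using convexotonic_map_Cayley[OF A C indep st n X det] .
    have "op_norm (Lam d n ?J Y) \<le> \<rho>"
      using op_norm_Cayley_le_iff[OF Lam_carrier[OF A X] Lam_carrier[OF J Y(2)] Y(3) det \<rho>(1)] le by blast
    then show ?thesis using X Y det \<rho> by auto
  qed
  show ?thesis
    unfolding injective_proper_map_into_def
  proof (intro conjI allI impI)
    show "?U \<subseteq> dom (convexotonic_map g \<Xi> n)" using map by blast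
    show "?f \<in> ?U \<rightarrow> ?V" using map by (auto simp: spectraball_interior_iff[OF J])
    show "inj_on ?f ?U"
    proof (rule inj_onI)
      fix X X' assume XX: "X \<in> ?U" "X' \<in> ?U" and eq: "?f X = ?f X'"
      note m = map[OF XX(1)] map[OF XX(2)]
      have "Lam d n A X = Lam d n A X'"
      proof (rule Cayley_inject)
        show "Lam d n ?J (?f X) \<in> carrier_mat ?N ?N" using m(1) Lam_carrier[OF J] by blast
        show "Lam d n ?J (?f X) * (1\<^sub>m ?N + Lam d n A X') = Lam d n A X'" unfolding eq using m(2) by blast
      qed (use m Lam_carrier[OF A] in blast)+
      then show "X = X'" using Lam_inject[OF A indep_A] m by blast
    qed
  next
    fix K assume "compactin (mtuple_topology n (g + h)) K \<and> K \<subseteq> ?V"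
    then have K: "compactin (mtuple_topology n (g + h)) K" and KV: "K \<subseteq> ?V" by auto
    have seqK: "\<exists>l r. l \<in> K \<and> strict_mono r \<and>
        limitin (mtuple_topology n (g + h)) (\<sigma> \<circ> r) l sequentially"
      if "range \<sigma> \<subseteq> K" for \<sigma> :: "nat \<Rightarrow> complex mat list"
      using K that unfolding mtuple_topology_def
        Metric_space.compactin_sequentially[OF Metric_space_mtuples] by blast
    show "compactin (mtuple_topology n g) {X \<in> ?U. ?f X \<in> K}"
      unfolding mtuple_topology_def Metric_space.compactin_sequentially[OF Metric_space_mtuples]
      unfolding mtuple_topology_def[symmetric]
    proof (intro conjI allI impI)
      show "{X \<in> ?U. ?f X \<in> K} \<subseteq> mtuples n g" using map by blast
      fix \<sigma> :: "nat \<Rightarrow> complex mat list" assume \<sigma>: "range \<sigma> \<subseteq> {X \<in> ?U. ?f X \<in> K}"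
      then have "range (\<lambda>k. ?f (\<sigma> k)) \<subseteq> K" by blast
      from seqK[OF this] obtain Y r where YK: "Y \<in> K" and r: "strict_mono r"
        and "limitin (mtuple_topology n (g + h)) ((\<lambda>k. ?f (\<sigma> k)) \<circ> r) Y sequentially" by blast
      then have Ylim: "\<And>\<epsilon>. 0 < \<epsilon> \<Longrightarrow> \<forall>\<^sub>F k in sequentially. mtuple_dist n (g + h) (?f (\<sigma> (r k))) Y < \<epsilon>"
        unfolding mtuple_topology_def Metric_space.limitin_metric[OF Metric_space_mtuples]
        by (auto elim: eventually_mono)
      have Y: "Y \<in> mtuples n (g + h)" and Y1: "op_norm (Lam d n ?J Y) < 1"
        using YK KV spectraball_interior_iff[OF J] by auto
      \<comment> \<open>Halfway between the norm of the limit pencil and 1, so that almost all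
        pencils of the sequence have norm at most \<beta>.\<close>
      define \<beta> where "\<beta> = (1 + op_norm (Lam d n ?J Y)) / 2"
      have \<beta>: "0 < \<beta>" "\<beta> < 1" using Y1 op_norm_nonneg[of "Lam d n ?J Y"] by (auto simp: \<beta>_def)
      obtain K1 where K1: "0 < K1" "\<And>X Y. X \<in> mtuples n (g + h) \<Longrightarrow> Y \<in> mtuples n (g + h) \<Longrightarrow>
        op_norm (Lam d n ?J X - Lam d n ?J Y) \<le> K1 * mtuple_dist n (g + h) X Y"
        by (rule Lam_lipschitz[OF J, of n]) blast
      obtain K2 where K2: "0 < K2" "\<And>X Y. X \<in> mtuples n g \<Longrightarrow> Y \<in> mtuples n g \<Longrightarrow>
        mtuple_dist n g X Y \<le> K2 * op_norm (Lam d n A X - Lam d n A Y)"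
        by (rule Lam_bounded_below[OF A indep_A, of n]) blast
      \<comment> \<open>Within this distance of \<open>Y\<close> the pencil moves by at most
        \<open>1 - \<beta>\<close>, and
        \<open>op_norm (Lam d n ?J Y) + (1 - \<beta>) = \<beta>\<close>.\<close>
      have "0 < (1 - \<beta>) / K1" using \<beta> K1 by simp
      from Ylim[OF this] obtain k0
        where k0: "\<And>k. k \<ge> k0 \<Longrightarrow> mtuple_dist n (g + h) (?f (\<sigma> (r k))) Y < (1 - \<beta>) / K1"
        unfolding eventually_sequentially by blast
      \<comment> \<open>The first \<open>k0\<close> terms are dropped so that the bound holds for
        every index.\<close>
      define X where "X k = \<sigma> (r (k + k0))" for k
      have XU: "X k \<in> ?U" and fX: "?f (X k) \<in> K" for k using \<sigma> by (auto simp: X_def)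
      note mX = map[OF XU]
      have Xm: "X k \<in> mtuples n g" for k using mX by blast
      have X_bound: "cmod (X k ! j $$ (p, q)) \<le> K2 * (\<beta> / (1 - \<beta>))" if jpq: "j < g" "p < n" "q < n" for k j p q
      proof -
        let ?M = "Lam d n ?J (?f (X k))" and ?T = "Lam d n A (X k)"
        have M: "?M \<in> carrier_mat ?N ?N" and T: "?T \<in> carrier_mat ?N ?N"
          using mX Lam_carrier[OF J] Lam_carrier[OF A] by blast+
        have LY: "Lam d n ?J Y \<in> carrier_mat ?N ?N" by (rule Lam_carrier[OF J Y])
        have "?M = (?M - Lam d n ?J Y) + Lam d n ?J Y" using M LY by (intro eq_matI) auto
        then have "op_norm ?M \<le> op_norm (?M - Lam d n ?J Y) + op_norm (Lam d n ?J Y)"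
          using op_norm_add[OF minus_carrier_mat[OF LY] LY, of ?M] by simp
        also have "op_norm (?M - Lam d n ?J Y) \<le> K1 * mtuple_dist n (g + h) (?f (X k)) Y"
          using K1(2) mX Y by blast
        also have "\<dots> \<le> K1 * ((1 - \<beta>) / K1)"
          using k0[of "k + k0"] K1(1) by (intro mult_left_mono) (auto simp: X_def)
        also have "K1 * ((1 - \<beta>) / K1) = 1 - \<beta>" using K1(1) by simp
        also have "1 - \<beta> + op_norm (Lam d n ?J Y) = \<beta>" by (simp add: \<beta>_def field_simps)
        finally have M\<beta>: "op_norm ?M \<le> \<beta>" by simp
        have "?T = ?M * (1\<^sub>m ?N + ?T)" using mX by simp
        also have "\<dots> = ?M + ?M * ?T" using mult_add_distrib_mat[OF M one_carrier_mat T] M by simp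
        finally have "op_norm ?T \<le> op_norm ?M + op_norm (?M * ?T)"
          using op_norm_add[OF M mult_carrier_mat[OF M T]] by simp
        also have "\<dots> \<le> \<beta> + \<beta> * op_norm ?T"
          using M\<beta> order_trans[OF op_norm_mult[OF M T] mult_right_mono[OF M\<beta> op_norm_nonneg]]
          by (intro add_mono)
        finally have T\<beta>: "op_norm ?T \<le> \<beta> / (1 - \<beta>)" using \<beta> by (simp add: field_simps)
        have zero: "mtuple_zero n g \<in> mtuples n g" by (rule mtuple_zero_mtuples)
        have "?T - Lam d n A (mtuple_zero n g) = ?T" unfolding Lam_zero[OF A] using T by (intro eq_matI) auto
        then have "mtuple_dist n g (X k) (mtuple_zero n g) \<le> K2 * op_norm ?T"
          using K2(2)[OF Xm zero, of k] by simp
        also have "\<dots> \<le> K2 * (\<beta> / (1 - \<beta>))" using T\<beta> K2(1) by (intro mult_left_mono) auto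
        finally show ?thesis
          using mtuple_entry_le_dist[OF jpq, of "X k" "mtuple_zero n g"] jpq by simp
      qed
      obtain l \<rho> where l: "l \<in> mtuples n g" and \<rho>: "strict_mono \<rho>"
        and lim: "(\<lambda>k. mtuple_dist n g (X (\<rho> k)) l) \<longlonglongrightarrow> 0"
        using mtuple_bounded_subsequence[of g n X, OF X_bound] by blast
      have shift: "strict_mono (\<lambda>k. \<rho> k + k0)" using \<rho> by (simp add: strict_mono_def)
      have "(\<lambda>k. mtuple_dist n (g + h) (?f (\<sigma> (r k))) Y) \<longlonglongrightarrow> 0"
        unfolding tendsto_iff using Ylim by simp
      from LIMSEQ_subseq_LIMSEQ[OF this shift]
      have Ylim': "(\<lambda>k. mtuple_dist n (g + h) (?f (X (\<rho> k))) Y) \<longlonglongrightarrow> 0" by (simp add: X_def o_def)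
      let ?M = "Lam d n ?J Y" and ?T = "Lam d n A l"
      note T = Lam_carrier[OF A l] and M = Lam_carrier[OF J Y]
      have MT: "?M * (1\<^sub>m ?N + ?T) = ?T"
      proof (rule eq_matI)
        fix i j assume "i < dim_row ?T" "j < dim_col ?T"
        then have ij: "i < ?N" "j < ?N" using T by auto
        have ix: "(P * (1\<^sub>m ?N + Q)) $$ (i, j) = (\<Sum>z<?N. P $$ (i, z) * ((1\<^sub>m ?N) $$ (z, j) + Q $$ (z, j)))"
          if "P \<in> carrier_mat ?N ?N" "Q \<in> carrier_mat ?N ?N" for P Q :: "complex mat"
          using that ij by (auto simp: scalar_prod_def atLeast0LessThan intro!: sum.cong)
        have fXm: "?f (X (\<rho> k)) \<in> mtuples n (g + h)" for k using mX by blast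
        have "(\<lambda>k. Lam d n A (X (\<rho> k)) $$ (i, j)) \<longlonglongrightarrow>
            (\<Sum>z<?N. ?M $$ (i, z) * ((1\<^sub>m ?N) $$ (z, j) + ?T $$ (z, j)))"
        proof -
          have eq: "Lam d n A (X (\<rho> k)) $$ (i, j) = (\<Sum>z<?N. Lam d n ?J (?f (X (\<rho> k))) $$ (i, z) *
              ((1\<^sub>m ?N) $$ (z, j) + Lam d n A (X (\<rho> k)) $$ (z, j)))" for k
            using ix[OF Lam_carrier[OF J fXm] Lam_carrier[OF A Xm]] mX by metis
          show ?thesis
            by (subst eq, intro tendsto_sum tendsto_mult tendsto_add tendsto_const
                Lam_entry_tendsto[OF A Xm l lim] Lam_entry_tendsto[OF J fXm Y Ylim'])
              (use ij in auto)
        qed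
        moreover have "(\<lambda>k. Lam d n A (X (\<rho> k)) $$ (i, j)) \<longlonglongrightarrow> ?T $$ (i, j)"
          by (rule Lam_entry_tendsto[OF A Xm l lim ij])
        ultimately show "(?M * (1\<^sub>m ?N + ?T)) $$ (i, j) = ?T $$ (i, j)"
          unfolding ix[OF M T] by (rule LIMSEQ_unique)
      qed (use M T in auto)
      have le: "vnorm (?T *\<^sub>v v) \<le> op_norm ?M * vnorm (v + ?T *\<^sub>v v)" if v: "v \<in> carrier_vec ?N" for v
      proof -
        have IT: "1\<^sub>m ?N + ?T \<in> carrier_mat ?N ?N" using T by simp
        have "?T *\<^sub>v v = ?M *\<^sub>v ((1\<^sub>m ?N + ?T) *\<^sub>v v)" using assoc_mult_mat_vec[OF M IT v] MT by simp
        also have "(1\<^sub>m ?N + ?T) *\<^sub>v v = v + ?T *\<^sub>v v" using v T by (simp add: add_mult_distrib_mat_vec[of _ ?N ?N])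
        finally have "?T *\<^sub>v v = ?M *\<^sub>v (v + ?T *\<^sub>v v)" .
        moreover have "v + ?T *\<^sub>v v \<in> carrier_vec (dim_col ?M)" using v T M by simp
        ultimately show ?thesis using vnorm_mult_le_op_norm by metis
      qed
      \<comment> \<open>Only here does \<open>l\<close> become an interior point, with the norm of
        \<open>?M\<close> as the uniform factor. Hence \<open>I + ?T\<close> is invertible, the map
        is defined at \<open>l\<close>, and its pencil there must be \<open>?M\<close>.\<close>
      have lU: "l \<in> ?U" by (rule free_spectrahedron_interiorI[OF A l op_norm_nonneg Y1 le])
      note ml = map[OF lU]
      have "Lam d n ?J (?f l) = ?M"
        by (rule Cayley_unique[OF T _ M]) (use ml MT Lam_carrier[OF J] in auto)
      then have "?f l = Y" using Lam_inject[OF J indep _ Y] ml by blast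
      then have lS: "l \<in> {X \<in> ?U. ?f X \<in> K}" using lU YK by simp
      have "limitin (mtuple_topology n g) (\<sigma> \<circ> (\<lambda>k. r (\<rho> k + k0))) l sequentially"
        unfolding mtuple_topology_def Metric_space.limitin_metric[OF Metric_space_mtuples]
      proof (intro conjI l allI impI)
        fix \<epsilon> :: real assume "0 < \<epsilon>"
        then have "\<forall>\<^sub>F k in sequentially. mtuple_dist n g (X (\<rho> k)) l < \<epsilon>"
          using order_tendstoD(2)[OF lim] by blast
        then show "\<forall>\<^sub>F k in sequentially. (\<sigma> \<circ> (\<lambda>k. r (\<rho> k + k0))) k \<in> mtuples n g \<and>
            mtuple_dist n g ((\<sigma> \<circ> (\<lambda>k. r (\<rho> k + k0))) k) l < \<epsilon>"
          by eventually_elim (use Xm in \<open>auto simp: X_def\<close>)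
      qed
      moreover have "strict_mono (\<lambda>k. r (\<rho> k + k0))"
        using r shift by (simp add: strict_mono_def)
      ultimately show "\<exists>l r. l \<in> {X \<in> ?U. ?f X \<in> K} \<and> strict_mono r \<and>
          limitin (mtuple_topology n g) (\<sigma> \<circ> r) l sequentially"
        using lS by blast
    qed
  qed
qed

text \<open>The image lies in the ball by the factor 1. Were it interior, the norm of its pencil
  would be a uniform factor below 1, placing \<open>X\<close> in the interior of the
  spectrahedron.\<close>

lemma convexotonic_map_frontier:
  assumes A: "A \<in> mtuples d g" and C: "C \<in> mtuples d h"
    and indep: "lin_indep_tuple d (A @ C)" and st: "structure_tuple d (A @ C) \<Xi>" and n: "1 \<le> n"
    and X: "X \<in> mtuple_topology n g frontier_of free_spectrahedron d A n"
  shows "X \<in> dom (convexotonic_map g \<Xi> n)"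
    "the (convexotonic_map g \<Xi> n X) \<in>
      mtuple_topology n (g + h) frontier_of spectraball d (A @ C) n"
proof -
  let ?J = "A @ C" and ?N = "d * n"
  note J = mtuples_append[OF A C]
  have "mtuple_topology n g frontier_of free_spectrahedron d A n =
    free_spectrahedron d A n - mtuple_topology n g interior_of free_spectrahedron d A n"
    \<comment> \<open>Closedness puts boundary points inside the spectrahedron itself, which is what
      makes \<open>I + T\<close> invertible and the map defined there.\<close>
    by (rule mtuple_frontier) (use free_spectrahedron_iff[OF A] free_spectrahedron_complement_open[OF A] in blast)+
  then have XD: "X \<in> free_spectrahedron d A n"
    and XI: "X \<notin> mtuple_topology n g interior_of free_spectrahedron d A n" using X by auto
  have Xm: "X \<in> mtuples n g" and le: "\<And>v. v \<in> carrier_vec ?N \<Longrightarrow>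
      vnorm (Lam d n A X *\<^sub>v v) \<le> 1 * vnorm (v + Lam d n A X *\<^sub>v v)"
    using XD by (auto simp: free_spectrahedron_iff[OF A])
  have det: "det (1\<^sub>m ?N + Lam d n A X) \<noteq> 0" by (rule det_one_plus_nonzero[OF Lam_carrier[OF A Xm] le])
  obtain Y where Y: "convexotonic_map g \<Xi> n X = Some Y" "Y \<in> mtuples n (g + h)"
    "Lam d n ?J Y * (1\<^sub>m ?N + Lam d n A X) = Lam d n A X"
    using convexotonic_map_Cayley[OF A C indep st n Xm det] .
  note iff = op_norm_Cayley_le_iff[OF Lam_carrier[OF A Xm] Lam_carrier[OF J Y(2)] Y(3) det]
  have "op_norm (Lam d n ?J Y) \<le> 1" using iff[of 1] le by simp
  then have YB: "Y \<in> spectraball d ?J n" using Y(2) mtuplesD(1)[OF J] by (simp add: spectraball_def)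
  have "Y \<notin> mtuple_topology n (g + h) interior_of spectraball d ?J n"
  proof
    assume "Y \<in> mtuple_topology n (g + h) interior_of spectraball d ?J n"
    then have lt: "op_norm (Lam d n ?J Y) < 1" by (simp add: spectraball_interior_iff[OF J])
    have "X \<in> mtuple_topology n g interior_of free_spectrahedron d A n"
      by (rule free_spectrahedron_interiorI[OF A Xm op_norm_nonneg lt])
        (use iff[OF op_norm_nonneg, of "Lam d n ?J Y"] in blast)
    then show False using XI by blast
  qed
  moreover have "Y \<in> mtuple_topology n (g + h) closure_of spectraball d ?J n"
  proof -
    have "spectraball d ?J n \<subseteq> topspace (mtuple_topology n (g + h))"
      unfolding mtuple_topology_def Metric_space.topspace_mtopology[OF Metric_space_mtuples]
      using mtuplesD(1)[OF J] by (auto simp: spectraball_def)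
    then show ?thesis using closure_of_subset YB by blast
  qed
  ultimately show "X \<in> dom (convexotonic_map g \<Xi> n)"
    "the (convexotonic_map g \<Xi> n X) \<in> mtuple_topology n (g + h) frontier_of spectraball d ?J n"
    using Y(1) by (auto simp: frontier_of_def)
qed

subsection \<open>Value and derivative at the origin\<close>

lemma convexotonic_map_zero:
  assumes A: "A \<in> mtuples d g" and C: "C \<in> mtuples d h"
    and indep: "lin_indep_tuple d (A @ C)" and st: "structure_tuple d (A @ C) \<Xi>" and n: "1 \<le> n"
  shows "convexotonic_map g \<Xi> n (mtuple_zero n g) = Some (mtuple_zero n (g + h))"
proof -
  note J = mtuples_append[OF A C] and Z = mtuple_zero_mtuples
  have one: "1\<^sub>m (d * n) + Lam d n A (mtuple_zero n g) = 1\<^sub>m (d * n)" by (simp add: Lam_zero[OF A])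
  then have det: "det (1\<^sub>m (d * n) + Lam d n A (mtuple_zero n g)) \<noteq> 0" by simp
  obtain Y where Y: "convexotonic_map g \<Xi> n (mtuple_zero n g) = Some Y" "Y \<in> mtuples n (g + h)"
    "Lam d n (A @ C) Y * (1\<^sub>m (d * n) + Lam d n A (mtuple_zero n g)) = Lam d n A (mtuple_zero n g)"
    using convexotonic_map_Cayley[OF A C indep st n Z det] .
  have "Lam d n (A @ C) Y = Lam d n (A @ C) (mtuple_zero n (g + h))"
    using Y(3) Lam_carrier[OF J Y(2)] unfolding one by (simp add: Lam_zero[OF A] Lam_zero[OF J])
  then show ?thesis using Y(1) Lam_inject[OF J indep Y(2) Z] by blast
qed

lemma map2_add_zero_left:
  assumes "H \<in> mtuples n m"
  shows "map2 (+) (mtuple_zero n m) H = H"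
  by (rule nth_equalityI) (use mtuplesD[OF assms] mtuplesD(1)[OF mtuple_zero_mtuples[of n m]] in auto)

text \<open>From \<open>M + M T = T\<close> follows \<open>M - T = - M T\<close>, of norm at most
  \<open>2 |T|^2\<close> once \<open>|T| \<le> 1/2\<close>. So \<open>M\<close> agrees with the
  pencil of \<open>(H, 0)\<close> up to a quadratic error, and linear independence of
  \<open>J\<close> carries this back to tuples.\<close>

lemma convexotonic_map_has_derivative:
  assumes A: "A \<in> mtuples d g" and C: "C \<in> mtuples d h"
    and indep: "lin_indep_tuple d (A @ C)" and st: "structure_tuple d (A @ C) \<Xi>" and n: "1 \<le> n"
  shows "mtuple_has_derivative n g (g + h) (convexotonic_map g \<Xi> n)
    (\<lambda>H. H @ mtuple_zero n h) (mtuple_zero n g)"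
  unfolding mtuple_has_derivative_def
proof (intro conjI allI impI)
  let ?J = "A @ C" and ?N = "d * n"
  note J = mtuples_append[OF A C] and Z = mtuple_zero_mtuples
  have Zh: "map2 (+) (mtuple_zero n h) (mtuple_zero n h) = mtuple_zero n h"
    by (rule map2_add_zero_left[OF Z])
  have Zs: "map ((\<cdot>\<^sub>m) a) (mtuple_zero n h) = mtuple_zero n h" for a
    by (simp add: mtuple_zero_def)
  show "linear_mtuple_map n g (g + h) (\<lambda>H. H @ mtuple_zero n h)"
    unfolding linear_mtuple_map_def using mtuplesD(1) mtuples_append[OF _ Z] by (auto simp: Zh Zs)
  fix \<epsilon> :: real assume \<epsilon>: "0 < \<epsilon>"
  obtain K1 where K1: "0 < K1" "\<And>X Y. X \<in> mtuples n g \<Longrightarrow> Y \<in> mtuples n g \<Longrightarrow>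
    op_norm (Lam d n A X - Lam d n A Y) \<le> K1 * mtuple_dist n g X Y"
    by (rule Lam_lipschitz[OF A, of n]) blast
  obtain K2 where K2: "0 < K2" "\<And>X Y. X \<in> mtuples n (g + h) \<Longrightarrow> Y \<in> mtuples n (g + h) \<Longrightarrow>
    mtuple_dist n (g + h) X Y \<le> K2 * op_norm (Lam d n ?J X - Lam d n ?J Y)"
    by (rule Lam_bounded_below[OF J indep, of n]) blast
  \<comment> \<open>The first bound gives \<open>|T| \<le> 1/2\<close>, the second makes the
    coefficient \<open>2 * K2 * K1^2 * \<eta>\<close> of the final estimate at most
    \<epsilon>.\<close>
  define \<delta> where "\<delta> = min (1 / (2 * K1)) (\<epsilon> / (2 * K2 * K1\<^sup>2))"
  have \<delta>: "0 < \<delta>" using \<epsilon> K1(1) K2(1) by (simp add: \<delta>_def)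
  show "\<exists>\<delta>>0. \<forall>H\<in>mtuples n g. mtuple_norm n g H < \<delta> \<longrightarrow>
      map2 (+) (mtuple_zero n g) H \<in> dom (convexotonic_map g \<Xi> n) \<and>
      mtuple_dist n (g + h) (the (convexotonic_map g \<Xi> n (map2 (+) (mtuple_zero n g) H)))
        (map2 (+) (the (convexotonic_map g \<Xi> n (mtuple_zero n g))) (H @ mtuple_zero n h))
      \<le> \<epsilon> * mtuple_norm n g H"
  proof (intro exI[of _ \<delta>] conjI \<delta> ballI impI)
    fix H assume H: "H \<in> mtuples n g" and "mtuple_norm n g H < \<delta>"
    define \<eta> where "\<eta> = mtuple_norm n g H"
    have \<eta>: "0 \<le> \<eta>" "\<eta> < \<delta>" using \<open>mtuple_norm n g H < \<delta>\<close> by (auto simp: \<eta>_def mtuple_norm_def)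
    let ?T = "Lam d n A H"
    have HZ: "H @ mtuple_zero n h \<in> mtuples n (g + h)" by (rule mtuples_append[OF H Z])
    have T: "?T \<in> carrier_mat ?N ?N" by (rule Lam_carrier[OF A H])
    have "?T - Lam d n A (mtuple_zero n g) = ?T" unfolding Lam_zero[OF A] using T by (intro eq_matI) auto
    then have T_le: "op_norm ?T \<le> K1 * \<eta>" using K1(2)[OF H Z] by (simp add: \<eta>_def mtuple_norm_def)
    have "K1 * \<eta> \<le> K1 * (1 / (2 * K1))"
      using \<eta> K1(1) by (intro mult_left_mono) (auto simp: \<delta>_def)
    then have half: "op_norm ?T \<le> 1 / 2" using T_le K1(1) by simp
    have "vnorm (?T *\<^sub>v v) \<le> 1 * vnorm (v + ?T *\<^sub>v v)" if v: "v \<in> carrier_vec ?N" for v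
    proof -
      have Tv: "?T *\<^sub>v v \<in> carrier_vec ?N" using T v by simp
      have "vnorm (?T *\<^sub>v v) \<le> op_norm ?T * vnorm v" using T v by (intro vnorm_mult_le_op_norm) auto
      also have "\<dots> \<le> 1 / 2 * vnorm v" using half by (intro mult_right_mono) auto
      finally have "vnorm (?T *\<^sub>v v) \<le> 1 / 2 * vnorm v" .
      moreover have "v = (v + ?T *\<^sub>v v) - ?T *\<^sub>v v" using v Tv T by (intro eq_vecI) auto
      then have "vnorm v \<le> vnorm (v + ?T *\<^sub>v v) + vnorm (?T *\<^sub>v v)"
        using vnorm_minus[OF add_carrier_vec[OF v Tv] Tv] by simp
      ultimately show ?thesis by linarith
    qed
    then have det: "det (1\<^sub>m ?N + ?T) \<noteq> 0" by (rule det_one_plus_nonzero[OF T])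
    obtain Y where Y: "convexotonic_map g \<Xi> n H = Some Y" "Y \<in> mtuples n (g + h)"
      "Lam d n ?J Y * (1\<^sub>m ?N + ?T) = ?T"
      using convexotonic_map_Cayley[OF A C indep st n H det] .
    let ?M = "Lam d n ?J Y"
    have M: "?M \<in> carrier_mat ?N ?N" by (rule Lam_carrier[OF J Y(2)])
    have MT: "?M * ?T \<in> carrier_mat ?N ?N" using M T by simp
    have sum: "?M + ?M * ?T = ?T" using Y(3) mult_add_distrib_mat[OF M one_carrier_mat T] M by simp
    have diff: "?M - ?T = (-1) \<cdot>\<^sub>m (?M * ?T)"
    proof (rule eq_matI)
      fix i j assume "i < dim_row ((-1) \<cdot>\<^sub>m (?M * ?T))" "j < dim_col ((-1) \<cdot>\<^sub>m (?M * ?T))"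
      then have ij: "i < ?N" "j < ?N" using M T by auto
      have "?T $$ (i, j) = ?M $$ (i, j) + (?M * ?T) $$ (i, j)"
        using arg_cong[OF sum, of "\<lambda>P. P $$ (i, j)"] ij M T MT by (simp del: index_mult_mat)
      then show "(?M - ?T) $$ (i, j) = ((-1) \<cdot>\<^sub>m (?M * ?T)) $$ (i, j)"
        using ij M T MT by (simp del: index_mult_mat(1))
    qed (use M T in auto)
    have diff_le: "op_norm (?M - ?T) \<le> op_norm ?M * op_norm ?T"
      unfolding diff using op_norm_smult_le[of "-1" "?M * ?T"] op_norm_mult[OF M T] by simp
    have "?M = ?T + (?M - ?T)" using M T by (intro eq_matI) auto
    then have "op_norm ?M \<le> op_norm ?T + op_norm (?M - ?T)"
      using op_norm_add[OF T minus_carrier_mat[OF T], of ?M] by simp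
    \<comment> \<open>Half of the norm of \<open>?M\<close> is absorbed on the left, which bounds it
      by twice the norm of \<open>?T\<close>.\<close>
    also have "\<dots> \<le> op_norm ?T + op_norm ?M * (1 / 2)"
      using diff_le half mult_left_mono[OF half op_norm_nonneg[of ?M]] by linarith
    finally have M_le: "op_norm ?M \<le> 2 * op_norm ?T" by simp
    have "op_norm (?M - ?T) \<le> 2 * op_norm ?T * op_norm ?T"
      using diff_le mult_right_mono[OF M_le op_norm_nonneg[of ?T]] by linarith
    also have "\<dots> \<le> 2 * (K1 * \<eta>) * (K1 * \<eta>)"
      using T_le op_norm_nonneg[of ?T] by (intro mult_mono) auto
    finally have sq: "op_norm (?M - ?T) \<le> 2 * K1\<^sup>2 * \<eta> * \<eta>" by (simp add: power2_eq_square mult_ac)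
    have "mtuple_dist n (g + h) Y (H @ mtuple_zero n h) \<le> K2 * op_norm (?M - ?T)"
      using K2(2)[OF Y(2) HZ] by (simp add: Lam_append_zero[OF A C H])
    also have "\<dots> \<le> K2 * (2 * K1\<^sup>2 * \<eta> * \<eta>)" using sq K2(1) by (intro mult_left_mono) auto
    also have "\<dots> = (2 * K2 * K1\<^sup>2 * \<eta>) * \<eta>" by (simp add: mult_ac)
    also have "\<dots> \<le> \<epsilon> * \<eta>"
    proof (intro mult_right_mono \<eta>)
      have "2 * K2 * K1\<^sup>2 * \<eta> \<le> 2 * K2 * K1\<^sup>2 * (\<epsilon> / (2 * K2 * K1\<^sup>2))"
        using \<eta> K1(1) K2(1) by (intro mult_left_mono) (auto simp: \<delta>_def)
      then show "2 * K2 * K1\<^sup>2 * \<eta> \<le> \<epsilon>" using K1(1) K2(1) by simp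
    qed
    finally have "mtuple_dist n (g + h) Y (H @ mtuple_zero n h) \<le> \<epsilon> * mtuple_norm n g H"
      by (simp add: \<eta>_def)
    moreover have "map2 (+) (the (convexotonic_map g \<Xi> n (mtuple_zero n g))) (H @ mtuple_zero n h) =
        H @ mtuple_zero n h"
      unfolding convexotonic_map_zero[OF A C indep st n] option.sel by (rule map2_add_zero_left[OF HZ])
    ultimately show "map2 (+) (mtuple_zero n g) H \<in> dom (convexotonic_map g \<Xi> n)"
      "mtuple_dist n (g + h) (the (convexotonic_map g \<Xi> n (map2 (+) (mtuple_zero n g) H)))
        (map2 (+) (the (convexotonic_map g \<Xi> n (mtuple_zero n g))) (H @ mtuple_zero n h))
      \<le> \<epsilon> * mtuple_norm n g H"
      unfolding map2_add_zero_left[OF H] using Y(1) by auto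
  qed
qed

theorem corollary1p4:
  fixes d g h :: nat and A C J :: "complex mat list"
  assumes A: "A \<in> mtuples d g"
    and A_indep: "lin_indep_tuple d A"
    and C: "C \<in> mtuples d h"
    and J: "J = A @ C"
    and J_indep: "lin_indep_tuple d J"
    and J_spans: "tuple_span d J = generated_algebra d A"
  shows "\<exists>f. free_rational_map g (g + h) f \<and>
    (\<forall>n\<ge>1.
      f n (mtuple_zero n g) = Some (mtuple_zero n (g + h)) \<and>
      mtuple_has_derivative n g (g + h) (f n) (\<lambda>H. H @ mtuple_zero n h) (mtuple_zero n g) \<and>
      injective_proper_map_into n g (g + h) (f n)
        (mtuple_topology n g interior_of free_spectrahedron d A n)
        (mtuple_topology n (g + h) interior_of spectraball d J n) \<and>
      (\<forall>X \<in> mtuple_topology n g frontier_of free_spectrahedron d A n.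
        X \<in> dom (f n) \<and>
        the (f n X) \<in> mtuple_topology n (g + h) frontier_of spectraball d J n)) \<and>
    (\<exists>!\<Xi>. structure_tuple d J \<Xi>) \<and>
    (\<forall>\<Xi>. structure_tuple d J \<Xi> \<longrightarrow>
      convexotonic (g + h) \<Xi> \<and> (\<forall>n\<ge>1. f n = convexotonic_map g \<Xi> n))"
proof -
  note Jm = mtuples_append[OF A C, folded J]
  have ex1: "\<exists>!\<Xi>. structure_tuple d J \<Xi>"
    \<comment> \<open>The spanning hypothesis identifies the span of \<open>J\<close> with the
      algebra generated by \<open>A\<close>, so products of entries of \<open>J\<close> stay in the
      span.\<close>
    using structure_tuple_ex1[OF Jm J_indep] mat_subalgebra_generated[OF A] J_spans by simp
  then obtain \<Xi> where st: "structure_tuple d J \<Xi>" by blast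
  then have \<Xi>: "\<Xi> \<in> mtuples (g + h) (g + h)" using mtuplesD(1)[OF Jm] by (simp add: structure_tuple_def)
  note facts = A C J_indep[unfolded J] st[unfolded J]
  show ?thesis
  proof (intro exI[of _ "convexotonic_map g \<Xi>"] conjI allI impI ballI ex1)
    show "free_rational_map g (g + h) (convexotonic_map g \<Xi>)"
      by (rule free_rational_convexotonic_map[OF \<Xi>])
    show "convexotonic_map g \<Xi> n (mtuple_zero n g) = Some (mtuple_zero n (g + h))" if "1 \<le> n" for n
      by (rule convexotonic_map_zero[OF facts that])
    show "mtuple_has_derivative n g (g + h) (convexotonic_map g \<Xi> n) (\<lambda>H. H @ mtuple_zero n h)
        (mtuple_zero n g)" if "1 \<le> n" for n
      by (rule convexotonic_map_has_derivative[OF facts that])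
    show "injective_proper_map_into n g (g + h) (convexotonic_map g \<Xi> n)
        (mtuple_topology n g interior_of free_spectrahedron d A n)
        (mtuple_topology n (g + h) interior_of spectraball d J n)" if "1 \<le> n" for n
      unfolding J by (rule convexotonic_map_proper[OF A C A_indep facts(3,4) that])
    show "X \<in> dom (convexotonic_map g \<Xi> n)"
      "the (convexotonic_map g \<Xi> n X) \<in> mtuple_topology n (g + h) frontier_of spectraball d J n"
      if "1 \<le> n" "X \<in> mtuple_topology n g frontier_of free_spectrahedron d A n" for n X
      unfolding J by (rule convexotonic_map_frontier[OF facts that])+
    fix \<Xi>' assume st': "structure_tuple d J \<Xi>'"
    show "convexotonic (g + h) \<Xi>'" by (rule structure_tuple_convexotonic[OF Jm J_indep st'])
    \<comment> \<open>The map was built from one structure tuple; uniqueness identifies it with any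
      other.\<close>
    show "convexotonic_map g \<Xi> n = convexotonic_map g \<Xi>' n" for n using ex1 st st' by auto
  qed
qed

end
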